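(* Let $\mathscr{X}$ be a finitely well-complete, locally small, well-pointed cartesian closed category, and let $\mathbb{L}$ be a commutative $\mathscr{X}$-monad on $\underline{\mathscr{X}}$ with tensor products of algebras. Let $(Z,a)$ be an algebra of the accessible distribution monad $\widetilde{\mathbb{D}}$, let $f:X\times Y\to Z$ be a morphism in $\mathscr{X}$, and let $\mu,\nu$ be accessible distributions on $X,Y$, respectively. Then $$\int_y\int_x f(x,y)\,d\mu\,d\nu=\int f\,d(\mu\otimes\nu)=\int_x\int_y f(x,y)\,d\nu\,d\mu.$$
   Context: Well-pointed: $\mathscr{X}(1,-):\mathscr{X}\to\mathbf{Set}$ is faithful; elements of an object $X$ are morphisms $1\to X$, and morphisms are identified with the functions they induce on elements. Finitely well-complete: having finite limits and intersections (fibre products) of arbitrary class-indexed families of strong monomorphisms with common codomain. $\underline{\mathscr{X}}$ is $\mathscr{X}$ enriched in itself. For an $\mathscr{X}$-monad $\mathbb{T}=(T,e,m)$ on $\underline{\mathscr{X}}$, let $t'_{XY}:TX\times Y\to T(X\times Y)$ be the transpose of $Y\to\underline{\mathscr{X}}(X,X\times Y)\xrightarrow{T}\underline{\mathscr{X}}(TX,T(X\times Y))$ and $t''_{XY}:X\times TY\to T(X\times Y)$ the transpose of $X\to\underline{\mathscr{X}}(Y,X\times Y)\xrightarrow{T}\underline{\mathscr{X}}(TY,T(X\times Y))$; put $\otimes^{\mathbb{T}}_{XY}:=m\cdot Tt'_{XY}\cdot t''_{TX,Y}$ and $\widetilde{\otimes}^{\mathbb{T}}_{XY}:=m\cdot Tt''_{XY}\cdot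 t'_{X,TY}$. $\mathbb{T}$ is commutative if these coincide for all $X,Y$. A commutative $\mathbb{L}=(L,\eta,\mu^{\mathbb{L}})$ has tensor products of algebras if for all algebras $(X,a),(Y,b)$ the pair $\mu^{\mathbb{L}}\cdot L\otimes^{\mathbb{L}}_{XY},\ L(a\times b):(L(LX\times LY),\mu^{\mathbb{L}})\rightrightarrows(L(X\times Y),\mu^{\mathbb{L}})$ has a coequalizer in $\mathscr{X}^{\mathbb{L}}$. $\mathscr{L}:=\mathscr{X}^{\mathbb{L}}$, with Eilenberg–Moore $\mathscr{X}$-adjunction $F\dashv G:\mathscr{L}\to\underline{\mathscr{X}}$ (unit $\eta$, counit $\varepsilon$). $\mathscr{L}$ is closed symmetric monoidal (tensor product: for algebras $A=(X,a)$, $B=(Y,b)$, $A\otimes B$ is the coequalizer in $\mathscr{X}^{\mathbb{L}}$ of the pair $\mu^{\mathbb{L}}\cdot L\otimes^{\mathbb{L}}_{XY},\ L(a\times b):(L(LX\times LY),\mu^{\mathbb{L}})\rightrightarrows(L(X\times Y),\mu^{\mathbb{L}})$; unit object $R:=F1$; internal hom $\underline{\mathscr{L}}(A,B)$ with $G\underline{\mathscr{L}}(A,B)=\mathscr{L}(A,B)$, the hom-object of the Eilenberg–Moore $\mathscr{X}$-category); $\underline{\mathscr{L}}$ is $\mathscr{L}$ enriched in itself. $E^*:=\underline{\mathscr{L}}(E,R)$. $E\in\mathscr{L}$ is functionally complete if $\underline{\mathscr{L}}(h,E)$ is an isomorphism for every $h$ in $\mathscr{L}$ with $h^{**}$ an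 isomorphism. The functionally complete objects form an $\mathscr{L}$-reflective subcategory of $\underline{\mathscr{L}}$, with idempotent $\mathscr{L}$-monad $\widetilde{\mathbb{H}}=(\widetilde{H},\widetilde{\mathfrak{d}},\widetilde{\mathfrak{k}})$. The accessible distribution monad $\widetilde{\mathbb{D}}$ on $\underline{\mathscr{X}}$ has $\widetilde{D}=G\widetilde{H}F$, unit $(G\widetilde{\mathfrak{d}}F)\cdot\eta$ and multiplication $(G\widetilde{\mathfrak{k}}F)\cdot(G\widetilde{H}\varepsilon\widetilde{H}F)$. An accessible distribution on $X$ is an element of $\widetilde{D}X$. Integral. For a $\widetilde{\mathbb{D}}$-algebra $(Z,a)$, a morphism $g:X\to Z$ and $\mu\in\widetilde{D}X$, put $\int_x g(x)\,d\mu:=\int g\,d\mu:=(a\cdot\widetilde{D}g)(\mu)\in Z$. For $f:X\times Y\to Z$, the functions $y\mapsto\int_x f(x,y)\,d\mu$ and $x\mapsto\int_y f(x,y)\,d\nu$ are morphisms in $\mathscr{X}$, so iterated integrals make sense. $\mu\otimes\nu:=\otimes^{\widetilde{\mathbb{D}}}_{XY}(\mu,\nu)\in\widetilde{D}(X\times Y)$. *)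

theory Defs
  imports Main
begin

section \<open>Categories\<close>

text \<open>Hom-classes are sets, so every category here is locally small, and a class of objects or
  arrows is an arbitrary set.  Different hom-sets may overlap, as they do for algebras when an
  algebra homomorphism is identified with its underlying morphism; notions that depend on the
  domain and codomain of an arrow therefore take them as arguments.\<close>

record ('o, 'a) cat =
  Ob :: "'o set"
  Hom :: "'o \<Rightarrow> 'o \<Rightarrow> 'a set"
  Id :: "'o \<Rightarrow> 'a"
  Comp :: "'a \<Rightarrow> 'a \<Rightarrow> 'a"  (infixr "\<cdot>\<index>" 70)

locale category =
  fixes C :: "('o, 'a, 'm) cat_scheme" (structure)
  assumes hom_ob: "f \<in> Hom C A B \<Longrightarrow> A \<in> Ob C \<and> B \<in> Ob C"
    and id_in_hom: "A \<in> Ob C \<Longrightarrow> Id C A \<in> Hom C A A"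
    and comp_in_hom: "f \<in> Hom C A B \<Longrightarrow> g \<in> Hom C B D \<Longrightarrow> g \<cdot> f \<in> Hom C A D"
    and comp_id: "f \<in> Hom C A B \<Longrightarrow> f \<cdot> Id C A = f"
    and id_comp: "f \<in> Hom C A B \<Longrightarrow> Id C B \<cdot> f = f"
    and comp_assoc: "f \<in> Hom C A B \<Longrightarrow> g \<in> Hom C B D \<Longrightarrow> h \<in> Hom C D E \<Longrightarrow>
      (h \<cdot> g) \<cdot> f = h \<cdot> (g \<cdot> f)"

definition is_iso :: "('o, 'a, 'm) cat_scheme \<Rightarrow> 'o \<Rightarrow> 'o \<Rightarrow> 'a \<Rightarrow> bool" where
  "is_iso C A B f \<longleftrightarrow> f \<in> Hom C A B \<and>
     (\<exists>g \<in> Hom C B A. g \<cdot>\<^bsub>C\<^esub> f = Id C A \<and> f \<cdot>\<^bsub>C\<^esub> g = Id C B)"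

definition is_mono :: "('o, 'a, 'm) cat_scheme \<Rightarrow> 'o \<Rightarrow> 'o \<Rightarrow> 'a \<Rightarrow> bool" where
  "is_mono C A B f \<longleftrightarrow> f \<in> Hom C A B \<and>
     (\<forall>D. \<forall>g \<in> Hom C D A. \<forall>h \<in> Hom C D A. f \<cdot>\<^bsub>C\<^esub> g = f \<cdot>\<^bsub>C\<^esub> h \<longrightarrow> g = h)"

definition is_epi :: "('o, 'a, 'm) cat_scheme \<Rightarrow> 'o \<Rightarrow> 'o \<Rightarrow> 'a \<Rightarrow> bool" where
  "is_epi C A B f \<longleftrightarrow> f \<in> Hom C A B \<and>
     (\<forall>D. \<forall>g \<in> Hom C B D. \<forall>h \<in> Hom C B D. g \<cdot>\<^bsub>C\<^esub> f = h \<cdot>\<^bsub>C\<^esub> f \<longrightarrow> g = h)"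

definition is_strong_mono :: "('o, 'a, 'm) cat_scheme \<Rightarrow> 'o \<Rightarrow> 'o \<Rightarrow> 'a \<Rightarrow> bool" where
  "is_strong_mono C A B m \<longleftrightarrow> is_mono C A B m \<and>
     (\<forall>P Q e. is_epi C P Q e \<longrightarrow>
        (\<forall>u \<in> Hom C P A. \<forall>v \<in> Hom C Q B. m \<cdot>\<^bsub>C\<^esub> u = v \<cdot>\<^bsub>C\<^esub> e \<longrightarrow>
           (\<exists>w \<in> Hom C Q A. w \<cdot>\<^bsub>C\<^esub> e = u \<and> m \<cdot>\<^bsub>C\<^esub> w = v)))"

definition is_equalizer ::
    "('o, 'a, 'm) cat_scheme \<Rightarrow> 'o \<Rightarrow> 'o \<Rightarrow> 'a \<Rightarrow> 'a \<Rightarrow> 'o \<Rightarrow> 'a \<Rightarrow> bool" where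
  "is_equalizer C A B f g E i \<longleftrightarrow> i \<in> Hom C E A \<and> f \<cdot>\<^bsub>C\<^esub> i = g \<cdot>\<^bsub>C\<^esub> i \<and>
     (\<forall>D. \<forall>h \<in> Hom C D A. f \<cdot>\<^bsub>C\<^esub> h = g \<cdot>\<^bsub>C\<^esub> h \<longrightarrow> (\<exists>!u. u \<in> Hom C D E \<and> i \<cdot>\<^bsub>C\<^esub> u = h))"

definition is_coequalizer ::
    "('o, 'a, 'm) cat_scheme \<Rightarrow> 'o \<Rightarrow> 'o \<Rightarrow> 'a \<Rightarrow> 'a \<Rightarrow> 'o \<Rightarrow> 'a \<Rightarrow> bool" where
  "is_coequalizer C A B f g Q q \<longleftrightarrow> q \<in> Hom C B Q \<and> q \<cdot>\<^bsub>C\<^esub> f = q \<cdot>\<^bsub>C\<^esub> g \<and>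
     (\<forall>D. \<forall>h \<in> Hom C B D. h \<cdot>\<^bsub>C\<^esub> f = h \<cdot>\<^bsub>C\<^esub> g \<longrightarrow> (\<exists>!u. u \<in> Hom C Q D \<and> u \<cdot>\<^bsub>C\<^esub> q = h))"

definition is_functor ::
    "('i, 'j, 'n) cat_scheme \<Rightarrow> ('o, 'a, 'm) cat_scheme \<Rightarrow>
     ('i \<Rightarrow> 'o) \<Rightarrow> ('i \<Rightarrow> 'i \<Rightarrow> 'j \<Rightarrow> 'a) \<Rightarrow> bool" where
  "is_functor J C Fo Fa \<longleftrightarrow>
     (\<forall>i \<in> Ob J. Fo i \<in> Ob C \<and> Fa i i (Id J i) = Id C (Fo i)) \<and>
     (\<forall>i j. \<forall>s \<in> Hom J i j. Fa i j s \<in> Hom C (Fo i) (Fo j)) \<and>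
     (\<forall>i j k. \<forall>s \<in> Hom J i j. \<forall>t \<in> Hom J j k.
        Fa i k (t \<cdot>\<^bsub>J\<^esub> s) = Fa j k t \<cdot>\<^bsub>C\<^esub> Fa i j s)"

definition is_cone ::
    "('i, 'j, 'n) cat_scheme \<Rightarrow> ('o, 'a, 'm) cat_scheme \<Rightarrow>
     ('i \<Rightarrow> 'o) \<Rightarrow> ('i \<Rightarrow> 'i \<Rightarrow> 'j \<Rightarrow> 'a) \<Rightarrow> 'o \<Rightarrow> ('i \<Rightarrow> 'a) \<Rightarrow> bool" where
  "is_cone J C Fo Fa P p \<longleftrightarrow> P \<in> Ob C \<and>
     (\<forall>i \<in> Ob J. p i \<in> Hom C P (Fo i)) \<and>
     (\<forall>i j. \<forall>s \<in> Hom J i j. Fa i j s \<cdot>\<^bsub>C\<^esub> p i = p j)"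

definition is_limit ::
    "('i, 'j, 'n) cat_scheme \<Rightarrow> ('o, 'a, 'm) cat_scheme \<Rightarrow>
     ('i \<Rightarrow> 'o) \<Rightarrow> ('i \<Rightarrow> 'i \<Rightarrow> 'j \<Rightarrow> 'a) \<Rightarrow> 'o \<Rightarrow> ('i \<Rightarrow> 'a) \<Rightarrow> bool" where
  "is_limit J C Fo Fa P p \<longleftrightarrow> is_cone J C Fo Fa P p \<and>
     (\<forall>Q q. is_cone J C Fo Fa Q q \<longrightarrow>
        (\<exists>!u. u \<in> Hom C Q P \<and> (\<forall>i \<in> Ob J. p i \<cdot>\<^bsub>C\<^esub> u = q i)))"

text \<open>Every finite category is isomorphic to one whose objects and arrows are natural numbers.\<close>

definition has_finite_limits :: "('o, 'a, 'm) cat_scheme \<Rightarrow> bool" where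
  "has_finite_limits C \<longleftrightarrow>
     (\<forall>(J :: (nat, nat) cat) Fo Fa.
        category J \<and> finite (Ob J) \<and> (\<forall>i j. finite (Hom J i j)) \<and> is_functor J C Fo Fa \<longrightarrow>
        (\<exists>P p. is_limit J C Fo Fa P p))"

text \<open>The fibre product of a family \<open>m i : S i \<rightarrow> B\<close> indexed by \<open>I\<close>; for empty \<open>I\<close> it is \<open>B\<close>
  itself.\<close>

definition is_fibre_product ::
    "('o, 'a, 'm) cat_scheme \<Rightarrow> 'o \<Rightarrow> 'i set \<Rightarrow> ('i \<Rightarrow> 'o) \<Rightarrow> ('i \<Rightarrow> 'a) \<Rightarrow>
     'o \<Rightarrow> 'a \<Rightarrow> ('i \<Rightarrow> 'a) \<Rightarrow> bool" where
  "is_fibre_product C B I S m P p q \<longleftrightarrow>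
     p \<in> Hom C P B \<and> (\<forall>i \<in> I. q i \<in> Hom C P (S i) \<and> m i \<cdot>\<^bsub>C\<^esub> q i = p) \<and>
     (\<forall>Q p' q'. p' \<in> Hom C Q B \<and> (\<forall>i \<in> I. q' i \<in> Hom C Q (S i) \<and> m i \<cdot>\<^bsub>C\<^esub> q' i = p') \<longrightarrow>
        (\<exists>!u. u \<in> Hom C Q P \<and> p \<cdot>\<^bsub>C\<^esub> u = p' \<and> (\<forall>i \<in> I. q i \<cdot>\<^bsub>C\<^esub> u = q' i)))"

text \<open>The index type \<open>'o \<times> 'a\<close> is large enough to index all pairs of an object and an arrow, so
  that no class-indexed family of strong monomorphisms is left out: a repetition of a monomorphism
  in a family does not affect the fibre product.\<close>

definition finitely_well_complete :: "('o, 'a, 'm) cat_scheme \<Rightarrow> bool" where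
  "finitely_well_complete C \<longleftrightarrow> has_finite_limits C \<and>
     (\<forall>B \<in> Ob C. \<forall>(I :: ('o \<times> 'a) set) S m.
        (\<forall>i \<in> I. is_strong_mono C (S i) B (m i)) \<longrightarrow>
        (\<exists>P p q. is_fibre_product C B I S m P p q))"


section \<open>Cartesian closed categories\<close>

text \<open>\<open>Exp X A B\<close> is the exponential written [A,B], and \<open>Ev X A B : [A,B] \<times> A \<rightarrow> B\<close>.\<close>

record ('o, 'a) ccc = "('o, 'a) cat" +
  One :: 'o
  Prod :: "'o \<Rightarrow> 'o \<Rightarrow> 'o"  (infixr "\<times>\<index>" 80)
  Fst :: "'o \<Rightarrow> 'o \<Rightarrow> 'a"
  Snd :: "'o \<Rightarrow> 'o \<Rightarrow> 'a"
  Exp :: "'o \<Rightarrow> 'o \<Rightarrow> 'o"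
  Ev :: "'o \<Rightarrow> 'o \<Rightarrow> 'a"

definition pair :: "('o, 'a) ccc \<Rightarrow> 'o \<Rightarrow> 'o \<Rightarrow> 'o \<Rightarrow> 'a \<Rightarrow> 'a \<Rightarrow> 'a" where
  "pair X D A B f g =
     (THE h. h \<in> Hom X D (A \<times>\<^bsub>X\<^esub> B) \<and> Fst X A B \<cdot>\<^bsub>X\<^esub> h = f \<and> Snd X A B \<cdot>\<^bsub>X\<^esub> h = g)"

definition prod_map :: "('o, 'a) ccc \<Rightarrow> 'o \<Rightarrow> 'o \<Rightarrow> 'o \<Rightarrow> 'o \<Rightarrow> 'a \<Rightarrow> 'a \<Rightarrow> 'a" where
  "prod_map X A B A' B' f g =
     pair X (A \<times>\<^bsub>X\<^esub> B) A' B' (f \<cdot>\<^bsub>X\<^esub> Fst X A B) (g \<cdot>\<^bsub>X\<^esub> Snd X A B)"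

text \<open>\<open>uncurry\<close> and \<open>curry\<close> are the two directions of the bijection between morphisms
  \<open>D \<rightarrow> [A,B]\<close> and \<open>D \<times> A \<rightarrow> B\<close>.\<close>

definition uncurry :: "('o, 'a) ccc \<Rightarrow> 'o \<Rightarrow> 'o \<Rightarrow> 'o \<Rightarrow> 'a \<Rightarrow> 'a" where
  "uncurry X D A B k = Ev X A B \<cdot>\<^bsub>X\<^esub> prod_map X D A (Exp X A B) A k (Id X A)"

definition curry :: "('o, 'a) ccc \<Rightarrow> 'o \<Rightarrow> 'o \<Rightarrow> 'o \<Rightarrow> 'a \<Rightarrow> 'a" where
  "curry X D A B f = (THE k. k \<in> Hom X D (Exp X A B) \<and> uncurry X D A B k = f)"

locale cartesian_closed = category X for X :: "('o, 'a) ccc" (structure) +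
  assumes one_ob: "One X \<in> Ob X"
    and terminal: "A \<in> Ob X \<Longrightarrow> \<exists>!f. f \<in> Hom X A (One X)"
    and proj_in_hom: "A \<in> Ob X \<Longrightarrow> B \<in> Ob X \<Longrightarrow>
      Fst X A B \<in> Hom X (A \<times>\<^bsub>X\<^esub> B) A \<and> Snd X A B \<in> Hom X (A \<times>\<^bsub>X\<^esub> B) B"
    and product: "f \<in> Hom X D A \<Longrightarrow> g \<in> Hom X D B \<Longrightarrow>
      \<exists>!h. h \<in> Hom X D (A \<times>\<^bsub>X\<^esub> B) \<and> Fst X A B \<cdot> h = f \<and> Snd X A B \<cdot> h = g"
    and ev_in_hom: "A \<in> Ob X \<Longrightarrow> B \<in> Ob X \<Longrightarrow> Ev X A B \<in> Hom X (Exp X A B \<times>\<^bsub>X\<^esub> A) B"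
    and exponential: "D \<in> Ob X \<Longrightarrow> A \<in> Ob X \<Longrightarrow> f \<in> Hom X (D \<times>\<^bsub>X\<^esub> A) B \<Longrightarrow>
      \<exists>!k. k \<in> Hom X D (Exp X A B) \<and> uncurry X D A B k = f"

definition elements :: "('o, 'a) ccc \<Rightarrow> 'o \<Rightarrow> 'a set" where
  "elements X A = Hom X (One X) A"

definition well_pointed :: "('o, 'a) ccc \<Rightarrow> bool" where
  "well_pointed X \<longleftrightarrow>
     (\<forall>A B. \<forall>f \<in> Hom X A B. \<forall>g \<in> Hom X A B.
        (\<forall>x \<in> elements X A. f \<cdot>\<^bsub>X\<^esub> x = g \<cdot>\<^bsub>X\<^esub> x) \<longrightarrow> f = g)"

definition bang :: "('o, 'a) ccc \<Rightarrow> 'o \<Rightarrow> 'a" where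
  "bang X A = (THE f. f \<in> Hom X A (One X))"

text \<open>Morphisms \<open>A \<rightarrow> B\<close> correspond to elements of \<open>[A,B]\<close>.\<close>

definition name_of :: "('o, 'a) ccc \<Rightarrow> 'o \<Rightarrow> 'o \<Rightarrow> 'a \<Rightarrow> 'a" where
  "name_of X A B f = curry X (One X) A B (f \<cdot>\<^bsub>X\<^esub> Snd X (One X) A)"

definition named_by :: "('o, 'a) ccc \<Rightarrow> 'o \<Rightarrow> 'o \<Rightarrow> 'a \<Rightarrow> 'a" where
  "named_by X A B n = Ev X A B \<cdot>\<^bsub>X\<^esub> pair X A (Exp X A B) A (n \<cdot>\<^bsub>X\<^esub> bang X A) (Id X A)"

text \<open>The self-enrichment of \<open>X\<close>: identities \<open>1 \<rightarrow> [A,A]\<close>, composition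
  \<open>[B,C] \<times> [A,B] \<rightarrow> [A,C]\<close>, and the actions \<open>[f,B] : [A',B] \<rightarrow> [A,B]\<close> of \<open>f : A \<rightarrow> A'\<close> and
  \<open>[A,g] : [A,B] \<rightarrow> [A,B']\<close> of \<open>g : B \<rightarrow> B'\<close>.\<close>

definition int_id :: "('o, 'a) ccc \<Rightarrow> 'o \<Rightarrow> 'a" where
  "int_id X A = name_of X A A (Id X A)"

definition int_comp :: "('o, 'a) ccc \<Rightarrow> 'o \<Rightarrow> 'o \<Rightarrow> 'o \<Rightarrow> 'a" where
  "int_comp X A B C =
     (let P = Exp X B C \<times>\<^bsub>X\<^esub> Exp X A B;
          g = Fst X (Exp X B C) (Exp X A B) \<cdot>\<^bsub>X\<^esub> Fst X P A;
          f = Snd X (Exp X B C) (Exp X A B) \<cdot>\<^bsub>X\<^esub> Fst X P A;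
          x = Snd X P A;
          fx = Ev X A B \<cdot>\<^bsub>X\<^esub> pair X (P \<times>\<^bsub>X\<^esub> A) (Exp X A B) A f x
      in curry X P A C (Ev X B C \<cdot>\<^bsub>X\<^esub> pair X (P \<times>\<^bsub>X\<^esub> A) (Exp X B C) B g fx))"

definition exp_pre :: "('o, 'a) ccc \<Rightarrow> 'o \<Rightarrow> 'o \<Rightarrow> 'o \<Rightarrow> 'a \<Rightarrow> 'a" where
  "exp_pre X A A' B f =
     curry X (Exp X A' B) A B
       (Ev X A' B \<cdot>\<^bsub>X\<^esub> prod_map X (Exp X A' B) A (Exp X A' B) A' (Id X (Exp X A' B)) f)"

definition exp_post :: "('o, 'a) ccc \<Rightarrow> 'o \<Rightarrow> 'o \<Rightarrow> 'o \<Rightarrow> 'a \<Rightarrow> 'a" where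
  "exp_post X A B B' g = curry X (Exp X A B) A B' (g \<cdot>\<^bsub>X\<^esub> Ev X A B)"


section \<open>Enriched functors and monads\<close>

text \<open>An enriched functor is given by its object map \<open>T\<close> and its actions
  \<open>Th A B : [A,B] \<rightarrow> [TA,TB]\<close> on hom-objects.\<close>

definition is_vfunctor :: "('o, 'a) ccc \<Rightarrow> ('o \<Rightarrow> 'o) \<Rightarrow> ('o \<Rightarrow> 'o \<Rightarrow> 'a) \<Rightarrow> bool" where
  "is_vfunctor X T Th \<longleftrightarrow>
     (\<forall>A \<in> Ob X. T A \<in> Ob X) \<and>
     (\<forall>A \<in> Ob X. \<forall>B \<in> Ob X. Th A B \<in> Hom X (Exp X A B) (Exp X (T A) (T B))) \<and>
     (\<forall>A \<in> Ob X. Th A A \<cdot>\<^bsub>X\<^esub> int_id X A = int_id X (T A)) \<and>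
     (\<forall>A \<in> Ob X. \<forall>B \<in> Ob X. \<forall>C \<in> Ob X.
        Th A C \<cdot>\<^bsub>X\<^esub> int_comp X A B C =
        int_comp X (T A) (T B) (T C) \<cdot>\<^bsub>X\<^esub>
          prod_map X (Exp X B C) (Exp X A B) (Exp X (T B) (T C)) (Exp X (T A) (T B))
            (Th B C) (Th A B))"

definition is_vnat ::
    "('o, 'a) ccc \<Rightarrow> ('o \<Rightarrow> 'o) \<Rightarrow> ('o \<Rightarrow> 'o \<Rightarrow> 'a) \<Rightarrow> ('o \<Rightarrow> 'o) \<Rightarrow> ('o \<Rightarrow> 'o \<Rightarrow> 'a) \<Rightarrow>
     ('o \<Rightarrow> 'a) \<Rightarrow> bool" where
  "is_vnat X S Sh T Th \<alpha> \<longleftrightarrow>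
     (\<forall>A \<in> Ob X. \<alpha> A \<in> Hom X (S A) (T A)) \<and>
     (\<forall>A \<in> Ob X. \<forall>B \<in> Ob X.
        exp_post X (S A) (S B) (T B) (\<alpha> B) \<cdot>\<^bsub>X\<^esub> Sh A B =
        exp_pre X (S A) (T A) (T B) (\<alpha> A) \<cdot>\<^bsub>X\<^esub> Th A B)"

record ('o, 'a) vmonad =
  TOb :: "'o \<Rightarrow> 'o"
  THom :: "'o \<Rightarrow> 'o \<Rightarrow> 'a"
  TUnit :: "'o \<Rightarrow> 'a"
  TMult :: "'o \<Rightarrow> 'a"

text \<open>The underlying ordinary functor: \<open>T f\<close> for \<open>f : A \<rightarrow> B\<close>.\<close>

definition vmap :: "('o, 'a) ccc \<Rightarrow> ('o, 'a) vmonad \<Rightarrow> 'o \<Rightarrow> 'o \<Rightarrow> 'a \<Rightarrow> 'a" where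
  "vmap X T A B f = named_by X (TOb T A) (TOb T B) (THom T A B \<cdot>\<^bsub>X\<^esub> name_of X A B f)"

definition is_vmonad :: "('o, 'a) ccc \<Rightarrow> ('o, 'a) vmonad \<Rightarrow> bool" where
  "is_vmonad X T \<longleftrightarrow>
     is_vfunctor X (TOb T) (THom T) \<and>
     is_vnat X (\<lambda>A. A) (\<lambda>A B. Id X (Exp X A B)) (TOb T) (THom T) (TUnit T) \<and>
     is_vnat X (\<lambda>A. TOb T (TOb T A)) (\<lambda>A B. THom T (TOb T A) (TOb T B) \<cdot>\<^bsub>X\<^esub> THom T A B)
       (TOb T) (THom T) (TMult T) \<and>
     (\<forall>A \<in> Ob X.
        TMult T A \<cdot>\<^bsub>X\<^esub> TUnit T (TOb T A) = Id X (TOb T A) \<and>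
        TMult T A \<cdot>\<^bsub>X\<^esub> vmap X T A (TOb T A) (TUnit T A) = Id X (TOb T A) \<and>
        TMult T A \<cdot>\<^bsub>X\<^esub> TMult T (TOb T A) =
          TMult T A \<cdot>\<^bsub>X\<^esub> vmap X T (TOb T (TOb T A)) (TOb T A) (TMult T A))"

text \<open>\<open>t' : TA \<times> B \<rightarrow> T(A \<times> B)\<close> and \<open>t'' : A \<times> TB \<rightarrow> T(A \<times> B)\<close>.\<close>

definition strength1 :: "('o, 'a) ccc \<Rightarrow> ('o, 'a) vmonad \<Rightarrow> 'o \<Rightarrow> 'o \<Rightarrow> 'a" where
  "strength1 X T A B =
     (let AB = A \<times>\<^bsub>X\<^esub> B;
          c = curry X B A AB (pair X (B \<times>\<^bsub>X\<^esub> A) A B (Snd X B A) (Fst X B A))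
      in uncurry X B (TOb T A) (TOb T AB) (THom T A AB \<cdot>\<^bsub>X\<^esub> c) \<cdot>\<^bsub>X\<^esub>
           pair X (TOb T A \<times>\<^bsub>X\<^esub> B) B (TOb T A) (Snd X (TOb T A) B) (Fst X (TOb T A) B))"

definition strength2 :: "('o, 'a) ccc \<Rightarrow> ('o, 'a) vmonad \<Rightarrow> 'o \<Rightarrow> 'o \<Rightarrow> 'a" where
  "strength2 X T A B =
     (let AB = A \<times>\<^bsub>X\<^esub> B;
          c = curry X A B AB (Id X AB)
      in uncurry X A (TOb T B) (TOb T AB) (THom T B AB \<cdot>\<^bsub>X\<^esub> c))"

text \<open>The two morphisms \<open>TA \<times> TB \<rightarrow> T(A \<times> B)\<close>.\<close>

definition otimes :: "('o, 'a) ccc \<Rightarrow> ('o, 'a) vmonad \<Rightarrow> 'o \<Rightarrow> 'o \<Rightarrow> 'a" where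
  "otimes X T A B =
     TMult T (A \<times>\<^bsub>X\<^esub> B) \<cdot>\<^bsub>X\<^esub>
     vmap X T (TOb T A \<times>\<^bsub>X\<^esub> B) (TOb T (A \<times>\<^bsub>X\<^esub> B)) (strength1 X T A B) \<cdot>\<^bsub>X\<^esub>
     strength2 X T (TOb T A) B"

definition otimes_tilde :: "('o, 'a) ccc \<Rightarrow> ('o, 'a) vmonad \<Rightarrow> 'o \<Rightarrow> 'o \<Rightarrow> 'a" where
  "otimes_tilde X T A B =
     TMult T (A \<times>\<^bsub>X\<^esub> B) \<cdot>\<^bsub>X\<^esub>
     vmap X T (A \<times>\<^bsub>X\<^esub> TOb T B) (TOb T (A \<times>\<^bsub>X\<^esub> B)) (strength2 X T A B) \<cdot>\<^bsub>X\<^esub>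
     strength1 X T A (TOb T B)"

definition is_commutative_vmonad :: "('o, 'a) ccc \<Rightarrow> ('o, 'a) vmonad \<Rightarrow> bool" where
  "is_commutative_vmonad X T \<longleftrightarrow> is_vmonad X T \<and>
     (\<forall>A \<in> Ob X. \<forall>B \<in> Ob X. otimes X T A B = otimes_tilde X T A B)"


section \<open>Algebras\<close>

definition algebras :: "('o, 'a) ccc \<Rightarrow> ('o, 'a) vmonad \<Rightarrow> ('o \<times> 'a) set" where
  "algebras X T = {(A, a). A \<in> Ob X \<and> a \<in> Hom X (TOb T A) A \<and>
     a \<cdot>\<^bsub>X\<^esub> TUnit T A = Id X A \<and>
     a \<cdot>\<^bsub>X\<^esub> vmap X T (TOb T A) A a = a \<cdot>\<^bsub>X\<^esub> TMult T A}"

text \<open>The Eilenberg-Moore category; the forgetful functor \<open>G\<close> is \<open>fst\<close> on objects and the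
  identity on arrows, and the component at \<open>E\<close> of the counit is \<open>snd E\<close>.\<close>

definition EM :: "('o, 'a) ccc \<Rightarrow> ('o, 'a) vmonad \<Rightarrow> ('o \<times> 'a, 'a) cat" where
  "EM X T = \<lparr>Ob = algebras X T,
     Hom = (\<lambda>E E'. {f \<in> Hom X (fst E) (fst E'). E \<in> algebras X T \<and> E' \<in> algebras X T \<and>
        f \<cdot>\<^bsub>X\<^esub> snd E = snd E' \<cdot>\<^bsub>X\<^esub> vmap X T (fst E) (fst E') f}),
     Id = (\<lambda>E. Id X (fst E)),
     Comp = Comp X\<rparr>"

definition free :: "('o, 'a) vmonad \<Rightarrow> 'o \<Rightarrow> 'o \<times> 'a" where
  "free T A = (TOb T A, TMult T A)"

definition has_tensor_products :: "('o, 'a) ccc \<Rightarrow> ('o, 'a) vmonad \<Rightarrow> bool" where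
  "has_tensor_products X L \<longleftrightarrow>
     (\<forall>(A, a) \<in> algebras X L. \<forall>(B, b) \<in> algebras X L.
        \<exists>Q q. is_coequalizer (EM X L)
          (free L (TOb L A \<times>\<^bsub>X\<^esub> TOb L B)) (free L (A \<times>\<^bsub>X\<^esub> B))
          (TMult L (A \<times>\<^bsub>X\<^esub> B) \<cdot>\<^bsub>X\<^esub>
             vmap X L (TOb L A \<times>\<^bsub>X\<^esub> TOb L B) (TOb L (A \<times>\<^bsub>X\<^esub> B)) (otimes X L A B))
          (vmap X L (TOb L A \<times>\<^bsub>X\<^esub> TOb L B) (A \<times>\<^bsub>X\<^esub> B)
             (prod_map X (TOb L A) (TOb L B) A B a b))
          Q q)"

text \<open>The hom-object of the Eilenberg-Moore \<open>X\<close>-category from \<open>(A,a)\<close> to \<open>(B,b)\<close>, with its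
  inclusion into \<open>[A,B]\<close>: the equalizer of \<open>[a,B]\<close> and
  \<open>[A,B] \<rightarrow> [LA,LB] \<rightarrow> [LA,B]\<close>.\<close>

definition em_equalizer ::
    "('o, 'a) ccc \<Rightarrow> ('o, 'a) vmonad \<Rightarrow> 'o \<times> 'a \<Rightarrow> 'o \<times> 'a \<Rightarrow> 'o \<times> 'a" where
  "em_equalizer X L E E' =
     (let A = fst E; a = snd E; B = fst E'; b = snd E'
      in SOME (K, i). is_equalizer X (Exp X A B) (Exp X (TOb L A) B)
           (exp_pre X (TOb L A) A B a)
           (exp_post X (TOb L A) (TOb L B) B b \<cdot>\<^bsub>X\<^esub> THom L A B) K i)"

definition em_hom ::
    "('o, 'a) ccc \<Rightarrow> ('o, 'a) vmonad \<Rightarrow> 'o \<times> 'a \<Rightarrow> 'o \<times> 'a \<Rightarrow> 'o" where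
  "em_hom X L E E' = fst (em_equalizer X L E E')"

definition em_incl ::
    "('o, 'a) ccc \<Rightarrow> ('o, 'a) vmonad \<Rightarrow> 'o \<times> 'a \<Rightarrow> 'o \<times> 'a \<Rightarrow> 'a" where
  "em_incl X L E E' = snd (em_equalizer X L E E')"

text \<open>The action \<open>[A,B] \<rightarrow> hom(FA,FB)\<close> of the free-algebra \<open>X\<close>-functor \<open>F\<close>.  That of \<open>G\<close> is
  \<open>em_incl\<close>.\<close>

definition free_hom :: "('o, 'a) ccc \<Rightarrow> ('o, 'a) vmonad \<Rightarrow> 'o \<Rightarrow> 'o \<Rightarrow> 'a" where
  "free_hom X L A B =
     (THE u. u \<in> Hom X (Exp X A B) (em_hom X L (free L A) (free L B)) \<and>
        em_incl X L (free L A) (free L B) \<cdot>\<^bsub>X\<^esub> u = THom L A B)"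


section \<open>The internal hom of algebras\<close>

text \<open>For an algebra \<open>(B,b)\<close>, the pointwise structure on \<open>[A,B]\<close> is the transpose of
  \<open>L[A,B] \<times> A \<rightarrow> L([A,B] \<times> A) \<rightarrow> LB \<rightarrow> B\<close> (first \<open>t'\<close>, then \<open>L Ev\<close>, then \<open>b\<close>).  Kock's internal
  hom, right adjoint to the tensor product of algebras, is the hom-object of the Eilenberg-Moore
  category regarded as a subalgebra of \<open>[A,B]\<close>.\<close>

definition pointwise :: "('o, 'a) ccc \<Rightarrow> ('o, 'a) vmonad \<Rightarrow> 'o \<Rightarrow> 'o \<times> 'a \<Rightarrow> 'a" where
  "pointwise X L A E' =
     (let B = fst E'; b = snd E'; AB = Exp X A B
      in curry X (TOb L AB) A B
           (b \<cdot>\<^bsub>X\<^esub> vmap X L (AB \<times>\<^bsub>X\<^esub> A) B (Ev X A B) \<cdot>\<^bsub>X\<^esub> strength1 X L AB A))"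

definition ihom ::
    "('o, 'a) ccc \<Rightarrow> ('o, 'a) vmonad \<Rightarrow> 'o \<times> 'a \<Rightarrow> 'o \<times> 'a \<Rightarrow> 'o \<times> 'a" where
  "ihom X L E E' =
     (let K = em_hom X L E E'; i = em_incl X L E E'
      in (K, THE s. s \<in> Hom X (TOb L K) K \<and>
            i \<cdot>\<^bsub>X\<^esub> s =
            pointwise X L (fst E) E' \<cdot>\<^bsub>X\<^esub> vmap X L K (Exp X (fst E) (fst E')) i))"

text \<open>The action \<open>ihom(E',K) \<rightarrow> ihom(E,K)\<close> of \<open>h : E \<rightarrow> E'\<close> and the action
  \<open>ihom(E,K) \<rightarrow> ihom(E,K')\<close> of \<open>g : K \<rightarrow> K'\<close>.\<close>

definition ihom_pre ::
    "('o, 'a) ccc \<Rightarrow> ('o, 'a) vmonad \<Rightarrow> 'o \<times> 'a \<Rightarrow> 'o \<times> 'a \<Rightarrow> 'o \<times> 'a \<Rightarrow> 'a \<Rightarrow> 'a" where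
  "ihom_pre X L E E' K h =
     (THE u. u \<in> Hom (EM X L) (ihom X L E' K) (ihom X L E K) \<and>
        em_incl X L E K \<cdot>\<^bsub>X\<^esub> u =
        exp_pre X (fst E) (fst E') (fst K) h \<cdot>\<^bsub>X\<^esub> em_incl X L E' K)"

definition ihom_post ::
    "('o, 'a) ccc \<Rightarrow> ('o, 'a) vmonad \<Rightarrow> 'o \<times> 'a \<Rightarrow> 'o \<times> 'a \<Rightarrow> 'o \<times> 'a \<Rightarrow> 'a \<Rightarrow> 'a" where
  "ihom_post X L E K K' g =
     (THE u. u \<in> Hom (EM X L) (ihom X L E K) (ihom X L E K') \<and>
        em_incl X L E K' \<cdot>\<^bsub>X\<^esub> u =
        exp_post X (fst E) (fst K) (fst K') g \<cdot>\<^bsub>X\<^esub> em_incl X L E K)"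

definition dual :: "('o, 'a) ccc \<Rightarrow> ('o, 'a) vmonad \<Rightarrow> 'o \<times> 'a \<Rightarrow> 'o \<times> 'a" where
  "dual X L E = ihom X L E (free L (One X))"

definition dual_map ::
    "('o, 'a) ccc \<Rightarrow> ('o, 'a) vmonad \<Rightarrow> 'o \<times> 'a \<Rightarrow> 'o \<times> 'a \<Rightarrow> 'a \<Rightarrow> 'a" where
  "dual_map X L E E' h = ihom_pre X L E E' (free L (One X)) h"

definition bidual_map ::
    "('o, 'a) ccc \<Rightarrow> ('o, 'a) vmonad \<Rightarrow> 'o \<times> 'a \<Rightarrow> 'o \<times> 'a \<Rightarrow> 'a \<Rightarrow> 'a" where
  "bidual_map X L E E' h = dual_map X L (dual X L E') (dual X L E) (dual_map X L E E' h)"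

definition functionally_complete ::
    "('o, 'a) ccc \<Rightarrow> ('o, 'a) vmonad \<Rightarrow> 'o \<times> 'a \<Rightarrow> bool" where
  "functionally_complete X L K \<longleftrightarrow> K \<in> Ob (EM X L) \<and>
     (\<forall>E E'. \<forall>h \<in> Hom (EM X L) E E'.
        is_iso (EM X L) (dual X L (dual X L E)) (dual X L (dual X L E')) (bidual_map X L E E' h) \<longrightarrow>
        is_iso (EM X L) (ihom X L E' K) (ihom X L E K) (ihom_pre X L E E' K h))"


section \<open>Enriched reflections and the accessible distribution monad\<close>

text \<open>A reflection onto the full subcategory of objects satisfying \<open>P\<close>, enriched in the category
  of \<open>L\<close>-algebras: the left adjoint is given by objects \<open>H E\<close> and units \<open>d E : E \<rightarrow> H E\<close>
  inducing isomorphisms of hom-objects (not only bijections of hom-sets) into every object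
  satisfying \<open>P\<close>.\<close>

definition is_L_reflection ::
    "('o, 'a) ccc \<Rightarrow> ('o, 'a) vmonad \<Rightarrow> ('o \<times> 'a \<Rightarrow> bool) \<Rightarrow>
     ('o \<times> 'a \<Rightarrow> 'o \<times> 'a) \<Rightarrow> ('o \<times> 'a \<Rightarrow> 'a) \<Rightarrow> bool" where
  "is_L_reflection X L P H d \<longleftrightarrow>
     (\<forall>E \<in> Ob (EM X L). H E \<in> Ob (EM X L) \<and> P (H E) \<and> d E \<in> Hom (EM X L) E (H E) \<and>
        (\<forall>K \<in> Ob (EM X L). P K \<longrightarrow>
           is_iso (EM X L) (ihom X L (H E) K) (ihom X L E K) (ihom_pre X L E (H E) K (d E))))"

text \<open>The rest of the induced idempotent monad is determined by \<open>H\<close> and \<open>d\<close>: its actions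
  \<open>ihom(E,E') \<rightarrow> ihom(HE,HE')\<close> by the enriched naturality of \<open>d\<close>, the underlying ordinary functor by
  the ordinary naturality, and its multiplication by the unit law.\<close>

definition refl_hom ::
    "('o, 'a) ccc \<Rightarrow> ('o, 'a) vmonad \<Rightarrow> ('o \<times> 'a \<Rightarrow> 'o \<times> 'a) \<Rightarrow> ('o \<times> 'a \<Rightarrow> 'a) \<Rightarrow>
     'o \<times> 'a \<Rightarrow> 'o \<times> 'a \<Rightarrow> 'a" where
  "refl_hom X L H d E E' =
     (THE u. u \<in> Hom (EM X L) (ihom X L E E') (ihom X L (H E) (H E')) \<and>
        ihom_pre X L E (H E) (H E') (d E) \<cdot>\<^bsub>X\<^esub> u = ihom_post X L E E' (H E') (d E'))"

definition refl_map ::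
    "('o, 'a) ccc \<Rightarrow> ('o, 'a) vmonad \<Rightarrow> ('o \<times> 'a \<Rightarrow> 'o \<times> 'a) \<Rightarrow> ('o \<times> 'a \<Rightarrow> 'a) \<Rightarrow>
     'o \<times> 'a \<Rightarrow> 'o \<times> 'a \<Rightarrow> 'a \<Rightarrow> 'a" where
  "refl_map X L H d E E' f =
     (THE g. g \<in> Hom (EM X L) (H E) (H E') \<and> g \<cdot>\<^bsub>X\<^esub> d E = d E' \<cdot>\<^bsub>X\<^esub> f)"

definition refl_mult ::
    "('o, 'a) ccc \<Rightarrow> ('o, 'a) vmonad \<Rightarrow> ('o \<times> 'a \<Rightarrow> 'o \<times> 'a) \<Rightarrow> ('o \<times> 'a \<Rightarrow> 'a) \<Rightarrow>
     'o \<times> 'a \<Rightarrow> 'a" where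
  "refl_mult X L H d E =
     (THE k. k \<in> Hom (EM X L) (H (H E)) (H E) \<and> k \<cdot>\<^bsub>X\<^esub> d (H E) = Id X (fst (H E)))"

definition accessible_distribution_monad ::
    "('o, 'a) ccc \<Rightarrow> ('o, 'a) vmonad \<Rightarrow> ('o \<times> 'a \<Rightarrow> 'o \<times> 'a) \<Rightarrow> ('o \<times> 'a \<Rightarrow> 'a) \<Rightarrow>
     ('o, 'a) vmonad" where
  "accessible_distribution_monad X L H d =
     \<lparr>TOb = (\<lambda>A. fst (H (free L A))),
      THom = (\<lambda>A B. em_incl X L (H (free L A)) (H (free L B)) \<cdot>\<^bsub>X\<^esub>
                refl_hom X L H d (free L A) (free L B) \<cdot>\<^bsub>X\<^esub> free_hom X L A B),
      TUnit = (\<lambda>A. d (free L A) \<cdot>\<^bsub>X\<^esub> TUnit L A),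
      TMult = (\<lambda>A. refl_mult X L H d (free L A) \<cdot>\<^bsub>X\<^esub>
                refl_map X L H d (free L (fst (H (free L A)))) (H (free L A))
                  (snd (H (free L A))))\<rparr>"


section \<open>Integrals\<close>

definition integral ::
    "('o, 'a) ccc \<Rightarrow> ('o, 'a) vmonad \<Rightarrow> 'o \<times> 'a \<Rightarrow> 'o \<Rightarrow> 'a \<Rightarrow> 'a \<Rightarrow> 'a" where
  "integral X D Z A g \<mu> = snd Z \<cdot>\<^bsub>X\<^esub> vmap X D A (fst Z) g \<cdot>\<^bsub>X\<^esub> \<mu>"

text \<open>The integral of a function on elements, identified with the morphism inducing it.\<close>

definition integral_fun ::
    "('o, 'a) ccc \<Rightarrow> ('o, 'a) vmonad \<Rightarrow> 'o \<times> 'a \<Rightarrow> 'o \<Rightarrow> ('a \<Rightarrow> 'a) \<Rightarrow> 'a \<Rightarrow> 'a" where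
  "integral_fun X D Z A \<phi> \<mu> =
     integral X D Z A
       (THE g. g \<in> Hom X A (fst Z) \<and> (\<forall>x \<in> elements X A. g \<cdot>\<^bsub>X\<^esub> x = \<phi> x)) \<mu>"

definition point :: "('o, 'a) ccc \<Rightarrow> 'o \<Rightarrow> 'o \<Rightarrow> 'a \<Rightarrow> 'a \<Rightarrow> 'a" where
  "point X A B x y = pair X (One X) A B x y"

definition product_distribution ::
    "('o, 'a) ccc \<Rightarrow> ('o, 'a) vmonad \<Rightarrow> 'o \<Rightarrow> 'o \<Rightarrow> 'a \<Rightarrow> 'a \<Rightarrow> 'a" where
  "product_distribution X D A B \<mu> \<nu> =
     otimes X D A B \<cdot>\<^bsub>X\<^esub> point X (TOb D A) (TOb D B) \<mu> \<nu>"

end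

theory Submission
  imports Defs
begin

text \<open>Since the category is well-pointed, every identity of morphisms, also of morphisms into
  exponentials, can be checked on global elements.  On elements, \<open>\<mu> \<otimes> \<nu>\<close> is by associativity of
  algebras the distribution whose integral is the iterated integral, in the order determined by
  which of the two tensors is used, so that Fubini's theorem amounts to commutativity of the
  accessible distribution monad.  Now let \<open>f : A \<times> B \<rightarrow> K\<close> with \<open>K\<close> in the reflective subcategory.
  Both iterated integrals of \<open>f\<close> are maps on \<open>HFA \<times> HFB\<close> that restrict to \<open>f\<close> along the units, and
  the first is a homomorphism in \<open>\<nu>\<close>, the second in \<open>\<mu>\<close>.  The point is that the first is a
  homomorphism in \<open>\<mu>\<close> as well: \<open>\<mu>\<close> is sent by a homomorphism to the element
  \<open>y \<mapsto> \<integral>\<^sub>x f(x,y) d\<mu>\<close> of \<open>ihom(FB,K)\<close>, which is isomorphic as an algebra to \<open>ihom(HFB,K)\<close> because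
  the reflection is enriched, and evaluation at \<open>\<nu>\<close> is a homomorphism \<open>ihom(HFB,K) \<rightarrow> K\<close>.
  Homomorphisms from \<open>HFA\<close> to \<open>K\<close> are determined by their restriction along the unit, so the two
  iterated integrals agree.\<close>

section \<open>Elements of a well-pointed cartesian closed category\<close>

text \<open>The algebra Z of the theorem is not assumed to be of the form \<open>H E\<close>, so
  uniqueness of homomorphisms into a reflective algebra cannot be applied to f itself. It is applied
  to the universal integrand, the unit \<open>A \<times> B \<rightarrow> D(A \<times> B)\<close>,
  where it says that the two tensors agree at (\<mu>, \<nu>); integrating f against this single
  distribution then gives both orders. The obstacle is homomorphy in the variable that is integrated
  first: for each y in B the inner integral is a homomorphism in \<mu>, but carrying this through
  the outer integral over \<nu> means that a map with values in a function space is a homomorphism.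
  This requires an algebra structure on hom-objects, and it is the commutativity of \<open>L\<close>
  that makes pointwise combinations of homomorphisms homomorphisms again. In the final comparison
  \<nu> stays arbitrary: when \<mu> is the unit at x, both orders reduce to the integral of f(x,-)
  against \<nu>.\<close>

locale well_pointed_ccc = cartesian_closed X for X :: "('o, 'a) ccc" (structure) +
  assumes well_pointed: "well_pointed X"
begin

abbreviation el :: "'o \<Rightarrow> 'a set" where
  "el A \<equiv> Hom X (One X) A"

lemma comp_el:
  assumes "x \<in> Hom X D A" "f \<in> Hom X A B" "g \<in> Hom X B C"
  shows "(g \<cdot> f) \<cdot> x = g \<cdot> (f \<cdot> x)"
  using assms by (rule comp_assoc)

lemma dom_ob: "f \<in> Hom X A B \<Longrightarrow> A \<in> Ob X" and cod_ob: "f \<in> Hom X A B \<Longrightarrow> B \<in> Ob X"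
  using hom_ob by blast+

lemma ext:
  assumes "f \<in> Hom X A B" "g \<in> Hom X A B" "\<And>x. x \<in> el A \<Longrightarrow> f \<cdot> x = g \<cdot> x"
  shows "f = g"
  using assms well_pointed unfolding well_pointed_def elements_def by blast

lemma bang_in_hom: "A \<in> Ob X \<Longrightarrow> bang X A \<in> Hom X A (One X)"
  unfolding bang_def by (rule theI') (rule terminal)

lemma el_One: "x \<in> el (One X) \<Longrightarrow> x = Id X (One X)"
  using terminal[OF one_ob] id_in_hom[OF one_ob] by blast

lemma const_in_hom: "y \<in> el B \<Longrightarrow> A \<in> Ob X \<Longrightarrow> y \<cdot> bang X A \<in> Hom X A B"
  using comp_in_hom bang_in_hom by blast

lemma const_el:
  assumes "y \<in> el B" "x \<in> el A"
  shows "(y \<cdot> bang X A) \<cdot> x = y"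
proof -
  have b: "bang X A \<in> Hom X A (One X)" using assms cod_ob bang_in_hom by blast
  have "bang X A \<cdot> x = Id X (One X)" using comp_in_hom[OF assms(2) b] by (rule el_One)
  then show ?thesis using comp_assoc[OF assms(2) b assms(1)] comp_id[OF assms(1)] by simp
qed

lemma prod_ob: "A \<in> Ob X \<Longrightarrow> B \<in> Ob X \<Longrightarrow> A \<times>\<^bsub>X\<^esub> B \<in> Ob X"
  using proj_in_hom dom_ob by blast

lemma fst_in_hom: "A \<in> Ob X \<Longrightarrow> B \<in> Ob X \<Longrightarrow> Fst X A B \<in> Hom X (A \<times>\<^bsub>X\<^esub> B) A"
  and snd_in_hom: "A \<in> Ob X \<Longrightarrow> B \<in> Ob X \<Longrightarrow> Snd X A B \<in> Hom X (A \<times>\<^bsub>X\<^esub> B) B"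
  using proj_in_hom by blast+

lemma pair_props:
  assumes "f \<in> Hom X D A" "g \<in> Hom X D B"
  shows pair_in_hom: "pair X D A B f g \<in> Hom X D (A \<times>\<^bsub>X\<^esub> B)"
    and fst_pair: "Fst X A B \<cdot> pair X D A B f g = f"
    and snd_pair: "Snd X A B \<cdot> pair X D A B f g = g"
  using theI'[OF product[OF assms]] unfolding pair_def by blast+

lemma pair_eqI:
  assumes "h \<in> Hom X D (A \<times>\<^bsub>X\<^esub> B)" "k \<in> Hom X D (A \<times>\<^bsub>X\<^esub> B)" "A \<in> Ob X" "B \<in> Ob X"
    and "Fst X A B \<cdot> h = Fst X A B \<cdot> k" "Snd X A B \<cdot> h = Snd X A B \<cdot> k"
  shows "h = k"
  using product[OF comp_in_hom[OF assms(2) fst_in_hom[OF assms(3,4)]]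
      comp_in_hom[OF assms(2) snd_in_hom[OF assms(3,4)]]] assms by blast

lemma point_in_hom: "x \<in> el A \<Longrightarrow> y \<in> el B \<Longrightarrow> point X A B x y \<in> el (A \<times>\<^bsub>X\<^esub> B)"
  unfolding point_def by (rule pair_in_hom)

lemma fst_point: "x \<in> el A \<Longrightarrow> y \<in> el B \<Longrightarrow> Fst X A B \<cdot> point X A B x y = x"
  and snd_point: "x \<in> el A \<Longrightarrow> y \<in> el B \<Longrightarrow> Snd X A B \<cdot> point X A B x y = y"
  unfolding point_def by (rule fst_pair snd_pair; assumption)+

lemma pair_el:
  assumes "f \<in> Hom X D A" "g \<in> Hom X D B" "x \<in> el D"
  shows "pair X D A B f g \<cdot> x = point X A B (f \<cdot> x) (g \<cdot> x)"
proof (rule pair_eqI)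
  note p = pair_in_hom[OF assms(1,2)]
  show A: "A \<in> Ob X" and B: "B \<in> Ob X" using assms cod_ob by blast+
  have fx: "f \<cdot> x \<in> el A" and gx: "g \<cdot> x \<in> el B" using assms comp_in_hom by blast+
  show "pair X D A B f g \<cdot> x \<in> el (A \<times>\<^bsub>X\<^esub> B)" using p assms(3) comp_in_hom by blast
  show "point X A B (f \<cdot> x) (g \<cdot> x) \<in> el (A \<times>\<^bsub>X\<^esub> B)" by (rule point_in_hom[OF fx gx])
  show "Fst X A B \<cdot> pair X D A B f g \<cdot> x = Fst X A B \<cdot> point X A B (f \<cdot> x) (g \<cdot> x)"
    using comp_assoc[OF assms(3) p fst_in_hom[OF A B]] fst_pair[OF assms(1,2)]
      fst_point[OF fx gx] by simp
  show "Snd X A B \<cdot> pair X D A B f g \<cdot> x = Snd X A B \<cdot> point X A B (f \<cdot> x) (g \<cdot> x)"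
    using comp_assoc[OF assms(3) p snd_in_hom[OF A B]] snd_pair[OF assms(1,2)]
      snd_point[OF fx gx] by simp
qed

lemma point_cases:
  assumes "p \<in> el (A \<times>\<^bsub>X\<^esub> B)" "A \<in> Ob X" "B \<in> Ob X"
  obtains x y where "x \<in> el A" "y \<in> el B" "p = point X A B x y"
proof
  show x: "Fst X A B \<cdot> p \<in> el A" and y: "Snd X A B \<cdot> p \<in> el B"
    using assms fst_in_hom snd_in_hom comp_in_hom by blast+
  show "p = point X A B (Fst X A B \<cdot> p) (Snd X A B \<cdot> p)"
    by (rule pair_eqI[OF assms(1) point_in_hom[OF x y] assms(2,3)])
      (simp_all add: fst_point[OF x y] snd_point[OF x y])
qed

lemma ext2:
  assumes "f \<in> Hom X (A \<times>\<^bsub>X\<^esub> B) C" "g \<in> Hom X (A \<times>\<^bsub>X\<^esub> B) C" "A \<in> Ob X" "B \<in> Ob X"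
    and "\<And>x y. x \<in> el A \<Longrightarrow> y \<in> el B \<Longrightarrow> f \<cdot> point X A B x y = g \<cdot> point X A B x y"
  shows "f = g"
  using assms(1,2) by (rule ext) (use assms point_cases in metis)

lemma prod_map_in_hom:
  assumes "f \<in> Hom X A A'" "g \<in> Hom X B B'"
  shows "prod_map X A B A' B' f g \<in> Hom X (A \<times>\<^bsub>X\<^esub> B) (A' \<times>\<^bsub>X\<^esub> B')"
  unfolding prod_map_def
  using assms dom_ob fst_in_hom snd_in_hom by (intro pair_in_hom) (blast intro: comp_in_hom)+

lemma prod_map_el:
  assumes f: "f \<in> Hom X A A'" and g: "g \<in> Hom X B B'" and x: "x \<in> el A" and y: "y \<in> el B"
  shows "prod_map X A B A' B' f g \<cdot> point X A B x y = point X A' B' (f \<cdot> x) (g \<cdot> y)"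
proof -
  have F: "Fst X A B \<in> Hom X (A \<times>\<^bsub>X\<^esub> B) A" and S: "Snd X A B \<in> Hom X (A \<times>\<^bsub>X\<^esub> B) B"
    using f g dom_ob fst_in_hom snd_in_hom by blast+
  note p = point_in_hom[OF x y]
  show ?thesis
    unfolding prod_map_def
    using pair_el[OF comp_in_hom[OF F f] comp_in_hom[OF S g] p]
    by (simp add: comp_el[OF p F f] comp_el[OF p S g] fst_point[OF x y] snd_point[OF x y])
qed

text \<open>The index names the coordinate that stays free: \<open>sec1\<close> is x \<mapsto> (x,y)
  for fixed y, and \<open>sec2\<close> is y \<mapsto> (x,y) for fixed x. Precomposing with them
  restricts a function of two variables to one.\<close>

definition sec1 :: "'o \<Rightarrow> 'o \<Rightarrow> 'a \<Rightarrow> 'a" where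
  "sec1 A B y = pair X A A B (Id X A) (y \<cdot> bang X A)"

definition sec2 :: "'o \<Rightarrow> 'o \<Rightarrow> 'a \<Rightarrow> 'a" where
  "sec2 A B x = pair X B A B (x \<cdot> bang X B) (Id X B)"

lemma sec1_in_hom: "y \<in> el B \<Longrightarrow> A \<in> Ob X \<Longrightarrow> sec1 A B y \<in> Hom X A (A \<times>\<^bsub>X\<^esub> B)"
  unfolding sec1_def by (intro pair_in_hom id_in_hom const_in_hom)

lemma sec2_in_hom: "x \<in> el A \<Longrightarrow> B \<in> Ob X \<Longrightarrow> sec2 A B x \<in> Hom X B (A \<times>\<^bsub>X\<^esub> B)"
  unfolding sec2_def by (intro pair_in_hom id_in_hom const_in_hom)

lemma sec1_el: "y \<in> el B \<Longrightarrow> x \<in> el A \<Longrightarrow> sec1 A B y \<cdot> x = point X A B x y"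
  unfolding sec1_def using pair_el[OF id_in_hom const_in_hom] cod_ob id_comp const_el by metis

lemma sec2_el: "x \<in> el A \<Longrightarrow> y \<in> el B \<Longrightarrow> sec2 A B x \<cdot> y = point X A B x y"
  unfolding sec2_def using pair_el[OF const_in_hom id_in_hom] cod_ob id_comp const_el by metis

section \<open>Exponentials, with their elements treated as functions\<close>

lemma exp_ob:
  assumes "A \<in> Ob X" "B \<in> Ob X"
  shows "Exp X A B \<in> Ob X"
proof -
  let ?D = "Exp X A B \<times>\<^bsub>X\<^esub> A"
  have D: "?D \<in> Ob X" using ev_in_hom[OF assms] dom_ob by blast
  have "Ev X A B \<cdot> Fst X ?D A \<in> Hom X (?D \<times>\<^bsub>X\<^esub> A) B"
    using fst_in_hom[OF D assms(1)] ev_in_hom[OF assms] comp_in_hom by blast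
  then show ?thesis using exponential[OF D assms(1)] cod_ob by blast
qed

definition ap :: "'o \<Rightarrow> 'o \<Rightarrow> 'a \<Rightarrow> 'a \<Rightarrow> 'a" where
  "ap A B n x = Ev X A B \<cdot> point X (Exp X A B) A n x"

lemma uncurry_in_hom:
  "k \<in> Hom X D (Exp X A B) \<Longrightarrow> A \<in> Ob X \<Longrightarrow> B \<in> Ob X \<Longrightarrow>
    uncurry X D A B k \<in> Hom X (D \<times>\<^bsub>X\<^esub> A) B"
  unfolding uncurry_def using prod_map_in_hom id_in_hom ev_in_hom comp_in_hom by metis

lemma uncurry_el:
  assumes "k \<in> Hom X D (Exp X A B)" "B \<in> Ob X" "d \<in> el D" "x \<in> el A"
  shows "uncurry X D A B k \<cdot> point X D A d x = ap A B (k \<cdot> d) x"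
proof -
  have A: "A \<in> Ob X" using assms cod_ob by blast
  show ?thesis
    unfolding uncurry_def ap_def
    by (simp add: comp_el[OF point_in_hom[OF assms(3,4)] prod_map_in_hom[OF assms(1) id_in_hom[OF A]]
          ev_in_hom[OF A assms(2)]] prod_map_el[OF assms(1) id_in_hom[OF A] assms(3,4)]
        id_comp[OF assms(4)])
qed

lemma curry_props:
  assumes "f \<in> Hom X (D \<times>\<^bsub>X\<^esub> A) B" "D \<in> Ob X" "A \<in> Ob X"
  shows curry_in_hom: "curry X D A B f \<in> Hom X D (Exp X A B)"
    and uncurry_curry: "uncurry X D A B (curry X D A B f) = f"
  using theI'[OF exponential[OF assms(2,3,1)]] unfolding curry_def by blast+

lemma curry_el:
  assumes "f \<in> Hom X (D \<times>\<^bsub>X\<^esub> A) B" "d \<in> el D" "x \<in> el A"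
  shows "ap A B (curry X D A B f \<cdot> d) x = f \<cdot> point X D A d x"
  using uncurry_el[OF curry_in_hom] uncurry_curry assms dom_ob cod_ob by metis

text \<open>Elements of an exponential are compared through their transposes
  \<open>1 \<times> A \<rightarrow> B\<close>, to which well-pointedness applies; transposition is
  injective by the uniqueness clause of \<open>exponential\<close>.\<close>

lemma ap_ext:
  assumes n: "n \<in> el (Exp X A B)" and n': "n' \<in> el (Exp X A B)" and A: "A \<in> Ob X" and B: "B \<in> Ob X"
    and eq: "\<And>x. x \<in> el A \<Longrightarrow> ap A B n x = ap A B n' x"
  shows "n = n'"
proof -
  have "uncurry X (One X) A B n = uncurry X (One X) A B n'"
  proof (rule ext2[OF uncurry_in_hom[OF n A B] uncurry_in_hom[OF n' A B] one_ob A])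
    fix u x assume "u \<in> el (One X)" "x \<in> el A"
    then show "uncurry X (One X) A B n \<cdot> point X (One X) A u x =
        uncurry X (One X) A B n' \<cdot> point X (One X) A u x"
      using uncurry_el[OF n B] uncurry_el[OF n' B] el_One comp_id[OF n] comp_id[OF n'] eq
      by metis
  qed
  then show ?thesis
    using exponential[OF one_ob A uncurry_in_hom[OF n A B]] n n' by metis
qed

lemma name_of_in_hom: "f \<in> Hom X A B \<Longrightarrow> name_of X A B f \<in> el (Exp X A B)"
  unfolding name_of_def using curry_in_hom snd_in_hom one_ob dom_ob comp_in_hom by metis

lemma name_of_ap:
  assumes "f \<in> Hom X A B" "x \<in> el A"
  shows "ap A B (name_of X A B f) x = f \<cdot> x"
proof -
  have A: "A \<in> Ob X" using assms dom_ob by blast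
  note S = snd_in_hom[OF one_ob A]
  note c = comp_in_hom[OF S assms(1)]
  note i = id_in_hom[OF one_ob]
  show ?thesis
    using curry_el[OF c i assms(2)] comp_id[OF curry_in_hom[OF c one_ob A]]
      comp_el[OF point_in_hom[OF i assms(2)] S assms(1)] snd_point[OF i assms(2)]
    unfolding name_of_def by simp
qed

lemma named_by_in_hom:
  "n \<in> el (Exp X A B) \<Longrightarrow> A \<in> Ob X \<Longrightarrow> B \<in> Ob X \<Longrightarrow> named_by X A B n \<in> Hom X A B"
  unfolding named_by_def using pair_in_hom const_in_hom id_in_hom ev_in_hom comp_in_hom by metis

lemma named_by_el:
  assumes "n \<in> el (Exp X A B)" "x \<in> el A" "B \<in> Ob X"
  shows "named_by X A B n \<cdot> x = ap A B n x"
proof -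
  have A: "A \<in> Ob X" using assms cod_ob by blast
  note c = const_in_hom[OF assms(1) A] and i = id_in_hom[OF A]
  show ?thesis
    unfolding named_by_def ap_def
    by (simp add: comp_el[OF assms(2) pair_in_hom[OF c i] ev_in_hom[OF A assms(3)]]
        pair_el[OF c i assms(2)] const_el[OF assms(1,2)] id_comp[OF assms(2)])
qed

lemma name_named: 
  "n \<in> el (Exp X A B) \<Longrightarrow> A \<in> Ob X \<Longrightarrow> B \<in> Ob X \<Longrightarrow> name_of X A B (named_by X A B n) = n"
  by (rule ap_ext[OF name_of_in_hom]) (auto simp: named_by_in_hom name_of_ap named_by_el)

lemma named_name: "f \<in> Hom X A B \<Longrightarrow> named_by X A B (name_of X A B f) = f"
  using dom_ob cod_ob by (intro ext[OF named_by_in_hom[OF name_of_in_hom]])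
    (auto simp: name_of_in_hom name_of_ap named_by_el)

lemma int_comp_in_hom_el:
  assumes A: "A \<in> Ob X" and B: "B \<in> Ob X" and C: "C \<in> Ob X"
  shows int_comp_in_hom: "int_comp X A B C \<in> Hom X (Exp X B C \<times>\<^bsub>X\<^esub> Exp X A B) (Exp X A C)"
    and int_comp_el: "\<And>g f x. g \<in> el (Exp X B C) \<Longrightarrow> f \<in> el (Exp X A B) \<Longrightarrow> x \<in> el A \<Longrightarrow>
      ap A C (int_comp X A B C \<cdot> point X (Exp X B C) (Exp X A B) g f) x = ap B C g (ap A B f x)"
proof -
  let ?P = "Exp X B C \<times>\<^bsub>X\<^esub> Exp X A B"
  let ?g = "Fst X (Exp X B C) (Exp X A B) \<cdot> Fst X ?P A"
  let ?f = "Snd X (Exp X B C) (Exp X A B) \<cdot> Fst X ?P A"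
  let ?x = "Snd X ?P A"
  let ?q = "pair X (?P \<times>\<^bsub>X\<^esub> A) (Exp X A B) A ?f ?x"
  let ?fx = "Ev X A B \<cdot> ?q"
  let ?p = "pair X (?P \<times>\<^bsub>X\<^esub> A) (Exp X B C) B ?g ?fx"
  let ?h = "Ev X B C \<cdot> ?p"
  have P: "?P \<in> Ob X" using A B C exp_ob prod_ob by blast
  note Fi = fst_in_hom[OF exp_ob[OF B C] exp_ob[OF A B]]
  note Si = snd_in_hom[OF exp_ob[OF B C] exp_ob[OF A B]]
  note Fo = fst_in_hom[OF P A] and x = snd_in_hom[OF P A]
  note g = comp_in_hom[OF Fo Fi] and f = comp_in_hom[OF Fo Si]
  note q = pair_in_hom[OF f x]
  note fx = comp_in_hom[OF q ev_in_hom[OF A B]]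
  note p = pair_in_hom[OF g fx]
  note h = comp_in_hom[OF p ev_in_hom[OF B C]]
  have c: "int_comp X A B C = curry X ?P A C ?h" unfolding int_comp_def Let_def ..
  show "int_comp X A B C \<in> Hom X ?P (Exp X A C)" unfolding c by (rule curry_in_hom[OF h P A])
  fix g' f' x' assume g': "g' \<in> el (Exp X B C)" and f': "f' \<in> el (Exp X A B)" and x': "x' \<in> el A"
  note w = point_in_hom[OF g' f']
  note wx = point_in_hom[OF w x']
  have 1: "?g \<cdot> point X ?P A (point X (Exp X B C) (Exp X A B) g' f') x' = g'"
    by (simp add: comp_el[OF wx Fo Fi] fst_point[OF w x'] fst_point[OF g' f'])
  have 2: "?f \<cdot> point X ?P A (point X (Exp X B C) (Exp X A B) g' f') x' = f'"
    by (simp add: comp_el[OF wx Fo Si] fst_point[OF w x'] snd_point[OF g' f'])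
  show "ap A C (int_comp X A B C \<cdot> point X (Exp X B C) (Exp X A B) g' f') x' = ap B C g' (ap A B f' x')"
    unfolding c curry_el[OF h w x'] comp_el[OF wx p ev_in_hom[OF B C]] pair_el[OF g fx wx]
      comp_el[OF wx q ev_in_hom[OF A B]] pair_el[OF f x wx] 1 2 snd_point[OF w x'] by (simp add: ap_def)
qed

lemma exp_pre_in_hom_el:
  assumes f: "f \<in> Hom X A A'" and B: "B \<in> Ob X"
  shows exp_pre_in_hom: "exp_pre X A A' B f \<in> Hom X (Exp X A' B) (Exp X A B)"
    and exp_pre_el: "\<And>n x. n \<in> el (Exp X A' B) \<Longrightarrow> x \<in> el A \<Longrightarrow>
      ap A B (exp_pre X A A' B f \<cdot> n) x = ap A' B n (f \<cdot> x)"
proof -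
  have A: "A \<in> Ob X" and A': "A' \<in> Ob X" using f dom_ob cod_ob by blast+
  note E = exp_ob[OF A' B]
  note m = prod_map_in_hom[OF id_in_hom[OF E] f]
  note h = comp_in_hom[OF m ev_in_hom[OF A' B]]
  show "exp_pre X A A' B f \<in> Hom X (Exp X A' B) (Exp X A B)"
    unfolding exp_pre_def by (rule curry_in_hom[OF h E A])
  fix n x assume n: "n \<in> el (Exp X A' B)" and x: "x \<in> el A"
  show "ap A B (exp_pre X A A' B f \<cdot> n) x = ap A' B n (f \<cdot> x)"
    unfolding exp_pre_def curry_el[OF h n x] comp_el[OF point_in_hom[OF n x] m ev_in_hom[OF A' B]]
      prod_map_el[OF id_in_hom[OF E] f n x] id_comp[OF n] by (simp add: ap_def)
qed

lemma exp_post_in_hom_el: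
  assumes g: "g \<in> Hom X B B'" and A: "A \<in> Ob X"
  shows exp_post_in_hom: "exp_post X A B B' g \<in> Hom X (Exp X A B) (Exp X A B')"
    and exp_post_el: "\<And>n x. n \<in> el (Exp X A B) \<Longrightarrow> x \<in> el A \<Longrightarrow>
      ap A B' (exp_post X A B B' g \<cdot> n) x = g \<cdot> ap A B n x"
proof -
  have B: "B \<in> Ob X" using g dom_ob by blast
  note E = exp_ob[OF A B] and v = ev_in_hom[OF A B]
  note h = comp_in_hom[OF v g]
  show "exp_post X A B B' g \<in> Hom X (Exp X A B) (Exp X A B')"
    unfolding exp_post_def by (rule curry_in_hom[OF h E A])
  fix n x assume n: "n \<in> el (Exp X A B)" and x: "x \<in> el A"
  show "ap A B' (exp_post X A B B' g \<cdot> n) x = g \<cdot> ap A B n x"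
    unfolding exp_post_def curry_el[OF h n x] comp_el[OF point_in_hom[OF n x] v g] by (simp add: ap_def)
qed

text \<open>Evaluation at a fixed x is made a morphism in the function variable so that a monad can
  be applied to it.\<close>

definition evat :: "'o \<Rightarrow> 'o \<Rightarrow> 'a \<Rightarrow> 'a" where
  "evat A B x = Ev X A B \<cdot> sec1 (Exp X A B) A x"

lemma evat_in_hom: "x \<in> el A \<Longrightarrow> B \<in> Ob X \<Longrightarrow> evat A B x \<in> Hom X (Exp X A B) B"
  unfolding evat_def using sec1_in_hom exp_ob ev_in_hom comp_in_hom cod_ob by metis

lemma evat_el:
  assumes "x \<in> el A" "B \<in> Ob X" "n \<in> el (Exp X A B)"
  shows "evat A B x \<cdot> n = ap A B n x"
proof -
  have A: "A \<in> Ob X" using assms cod_ob by blast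
  show ?thesis
    unfolding evat_def ap_def
    by (simp add: comp_el[OF assms(3) sec1_in_hom[OF assms(1) exp_ob[OF A assms(2)]]
          ev_in_hom[OF A assms(2)]] sec1_el[OF assms(1,3)])
qed

text \<open>Well-pointedness leaves at most one morphism inducing \<phi>, so the definite
  description in \<open>integral_fun\<close> denotes as soon as one such morphism is
  exhibited.\<close>

lemma integral_fun_eq:
  assumes "g \<in> Hom X A (fst Z)" "\<And>x. x \<in> el A \<Longrightarrow> g \<cdot> x = \<phi> x"
  shows "integral_fun X D Z A \<phi> \<mu> = integral X D Z A g \<mu>"
proof -
  have "(THE g. g \<in> Hom X A (fst Z) \<and> (\<forall>x \<in> elements X A. g \<cdot> x = \<phi> x)) = g"
    unfolding elements_def using assms by (intro the_equality) (auto intro: ext)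
  then show ?thesis unfolding integral_fun_def by simp
qed

end

section \<open>Strengths and iterated integrals\<close>

text \<open>The object map and the hom-action are the data from which the strengths are built, and
  these two typings yield the formulas for the strengths on elements. Both \<open>L\<close> and the
  accessible distribution monad are instances.\<close>

locale strong_functor = well_pointed_ccc X for X :: "('o, 'a) ccc" (structure) +
  fixes T :: "('o, 'a) vmonad"
  assumes TOb_ob: "A \<in> Ob X \<Longrightarrow> TOb T A \<in> Ob X"
    and THom_in_hom: "A \<in> Ob X \<Longrightarrow> B \<in> Ob X \<Longrightarrow>
      THom T A B \<in> Hom X (Exp X A B) (Exp X (TOb T A) (TOb T B))"
begin

lemma vmap_in_hom:
  assumes "f \<in> Hom X A B"
  shows "vmap X T A B f \<in> Hom X (TOb T A) (TOb T B)"
  unfolding vmap_def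
  using assms dom_ob cod_ob by (intro named_by_in_hom comp_in_hom[OF name_of_in_hom THom_in_hom] TOb_ob)

lemma THom_el:
  assumes n: "n \<in> el (Exp X A B)" and A: "A \<in> Ob X" and B: "B \<in> Ob X" and v: "v \<in> el (TOb T A)"
  shows "ap (TOb T A) (TOb T B) (THom T A B \<cdot> n) v = vmap X T A B (named_by X A B n) \<cdot> v"
  unfolding vmap_def name_named[OF n A B]
  using named_by_el[OF comp_in_hom[OF n THom_in_hom[OF A B]] v TOb_ob[OF B]] by simp

lemma named_THom:
  assumes n: "n \<in> el (Exp X A B)" and A: "A \<in> Ob X" and B: "B \<in> Ob X"
  shows "named_by X (TOb T A) (TOb T B) (THom T A B \<cdot> n) = vmap X T A B (named_by X A B n)"
  unfolding vmap_def name_named[OF n A B] ..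

text \<open>The curried map in the definition sends y to the name of x \<mapsto> (x,y), which is
  \<open>sec1 A B y\<close>, and the hom-action turns this name into the functor applied to the
  section. The pairing \<open>?p\<close> only swaps the factors into the order of the
  transpose.\<close>

lemma strength1_in_hom_el:
  assumes A: "A \<in> Ob X" and B: "B \<in> Ob X"
  shows strength1_in_hom: "strength1 X T A B \<in> Hom X (TOb T A \<times>\<^bsub>X\<^esub> B) (TOb T (A \<times>\<^bsub>X\<^esub> B))"
    and strength1_el: "\<And>v y. v \<in> el (TOb T A) \<Longrightarrow> y \<in> el B \<Longrightarrow>
      strength1 X T A B \<cdot> point X (TOb T A) B v y = vmap X T A (A \<times>\<^bsub>X\<^esub> B) (sec1 A B y) \<cdot> v"
proof -
  let ?AB = "A \<times>\<^bsub>X\<^esub> B"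
  let ?w = "pair X (B \<times>\<^bsub>X\<^esub> A) A B (Snd X B A) (Fst X B A)"
  let ?c = "curry X B A ?AB ?w"
  let ?p = "pair X (TOb T A \<times>\<^bsub>X\<^esub> B) B (TOb T A) (Snd X (TOb T A) B) (Fst X (TOb T A) B)"
  note TA = TOb_ob[OF A] and AB = prod_ob[OF A B]
  note TAB = TOb_ob[OF AB]
  note w = pair_in_hom[OF snd_in_hom[OF B A] fst_in_hom[OF B A]]
  note c = curry_in_hom[OF w B A]
  note k = comp_in_hom[OF c THom_in_hom[OF A AB]]
  note u = uncurry_in_hom[OF k TA TAB]
  note S = snd_in_hom[OF TA B] and F = fst_in_hom[OF TA B]
  note p = pair_in_hom[OF S F]
  have s: "strength1 X T A B = uncurry X B (TOb T A) (TOb T ?AB) (THom T A ?AB \<cdot> ?c) \<cdot> ?p"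
    unfolding strength1_def Let_def ..
  show "strength1 X T A B \<in> Hom X (TOb T A \<times>\<^bsub>X\<^esub> B) (TOb T ?AB)"
    unfolding s by (rule comp_in_hom[OF p u])
  fix v y assume v: "v \<in> el (TOb T A)" and y: "y \<in> el B"
  note vy = point_in_hom[OF v y]
  note cy = comp_in_hom[OF y c]
  have n: "named_by X A ?AB (?c \<cdot> y) = sec1 A B y"
  proof (rule ext[OF named_by_in_hom[OF cy A AB] sec1_in_hom[OF y A]])
    fix x assume x: "x \<in> el A"
    show "named_by X A ?AB (?c \<cdot> y) \<cdot> x = sec1 A B y \<cdot> x"
      unfolding named_by_el[OF cy x AB] curry_el[OF w y x] sec1_el[OF y x]
        pair_el[OF snd_in_hom[OF B A] fst_in_hom[OF B A] point_in_hom[OF y x]]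
        fst_point[OF y x] snd_point[OF y x] ..
  qed
  show "strength1 X T A B \<cdot> point X (TOb T A) B v y = vmap X T A ?AB (sec1 A B y) \<cdot> v"
    unfolding s comp_el[OF vy p u] pair_el[OF S F vy] fst_point[OF v y] snd_point[OF v y]
      uncurry_el[OF k TAB y v] comp_el[OF y c THom_in_hom[OF A AB]] THom_el[OF cy A AB v] n ..
qed

lemma strength2_in_hom_el:
  assumes A: "A \<in> Ob X" and B: "B \<in> Ob X"
  shows strength2_in_hom: "strength2 X T A B \<in> Hom X (A \<times>\<^bsub>X\<^esub> TOb T B) (TOb T (A \<times>\<^bsub>X\<^esub> B))"
    and strength2_el: "\<And>x w. x \<in> el A \<Longrightarrow> w \<in> el (TOb T B) \<Longrightarrow>
      strength2 X T A B \<cdot> point X A (TOb T B) x w = vmap X T B (A \<times>\<^bsub>X\<^esub> B) (sec2 A B x) \<cdot> w"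
proof -
  let ?AB = "A \<times>\<^bsub>X\<^esub> B"
  let ?c = "curry X A B ?AB (Id X ?AB)"
  note AB = prod_ob[OF A B]
  note i = id_in_hom[OF AB]
  note c = curry_in_hom[OF i A B]
  note k = comp_in_hom[OF c THom_in_hom[OF B AB]]
  note u = uncurry_in_hom[OF k TOb_ob[OF B] TOb_ob[OF AB]]
  have s: "strength2 X T A B = uncurry X A (TOb T B) (TOb T ?AB) (THom T B ?AB \<cdot> ?c)"
    unfolding strength2_def Let_def ..
  show "strength2 X T A B \<in> Hom X (A \<times>\<^bsub>X\<^esub> TOb T B) (TOb T ?AB)"
    unfolding s by (rule u)
  fix x w assume x: "x \<in> el A" and w: "w \<in> el (TOb T B)"
  note cx = comp_in_hom[OF x c]
  have n: "named_by X B ?AB (?c \<cdot> x) = sec2 A B x"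
  proof (rule ext[OF named_by_in_hom[OF cx B AB] sec2_in_hom[OF x B]])
    fix y assume y: "y \<in> el B"
    show "named_by X B ?AB (?c \<cdot> x) \<cdot> y = sec2 A B x \<cdot> y"
      unfolding named_by_el[OF cx y AB] curry_el[OF i x y] sec2_el[OF x y]
        id_comp[OF point_in_hom[OF x y]] ..
  qed
  show "strength2 X T A B \<cdot> point X A (TOb T B) x w = vmap X T B ?AB (sec2 A B x) \<cdot> w"
    unfolding s uncurry_el[OF k TOb_ob[OF AB] x w] comp_el[OF x c THom_in_hom[OF B AB]]
      THom_el[OF cx B AB w] n ..
qed

end

text \<open>Functoriality composes an integrand with a kernel, and naturality of the multiplication
  moves an integrand past it; together they turn the tensors into iterated integrals. For the
  accessible distribution monad these laws come from uniqueness of extensions along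
  \<open>d\<close>.\<close>

locale strong_functor_mult = strong_functor X T
  for X :: "('o, 'a) ccc" (structure) and T :: "('o, 'a) vmonad" +
  assumes vmap_comp: "f \<in> Hom X A B \<Longrightarrow> g \<in> Hom X B C \<Longrightarrow>
      vmap X T A C (g \<cdot> f) = vmap X T B C g \<cdot> vmap X T A B f"
    and TMult_in_hom: "A \<in> Ob X \<Longrightarrow> TMult T A \<in> Hom X (TOb T (TOb T A)) (TOb T A)"
    and TMult_nat: "f \<in> Hom X A B \<Longrightarrow>
      TMult T B \<cdot> vmap X T (TOb T A) (TOb T B) (vmap X T A B f) = vmap X T A B f \<cdot> TMult T A"
begin

lemma vmap_comp_el:
  assumes "f \<in> Hom X A B" "g \<in> Hom X B C" "v \<in> el (TOb T A)"
  shows "vmap X T A C (g \<cdot> f) \<cdot> v = vmap X T B C g \<cdot> vmap X T A B f \<cdot> v"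
  using assms by (simp add: vmap_comp comp_el[OF _ vmap_in_hom vmap_in_hom])

text \<open>The inner integrals \<open>y \<mapsto> \<integral>\<^sub>x f(x,y) d\<mu>\<close> and \<open>x \<mapsto> \<integral>\<^sub>y f(x,y) d\<nu>\<close> as morphisms.\<close>

definition inner1 :: "'o \<Rightarrow> 'o \<Rightarrow> 'o \<Rightarrow> 'a \<Rightarrow> 'a \<Rightarrow> 'a \<Rightarrow> 'a" where
  "inner1 A B Z a f \<mu> =
     a \<cdot> vmap X T (A \<times>\<^bsub>X\<^esub> B) Z f \<cdot> strength1 X T A B \<cdot> sec2 (TOb T A) B \<mu>"

definition inner2 :: "'o \<Rightarrow> 'o \<Rightarrow> 'o \<Rightarrow> 'a \<Rightarrow> 'a \<Rightarrow> 'a \<Rightarrow> 'a" where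
  "inner2 A B Z a f \<nu> =
     a \<cdot> vmap X T (A \<times>\<^bsub>X\<^esub> B) Z f \<cdot> strength2 X T A B \<cdot> sec1 A (TOb T B) \<nu>"

text \<open>Iterated integration for a kernel \<open>s : B \<rightarrow> TC\<close>: integrating f
  against the mixture of the distributions s(y) over \<nu> is integrating y \<mapsto> \<integral> f
  ds(y) against \<nu>. Naturality moves \<open>f\<close> past the multiplication, and associativity
  of the algebra replaces the multiplication by a second integration.\<close>

lemma algebra_vmap_mult:
  assumes a: "a \<in> Hom X (TOb T Z) Z"
    and assoc: "a \<cdot> vmap X T (TOb T Z) Z a = a \<cdot> TMult T Z"
    and f: "f \<in> Hom X C Z" and s: "s \<in> Hom X B (TOb T C)" and \<nu>: "\<nu> \<in> el (TOb T B)"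
  shows "a \<cdot> vmap X T C Z f \<cdot> TMult T C \<cdot> vmap X T B (TOb T C) s \<cdot> \<nu> =
    a \<cdot> vmap X T B Z (a \<cdot> vmap X T C Z f \<cdot> s) \<cdot> \<nu>"
proof -
  have C: "C \<in> Ob X" and Z: "Z \<in> Ob X" using f dom_ob cod_ob by blast+
  note m = TMult_in_hom[OF C] and Tf = vmap_in_hom[OF f] and Ts = vmap_in_hom[OF s]
  note TTf = vmap_in_hom[OF Tf] and mZ = TMult_in_hom[OF Z]
  note w = comp_in_hom[OF \<nu> Ts]
  have "vmap X T C Z f \<cdot> TMult T C \<cdot> vmap X T B (TOb T C) s \<cdot> \<nu> =
      TMult T Z \<cdot> vmap X T (TOb T C) (TOb T Z) (vmap X T C Z f) \<cdot> vmap X T B (TOb T C) s \<cdot> \<nu>"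
    using comp_el[OF w m Tf] comp_el[OF w TTf mZ] TMult_nat[OF f] by simp
  then have "a \<cdot> vmap X T C Z f \<cdot> TMult T C \<cdot> vmap X T B (TOb T C) s \<cdot> \<nu> =
      a \<cdot> vmap X T (TOb T Z) Z a \<cdot> vmap X T (TOb T C) (TOb T Z) (vmap X T C Z f) \<cdot>
        vmap X T B (TOb T C) s \<cdot> \<nu>"
    using comp_el[OF comp_in_hom[OF w TTf] vmap_in_hom[OF a] a]
      comp_el[OF comp_in_hom[OF w TTf] mZ a] assoc by simp
  then show ?thesis
    by (simp add: vmap_comp_el[OF comp_in_hom[OF s Tf] a \<nu>] vmap_comp_el[OF s Tf \<nu>])
qed

lemma otimes_in_hom:
  assumes A: "A \<in> Ob X" and B: "B \<in> Ob X"
  shows "otimes X T A B \<in> Hom X (TOb T A \<times>\<^bsub>X\<^esub> TOb T B) (TOb T (A \<times>\<^bsub>X\<^esub> B))"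
  unfolding otimes_def
  by (intro comp_in_hom[OF _ TMult_in_hom[OF prod_ob[OF A B]]]
      comp_in_hom[OF _ vmap_in_hom[OF strength1_in_hom[OF A B]]]
      strength2_in_hom[OF TOb_ob[OF A] B])

lemma otimes_tilde_in_hom:
  assumes A: "A \<in> Ob X" and B: "B \<in> Ob X"
  shows "otimes_tilde X T A B \<in> Hom X (TOb T A \<times>\<^bsub>X\<^esub> TOb T B) (TOb T (A \<times>\<^bsub>X\<^esub> B))"
  unfolding otimes_tilde_def
  by (intro comp_in_hom[OF _ TMult_in_hom[OF prod_ob[OF A B]]]
      comp_in_hom[OF _ vmap_in_hom[OF strength2_in_hom[OF A B]]]
      strength1_in_hom[OF A TOb_ob[OF B]])

context
  fixes A B Z a f
  assumes A: "A \<in> Ob X" and B: "B \<in> Ob X"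
    and a: "a \<in> Hom X (TOb T Z) Z" and f: "f \<in> Hom X (A \<times>\<^bsub>X\<^esub> B) Z"
begin

lemma inner1_in_hom: "\<mu> \<in> el (TOb T A) \<Longrightarrow> inner1 A B Z a f \<mu> \<in> Hom X B Z"
  unfolding inner1_def
  by (intro comp_in_hom[OF _ a] comp_in_hom[OF _ vmap_in_hom[OF f]]
      comp_in_hom[OF _ strength1_in_hom[OF A B]] sec2_in_hom B)

lemma inner1_el:
  assumes \<mu>: "\<mu> \<in> el (TOb T A)" and y: "y \<in> el B"
  shows "inner1 A B Z a f \<mu> \<cdot> y = a \<cdot> vmap X T A Z (f \<cdot> sec1 A B y) \<cdot> \<mu>"
proof -
  note s = sec2_in_hom[OF \<mu> B] and t = strength1_in_hom[OF A B] and Tf = vmap_in_hom[OF f]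
  note ts = comp_in_hom[OF s t]
  show ?thesis
    unfolding inner1_def comp_el[OF y comp_in_hom[OF ts Tf] a] comp_el[OF y ts Tf] comp_el[OF y s t]
      sec2_el[OF \<mu> y] strength1_el[OF A B \<mu> y] vmap_comp_el[OF sec1_in_hom[OF y A] f \<mu>] ..
qed

lemma inner2_in_hom: "\<nu> \<in> el (TOb T B) \<Longrightarrow> inner2 A B Z a f \<nu> \<in> Hom X A Z"
  unfolding inner2_def
  by (intro comp_in_hom[OF _ a] comp_in_hom[OF _ vmap_in_hom[OF f]]
      comp_in_hom[OF _ strength2_in_hom[OF A B]] sec1_in_hom A)

lemma inner2_el:
  assumes \<nu>: "\<nu> \<in> el (TOb T B)" and x: "x \<in> el A"
  shows "inner2 A B Z a f \<nu> \<cdot> x = a \<cdot> vmap X T B Z (f \<cdot> sec2 A B x) \<cdot> \<nu>"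
proof -
  note s = sec1_in_hom[OF \<nu> A] and t = strength2_in_hom[OF A B] and Tf = vmap_in_hom[OF f]
  note ts = comp_in_hom[OF s t]
  show ?thesis
    unfolding inner2_def comp_el[OF x comp_in_hom[OF ts Tf] a] comp_el[OF x ts Tf] comp_el[OF x s t]
      sec1_el[OF \<nu> x] strength2_el[OF A B x \<nu>] vmap_comp_el[OF sec2_in_hom[OF x B] f \<nu>] ..
qed

text \<open>On elements \<open>otimes\<close> is the mixture over \<nu> of the kernel that sends y
  to the strength at (\<mu>, y), so \<open>algebra_vmap_mult\<close> applies. In
  \<open>otimes_tilde\<close> the roles of \<mu> and \<nu> are exchanged.\<close>

lemma integral_otimes:
  assumes assoc: "a \<cdot> vmap X T (TOb T Z) Z a = a \<cdot> TMult T Z"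
    and \<mu>: "\<mu> \<in> el (TOb T A)" and \<nu>: "\<nu> \<in> el (TOb T B)"
  shows "a \<cdot> vmap X T (A \<times>\<^bsub>X\<^esub> B) Z f \<cdot> otimes X T A B \<cdot> point X (TOb T A) (TOb T B) \<mu> \<nu> =
    a \<cdot> vmap X T B Z (inner1 A B Z a f \<mu>) \<cdot> \<nu>"
proof -
  note t = strength1_in_hom[OF A B] and t2 = strength2_in_hom[OF TOb_ob[OF A] B]
  note m = TMult_in_hom[OF prod_ob[OF A B]] and p = point_in_hom[OF \<mu> \<nu>]
    and s = sec2_in_hom[OF \<mu> B]
  have "otimes X T A B \<cdot> point X (TOb T A) (TOb T B) \<mu> \<nu> =
      TMult T (A \<times>\<^bsub>X\<^esub> B) \<cdot> vmap X T B (TOb T (A \<times>\<^bsub>X\<^esub> B)) (strength1 X T A B \<cdot> sec2 (TOb T A) B \<mu>) \<cdot> \<nu>"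
    unfolding otimes_def comp_el[OF p comp_in_hom[OF t2 vmap_in_hom[OF t]] m]
      comp_el[OF p t2 vmap_in_hom[OF t]] strength2_el[OF TOb_ob[OF A] B \<mu> \<nu>] vmap_comp_el[OF s t \<nu>] ..
  then show ?thesis
    using algebra_vmap_mult[OF a assoc f comp_in_hom[OF s t] \<nu>] unfolding inner1_def by simp
qed

lemma integral_otimes_tilde:
  assumes assoc: "a \<cdot> vmap X T (TOb T Z) Z a = a \<cdot> TMult T Z"
    and \<mu>: "\<mu> \<in> el (TOb T A)" and \<nu>: "\<nu> \<in> el (TOb T B)"
  shows "a \<cdot> vmap X T (A \<times>\<^bsub>X\<^esub> B) Z f \<cdot> otimes_tilde X T A B \<cdot> point X (TOb T A) (TOb T B) \<mu> \<nu> =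
    a \<cdot> vmap X T A Z (inner2 A B Z a f \<nu>) \<cdot> \<mu>"
proof -
  note t = strength2_in_hom[OF A B] and t2 = strength1_in_hom[OF A TOb_ob[OF B]]
  note m = TMult_in_hom[OF prod_ob[OF A B]] and p = point_in_hom[OF \<mu> \<nu>]
    and s = sec1_in_hom[OF \<nu> A]
  have "otimes_tilde X T A B \<cdot> point X (TOb T A) (TOb T B) \<mu> \<nu> =
      TMult T (A \<times>\<^bsub>X\<^esub> B) \<cdot> vmap X T A (TOb T (A \<times>\<^bsub>X\<^esub> B)) (strength2 X T A B \<cdot> sec1 A (TOb T B) \<nu>) \<cdot> \<mu>"
    unfolding otimes_tilde_def comp_el[OF p comp_in_hom[OF t2 vmap_in_hom[OF t]] m]
      comp_el[OF p t2 vmap_in_hom[OF t]] strength1_el[OF A TOb_ob[OF B] \<mu> \<nu>] vmap_comp_el[OF s t \<mu>] ..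
  then show ?thesis
    using algebra_vmap_mult[OF a assoc f comp_in_hom[OF s t] \<mu>] unfolding inner2_def by simp
qed

end

text \<open>The integrals with bound variables are replaced by integrals of morphisms: for each y
  the inner integrand is induced by \<open>f \<cdot> sec1 A B y\<close>, and the function of y that
  results is induced by \<open>inner1\<close>.\<close>

lemma iterated_integral1:
  assumes A: "A \<in> Ob X" and B: "B \<in> Ob X"
    and a: "a \<in> Hom X (TOb T Z) Z" and f: "f \<in> Hom X (A \<times>\<^bsub>X\<^esub> B) Z"
    and \<mu>: "\<mu> \<in> el (TOb T A)"
  shows "integral_fun X T (Z, a) B
      (\<lambda>y. integral_fun X T (Z, a) A (\<lambda>x. f \<cdot> point X A B x y) \<mu>) \<nu> =
    a \<cdot> vmap X T B Z (inner1 A B Z a f \<mu>) \<cdot> \<nu>"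
proof -
  have "integral_fun X T (Z, a) A (\<lambda>x. f \<cdot> point X A B x y) \<mu> =
      a \<cdot> vmap X T A Z (f \<cdot> sec1 A B y) \<cdot> \<mu>" if y: "y \<in> el B" for y
    using comp_in_hom[OF sec1_in_hom[OF y A] f] comp_el[OF _ sec1_in_hom[OF y A] f] sec1_el[OF y]
    by (subst integral_fun_eq[where g = "f \<cdot> sec1 A B y"]) (simp_all add: integral_def)
  then show ?thesis
    using inner1_in_hom[OF A B a f \<mu>] inner1_el[OF A B a f \<mu>]
    by (subst integral_fun_eq[where g = "inner1 A B Z a f \<mu>"]) (simp_all add: integral_def)
qed

lemma iterated_integral2:
  assumes A: "A \<in> Ob X" and B: "B \<in> Ob X"
    and a: "a \<in> Hom X (TOb T Z) Z" and f: "f \<in> Hom X (A \<times>\<^bsub>X\<^esub> B) Z"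
    and \<nu>: "\<nu> \<in> el (TOb T B)"
  shows "integral_fun X T (Z, a) A
      (\<lambda>x. integral_fun X T (Z, a) B (\<lambda>y. f \<cdot> point X A B x y) \<nu>) \<mu> =
    a \<cdot> vmap X T A Z (inner2 A B Z a f \<nu>) \<cdot> \<mu>"
proof -
  have "integral_fun X T (Z, a) B (\<lambda>y. f \<cdot> point X A B x y) \<nu> =
      a \<cdot> vmap X T B Z (f \<cdot> sec2 A B x) \<cdot> \<nu>" if x: "x \<in> el A" for x
    using comp_in_hom[OF sec2_in_hom[OF x B] f] comp_el[OF _ sec2_in_hom[OF x B] f] sec2_el[OF x]
    by (subst integral_fun_eq[where g = "f \<cdot> sec2 A B x"]) (simp_all add: integral_def)
  then show ?thesis
    using inner2_in_hom[OF A B a f \<nu>] inner2_el[OF A B a f \<nu>]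
    by (subst integral_fun_eq[where g = "inner2 A B Z a f \<nu>"]) (simp_all add: integral_def)
qed

end

section \<open>Equalizers and commutative monads\<close>

lemma equalizer_of_finite_limits:
  fixes C :: "('o, 'a, 'm) cat_scheme"
  assumes C: "category C" and lim: "has_finite_limits C"
    and f: "f \<in> Hom C A B" and g: "g \<in> Hom C A B"
  shows "\<exists>E i. is_equalizer C A B f g E i"
proof -
  interpret category C by (rule C)
  have A: "A \<in> Ob C" and B: "B \<in> Ob C" using f hom_ob by blast+
  \<comment> \<open>the category with two objects and two parallel arrows \<open>1, 2 : 0 \<rightarrow> 1\<close>\<close>
  define J :: "(nat, nat) cat" where "J = \<lparr>Ob = {0, 1},
    Hom = (\<lambda>i j. if i = j \<and> i \<le> 1 then {0} else if i = 0 \<and> j = 1 then {1, 2} else {}),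
    Id = (\<lambda>_. 0), Comp = (+)\<rparr>"
  define Fo where "Fo = (\<lambda>i::nat. if i = 0 then A else B)"
  define Fa where "Fa = (\<lambda>(i::nat) (j::nat) (s::nat). if s = 0 then Id C (Fo i) else if s = 1 then f else g)"
  \<comment> \<open>Addition is a correct composition because both identities are 0 and the arrows 1
    and 2 compose only with identities.\<close>
  have J: "category J"
    unfolding J_def by standard (auto split: if_splits)
  have fin: "finite (Ob J)" "finite (Hom J i j)" for i j
    unfolding J_def by auto
  have Fun: "is_functor J C Fo Fa"
    unfolding is_functor_def J_def Fo_def Fa_def
    using A B f g id_in_hom comp_id[OF f] comp_id[OF g] id_comp[OF f] id_comp[OF g]
      id_comp[OF id_in_hom[OF A]] id_comp[OF id_in_hom[OF B]] by (auto split: if_splits)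
  obtain P p where P: "is_limit J C Fo Fa P p"
    using lim J fin Fun unfolding has_finite_limits_def by blast
  \<comment> \<open>The leg at 1 is forced by the leg at 0, so a cone over this diagram is a
    fork.\<close>
  have cone: "is_cone J C Fo Fa Q q \<longleftrightarrow>
      Q \<in> Ob C \<and> q 0 \<in> Hom C Q A \<and> q 1 = f \<cdot>\<^bsub>C\<^esub> q 0 \<and> q 1 = g \<cdot>\<^bsub>C\<^esub> q 0" for Q q
    unfolding is_cone_def J_def Fo_def Fa_def
    using comp_in_hom[OF _ f, of "q 0" Q] id_comp by (auto simp: le_Suc_eq split: if_splits)
  have "is_equalizer C A B f g P (p 0)"
    unfolding is_equalizer_def
  proof (intro conjI allI ballI impI)
    have c: "is_cone J C Fo Fa P p" using P unfolding is_limit_def by blast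
    then show p0: "p 0 \<in> Hom C P A" and "f \<cdot>\<^bsub>C\<^esub> p 0 = g \<cdot>\<^bsub>C\<^esub> p 0"
      unfolding cone by auto
    fix D h assume h: "h \<in> Hom C D A" and e: "f \<cdot>\<^bsub>C\<^esub> h = g \<cdot>\<^bsub>C\<^esub> h"
    let ?q = "\<lambda>i::nat. if i = 0 then h else f \<cdot>\<^bsub>C\<^esub> h"
    have "is_cone J C Fo Fa D ?q" unfolding cone using h e hom_ob by auto
    then have "\<exists>!u. u \<in> Hom C D P \<and> (\<forall>i\<in>Ob J. p i \<cdot>\<^bsub>C\<^esub> u = ?q i)"
      using P unfolding is_limit_def by blast
    moreover have "(\<forall>i\<in>Ob J. p i \<cdot>\<^bsub>C\<^esub> u = ?q i) \<longleftrightarrow> p 0 \<cdot>\<^bsub>C\<^esub> u = h" if u: "u \<in> Hom C D P" for u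
      using c[unfolded cone] comp_assoc[OF u p0 f] unfolding J_def by auto
    ultimately show "\<exists>!u. u \<in> Hom C D P \<and> p 0 \<cdot>\<^bsub>C\<^esub> u = h" by metis
  qed
  then show ?thesis by blast
qed

section \<open>Enriched monad laws in terms of underlying morphisms\<close>

locale commutative_monad = strong_functor_mult X L
  for X :: "('o, 'a) ccc" (structure) and L :: "('o, 'a) vmonad" +
  assumes vmap_id: "A \<in> Ob X \<Longrightarrow> vmap X L A A (Id X A) = Id X (TOb L A)"
    and TUnit_in_hom: "A \<in> Ob X \<Longrightarrow> TUnit L A \<in> Hom X A (TOb L A)"
    and TUnit_nat: "f \<in> Hom X A B \<Longrightarrow> TUnit L B \<cdot> f = vmap X L A B f \<cdot> TUnit L A"
    and mult_unit: "A \<in> Ob X \<Longrightarrow> TMult L A \<cdot> TUnit L (TOb L A) = Id X (TOb L A)"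
    and mult_vmap_unit:
      "A \<in> Ob X \<Longrightarrow> TMult L A \<cdot> vmap X L A (TOb L A) (TUnit L A) = Id X (TOb L A)"
    and mult_assoc: "A \<in> Ob X \<Longrightarrow>
      TMult L A \<cdot> TMult L (TOb L A) = TMult L A \<cdot> vmap X L (TOb L (TOb L A)) (TOb L A) (TMult L A)"
    and commutative: "A \<in> Ob X \<Longrightarrow> B \<in> Ob X \<Longrightarrow> otimes X L A B = otimes_tilde X L A B"
    and equalizer_ex: "f \<in> Hom X A B \<Longrightarrow> g \<in> Hom X A B \<Longrightarrow> \<exists>E i. is_equalizer X A B f g E i"

text \<open>Enriched functoriality and naturality are equations between morphisms on hom-objects.
  Applied to the element that names f, and evaluated at points, they become the ordinary laws for
  f.\<close>

lemma (in well_pointed_ccc) commutative_monadI: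
  assumes T: "is_commutative_vmonad X T" and lim: "has_finite_limits X"
  shows "commutative_monad X T"
proof -
  have fu: "is_vfunctor X (TOb T) (THom T)"
    and un: "is_vnat X (\<lambda>A. A) (\<lambda>A B. Id X (Exp X A B)) (TOb T) (THom T) (TUnit T)"
    and mn: "is_vnat X (\<lambda>A. TOb T (TOb T A)) (\<lambda>A B. THom T (TOb T A) (TOb T B) \<cdot> THom T A B)
       (TOb T) (THom T) (TMult T)"
    using T unfolding is_commutative_vmonad_def is_vmonad_def by blast+
  interpret strong_functor X T
    by standard (use fu in \<open>auto simp: is_vfunctor_def\<close>)
  have u: "TUnit T A \<in> Hom X A (TOb T A)" and m: "TMult T A \<in> Hom X (TOb T (TOb T A)) (TOb T A)"
    if "A \<in> Ob X" for A
    using that un mn unfolding is_vnat_def by blast+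
  have i: "vmap X T A A (Id X A) = Id X (TOb T A)" if A: "A \<in> Ob X" for A
  proof -
    have "THom T A A \<cdot> int_id X A = int_id X (TOb T A)"
      using A fu unfolding is_vfunctor_def by blast
    then show ?thesis
      unfolding vmap_def int_id_def using named_name[OF id_in_hom[OF TOb_ob[OF A]]] by simp
  qed
  have c: "vmap X T A C (g \<cdot> f) = vmap X T B C g \<cdot> vmap X T A B f"
    if f: "f \<in> Hom X A B" and g: "g \<in> Hom X B C" for f g A B C
  proof (rule ext[OF vmap_in_hom[OF comp_in_hom[OF f g]] comp_in_hom[OF vmap_in_hom[OF f] vmap_in_hom[OF g]]])
    fix v assume v: "v \<in> el (TOb T A)"
    have A: "A \<in> Ob X" and B: "B \<in> Ob X" and C: "C \<in> Ob X" using f g dom_ob cod_ob by blast+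
    let ?f = "name_of X A B f" and ?g = "name_of X B C g"
    note nf = name_of_in_hom[OF f] and ng = name_of_in_hom[OF g]
      and gf = comp_in_hom[OF f g]
    note p = point_in_hom[OF ng nf]
    note tf = THom_in_hom[OF A B] and tg = THom_in_hom[OF B C] and tc = THom_in_hom[OF A C]
    note ic = int_comp_in_hom[OF A B C]
      and ic' = int_comp_in_hom[OF TOb_ob[OF A] TOb_ob[OF B] TOb_ob[OF C]]
    have "int_comp X A B C \<cdot> point X (Exp X B C) (Exp X A B) ?g ?f = name_of X A C (g \<cdot> f)"
      using A C p
      by (intro ap_ext[OF comp_in_hom[OF p ic] name_of_in_hom[OF gf]])
        (auto simp: int_comp_el[OF A B C ng nf] name_of_ap[OF f] name_of_ap[OF gf]
          name_of_ap[OF g comp_in_hom[OF _ f]] comp_el[OF _ f g])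
    then have "THom T A C \<cdot> name_of X A C (g \<cdot> f) =
        (THom T A C \<cdot> int_comp X A B C) \<cdot> point X (Exp X B C) (Exp X A B) ?g ?f"
      using comp_el[OF p ic tc] by simp
    also have "\<dots> = int_comp X (TOb T A) (TOb T B) (TOb T C) \<cdot>
        point X (Exp X (TOb T B) (TOb T C)) (Exp X (TOb T A) (TOb T B)) (THom T B C \<cdot> ?g) (THom T A B \<cdot> ?f)"
      using fu A B C comp_el[OF p prod_map_in_hom[OF tg tf] ic'] prod_map_el[OF tg tf ng nf]
      unfolding is_vfunctor_def by simp
    finally have e: "THom T A C \<cdot> name_of X A C (g \<cdot> f) = \<dots>" .
    show "vmap X T A C (g \<cdot> f) \<cdot> v = (vmap X T B C g \<cdot> vmap X T A B f) \<cdot> v"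
      using THom_el[OF name_of_in_hom[OF gf] A C v] THom_el[OF nf A B v]
        THom_el[OF ng B C comp_in_hom[OF v vmap_in_hom[OF f]]]
        int_comp_el[OF TOb_ob[OF A] TOb_ob[OF B] TOb_ob[OF C] comp_in_hom[OF ng tg]
          comp_in_hom[OF nf tf] v]
      unfolding e named_name[OF gf] named_name[OF f] named_name[OF g]
        comp_el[OF v vmap_in_hom[OF f] vmap_in_hom[OF g]] by simp
  qed
  have un': "TUnit T B \<cdot> f = vmap X T A B f \<cdot> TUnit T A" if f: "f \<in> Hom X A B" for f A B
  proof -
    have A: "A \<in> Ob X" and B: "B \<in> Ob X" using f dom_ob cod_ob by blast+
    let ?f = "name_of X A B f"
    note nf = name_of_in_hom[OF f]
    have "exp_post X A B (TOb T B) (TUnit T B) \<cdot> Id X (Exp X A B) =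
        exp_pre X A (TOb T A) (TOb T B) (TUnit T A) \<cdot> THom T A B"
      using un A B unfolding is_vnat_def by blast
    then have e: "exp_post X A B (TOb T B) (TUnit T B) \<cdot> ?f =
        exp_pre X A (TOb T A) (TOb T B) (TUnit T A) \<cdot> THom T A B \<cdot> ?f"
      using comp_el[OF nf THom_in_hom[OF A B] exp_pre_in_hom[OF u[OF A] TOb_ob[OF B]]]
        comp_id[OF exp_post_in_hom[OF u[OF B] A]] by simp
    show ?thesis
    proof (rule ext[OF comp_in_hom[OF f u[OF B]] comp_in_hom[OF u[OF A] vmap_in_hom[OF f]]])
      fix x assume x: "x \<in> el A"
      show "(TUnit T B \<cdot> f) \<cdot> x = (vmap X T A B f \<cdot> TUnit T A) \<cdot> x"
        using exp_post_el[OF u[OF B] A nf x]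
          exp_pre_el[OF u[OF A] TOb_ob[OF B] comp_in_hom[OF nf THom_in_hom[OF A B]] x]
        unfolding e name_of_ap[OF f x] THom_el[OF nf A B comp_in_hom[OF x u[OF A]]] named_name[OF f]
          comp_el[OF x f u[OF B]] comp_el[OF x u[OF A] vmap_in_hom[OF f]] by simp
    qed
  qed
  have mn': "TMult T B \<cdot> vmap X T (TOb T A) (TOb T B) (vmap X T A B f) = vmap X T A B f \<cdot> TMult T A"
    if f: "f \<in> Hom X A B" for f A B
  proof -
    have A: "A \<in> Ob X" and B: "B \<in> Ob X" using f dom_ob cod_ob by blast+
    note TA = TOb_ob[OF A] and TB = TOb_ob[OF B]
    let ?f = "name_of X A B f"
    note nf = name_of_in_hom[OF f]
    note t = THom_in_hom[OF A B] and tt = THom_in_hom[OF TA TB]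
    have "exp_post X (TOb T (TOb T A)) (TOb T (TOb T B)) (TOb T B) (TMult T B) \<cdot>
          THom T (TOb T A) (TOb T B) \<cdot> THom T A B =
        exp_pre X (TOb T (TOb T A)) (TOb T A) (TOb T B) (TMult T A) \<cdot> THom T A B"
      using mn A B unfolding is_vnat_def by blast
    then have e: "exp_post X (TOb T (TOb T A)) (TOb T (TOb T B)) (TOb T B) (TMult T B) \<cdot>
          THom T (TOb T A) (TOb T B) \<cdot> THom T A B \<cdot> ?f =
        exp_pre X (TOb T (TOb T A)) (TOb T A) (TOb T B) (TMult T A) \<cdot> THom T A B \<cdot> ?f"
      using comp_el[OF nf t exp_pre_in_hom[OF m[OF A] TB]] comp_el[OF nf t tt]
        comp_el[OF nf comp_in_hom[OF t tt] exp_post_in_hom[OF m[OF B] TOb_ob[OF TA]]] by simp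
    note Tf = vmap_in_hom[OF f]
    show ?thesis
    proof (rule ext[OF comp_in_hom[OF vmap_in_hom[OF Tf] m[OF B]] comp_in_hom[OF m[OF A] Tf]])
      fix x assume x: "x \<in> el (TOb T (TOb T A))"
      show "(TMult T B \<cdot> vmap X T (TOb T A) (TOb T B) (vmap X T A B f)) \<cdot> x =
          (vmap X T A B f \<cdot> TMult T A) \<cdot> x"
        using exp_post_el[OF m[OF B] TOb_ob[OF TA] comp_in_hom[OF comp_in_hom[OF nf t] tt] x]
          exp_pre_el[OF m[OF A] TB comp_in_hom[OF nf t] x]
        unfolding e THom_el[OF comp_in_hom[OF nf t] TA TB x]
          THom_el[OF nf A B comp_in_hom[OF x m[OF A]]] named_THom[OF nf A B] named_name[OF f]
          comp_el[OF x vmap_in_hom[OF Tf] m[OF B]] comp_el[OF x m[OF A] Tf] by simp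
    qed
  qed
  show ?thesis
    by standard (use i c u m un' mn' T lim equalizer_of_finite_limits[OF category_axioms] in
      \<open>auto simp: is_commutative_vmonad_def is_vmonad_def\<close>)
qed

section \<open>Algebras and their hom-objects\<close>

context commutative_monad
begin

abbreviation alg :: "'o \<times> 'a \<Rightarrow> bool" where
  "alg E \<equiv> E \<in> algebras X L"

abbreviation lhom :: "'o \<times> 'a \<Rightarrow> 'o \<times> 'a \<Rightarrow> 'a set" where
  "lhom \<equiv> Hom (EM X L)"

lemma algD:
  assumes "alg E"
  shows alg_ob: "fst E \<in> Ob X" and alg_struct: "snd E \<in> Hom X (TOb L (fst E)) (fst E)"
    and alg_unit: "snd E \<cdot> TUnit L (fst E) = Id X (fst E)"
    and alg_assoc: "snd E \<cdot> vmap X L (TOb L (fst E)) (fst E) (snd E) = snd E \<cdot> TMult L (fst E)"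
  using assms by (auto simp: algebras_def)

lemma algI:
  assumes "fst E \<in> Ob X" "snd E \<in> Hom X (TOb L (fst E)) (fst E)"
    and "snd E \<cdot> TUnit L (fst E) = Id X (fst E)"
    and "snd E \<cdot> vmap X L (TOb L (fst E)) (fst E) (snd E) = snd E \<cdot> TMult L (fst E)"
  shows "alg E"
  using assms by (auto simp: algebras_def split: prod.splits)

lemma alg_unit_el: "alg E \<Longrightarrow> x \<in> el (fst E) \<Longrightarrow> snd E \<cdot> TUnit L (fst E) \<cdot> x = x"
  using comp_el[OF _ TUnit_in_hom alg_struct] alg_ob alg_unit id_comp by metis

lemma alg_assoc_el:
  assumes E: "alg E" and v: "v \<in> el (TOb L (TOb L (fst E)))"
  shows "snd E \<cdot> vmap X L (TOb L (fst E)) (fst E) (snd E) \<cdot> v = snd E \<cdot> TMult L (fst E) \<cdot> v"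
  using comp_el[OF v vmap_in_hom[OF alg_struct[OF E]] alg_struct[OF E]]
    comp_el[OF v TMult_in_hom[OF alg_ob[OF E]] alg_struct[OF E]] alg_assoc[OF E] by simp

lemma lhomD:
  assumes "f \<in> lhom E E'"
  shows lhom_dom: "alg E" and lhom_cod: "alg E'" and lhom_in_hom: "f \<in> Hom X (fst E) (fst E')"
    and lhom_eq: "f \<cdot> snd E = snd E' \<cdot> vmap X L (fst E) (fst E') f"
  using assms by (auto simp: EM_def)

lemma lhom_el:
  assumes f: "f \<in> lhom E E'" and v: "v \<in> el (TOb L (fst E))"
  shows "f \<cdot> snd E \<cdot> v = snd E' \<cdot> vmap X L (fst E) (fst E') f \<cdot> v"
proof -
  note f' = lhom_in_hom[OF f]
  show ?thesis
    using comp_el[OF v alg_struct[OF lhom_dom[OF f]] f']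
      comp_el[OF v vmap_in_hom[OF f'] alg_struct[OF lhom_cod[OF f]]] lhom_eq[OF f] by simp
qed

lemma lhomI:
  assumes E: "alg E" and E': "alg E'" and f: "f \<in> Hom X (fst E) (fst E')"
    and eq: "\<And>v. v \<in> el (TOb L (fst E)) \<Longrightarrow>
      f \<cdot> snd E \<cdot> v = snd E' \<cdot> vmap X L (fst E) (fst E') f \<cdot> v"
  shows "f \<in> lhom E E'"
proof -
  have "f \<cdot> snd E = snd E' \<cdot> vmap X L (fst E) (fst E') f"
    using eq
    by (intro ext[OF comp_in_hom[OF alg_struct[OF E] f]
          comp_in_hom[OF vmap_in_hom[OF f] alg_struct[OF E']]])
      (simp add: comp_el[OF _ alg_struct[OF E] f] comp_el[OF _ vmap_in_hom[OF f] alg_struct[OF E']])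
  then show ?thesis using E E' f by (simp add: EM_def)
qed

lemma lhom_comp:
  assumes f: "f \<in> lhom E E'" and g: "g \<in> lhom E' E''"
  shows "g \<cdot> f \<in> lhom E E''"
proof (rule lhomI[OF lhom_dom[OF f] lhom_cod[OF g]])
  note f' = lhom_in_hom[OF f] and g' = lhom_in_hom[OF g]
  show "g \<cdot> f \<in> Hom X (fst E) (fst E'')" by (rule comp_in_hom[OF f' g'])
  fix v assume v: "v \<in> el (TOb L (fst E))"
  show "(g \<cdot> f) \<cdot> snd E \<cdot> v = snd E'' \<cdot> vmap X L (fst E) (fst E'') (g \<cdot> f) \<cdot> v"
    using comp_el[OF comp_in_hom[OF v alg_struct[OF lhom_dom[OF f]]] f' g']
      lhom_el[OF f v] lhom_el[OF g comp_in_hom[OF v vmap_in_hom[OF f']]] vmap_comp_el[OF f' g' v]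
    by simp
qed

lemma lhom_id: "alg E \<Longrightarrow> Id X (fst E) \<in> lhom E E"
  using comp_id[OF alg_struct] id_comp[OF alg_struct] alg_ob id_in_hom vmap_id by (simp add: EM_def)

lemma EM_simps [simp]: "Ob (EM X L) = algebras X L" "Comp (EM X L) = Comp X" "Id (EM X L) E = Id X (fst E)"
  by (simp_all add: EM_def)

lemma free_simps [simp]: "fst (free L A) = TOb L A" "snd (free L A) = TMult L A"
  by (simp_all add: free_def)

lemma alg_free: "A \<in> Ob X \<Longrightarrow> alg (free L A)"
  by (rule algI) (simp_all add: TOb_ob TMult_in_hom mult_unit mult_assoc)

lemma struct_lhom: "alg E \<Longrightarrow> snd E \<in> lhom (free L (fst E)) E"
  by (rule lhomI) (simp_all add: alg_free alg_ob alg_struct alg_assoc_el)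

lemma vmap_lhom:
  assumes f: "f \<in> Hom X A B"
  shows "vmap X L A B f \<in> lhom (free L A) (free L B)"
proof (rule lhomI)
  show "alg (free L A)" "alg (free L B)" using f dom_ob cod_ob alg_free by blast+
  note f' = vmap_in_hom[OF f]
  show "vmap X L A B f \<in> Hom X (fst (free L A)) (fst (free L B))" using f' by simp
  fix v assume "v \<in> el (TOb L (fst (free L A)))"
  then have v: "v \<in> el (TOb L (TOb L A))" by simp
  show "vmap X L A B f \<cdot> snd (free L A) \<cdot> v =
      snd (free L B) \<cdot> vmap X L (fst (free L A)) (fst (free L B)) (vmap X L A B f) \<cdot> v"
    using comp_el[OF v TMult_in_hom[OF dom_ob[OF f]] f']
      comp_el[OF v vmap_in_hom[OF f'] TMult_in_hom[OF cod_ob[OF f]]] TMult_nat[OF f] by simp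
qed

lemma ext_lhom: "alg E \<Longrightarrow> q \<in> Hom X A (fst E) \<Longrightarrow> snd E \<cdot> vmap X L A (fst E) q \<in> lhom (free L A) E"
  by (rule lhom_comp[OF vmap_lhom struct_lhom])

lemma ext_unit:
  assumes E: "alg E" and q: "q \<in> Hom X A (fst E)" and x: "x \<in> el A"
  shows "snd E \<cdot> vmap X L A (fst E) q \<cdot> TUnit L A \<cdot> x = q \<cdot> x"
proof -
  have u: "TUnit L A \<in> Hom X A (TOb L A)" using q dom_ob TUnit_in_hom by blast
  have "vmap X L A (fst E) q \<cdot> TUnit L A \<cdot> x = TUnit L (fst E) \<cdot> q \<cdot> x"
    using comp_el[OF x u vmap_in_hom[OF q]] comp_el[OF x q TUnit_in_hom[OF alg_ob[OF E]]]
      TUnit_nat[OF q] by simp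
  then show ?thesis using alg_unit_el[OF E comp_in_hom[OF x q]] by simp
qed

text \<open>Homomorphy of a map into an internal hom will be tested by evaluation at elements of E,
  and the test may be restricted to any S that determines homomorphisms into the given K. The two
  choices are all elements, and the image of the unit in a free algebra.\<close>

definition generates :: "'o \<times> 'a \<Rightarrow> 'o \<times> 'a \<Rightarrow> 'a set \<Rightarrow> bool" where
  "generates E K S \<longleftrightarrow> S \<subseteq> el (fst E) \<and>
    (\<forall>\<phi> \<in> lhom E K. \<forall>\<psi> \<in> lhom E K. (\<forall>x \<in> S. \<phi> \<cdot> x = \<psi> \<cdot> x) \<longrightarrow> \<phi> = \<psi>)"

lemma generates_el: "generates E K (el (fst E))"
  unfolding generates_def by (auto intro: ext lhom_in_hom)

text \<open>A homomorphism \<open>\<chi>\<close> on a free algebra is recovered from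
  \<open>\<chi> \<cdot> TUnit L A\<close>: insert the identity as the multiplication after the
  mapped unit, then move \<open>\<chi>\<close> past the multiplication by homomorphy.\<close>

lemma free_lhom_unique:
  assumes f: "\<phi> \<in> lhom (free L A) K" and g: "\<psi> \<in> lhom (free L A) K" and A: "A \<in> Ob X"
    and eq: "\<And>x. x \<in> el A \<Longrightarrow> \<phi> \<cdot> TUnit L A \<cdot> x = \<psi> \<cdot> TUnit L A \<cdot> x"
  shows "\<phi> = \<psi>"
proof -
  note u = TUnit_in_hom[OF A] and m = TMult_in_hom[OF A]
  note f' = lhom_in_hom[OF f, simplified] and g' = lhom_in_hom[OF g, simplified]
  have e: "\<phi> \<cdot> TUnit L A = \<psi> \<cdot> TUnit L A"
    using eq by (intro ext[OF comp_in_hom[OF u f'] comp_in_hom[OF u g']])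
      (simp add: comp_el[OF _ u f'] comp_el[OF _ u g'])
  have *: "\<chi> = snd K \<cdot> vmap X L A (fst K) (\<chi> \<cdot> TUnit L A)" if h: "\<chi> \<in> lhom (free L A) K" for \<chi>
  proof -
    note h' = lhom_in_hom[OF h, simplified] and k = alg_struct[OF lhom_cod[OF h]]
    have "\<chi> = \<chi> \<cdot> TMult L A \<cdot> vmap X L A (TOb L A) (TUnit L A)"
      using mult_vmap_unit[OF A] comp_id[OF h'] by simp
    also have "\<dots> = (\<chi> \<cdot> TMult L A) \<cdot> vmap X L A (TOb L A) (TUnit L A)"
      using comp_assoc[OF vmap_in_hom[OF u] m h'] by simp
    also have "\<dots> = (snd K \<cdot> vmap X L (TOb L A) (fst K) \<chi>) \<cdot> vmap X L A (TOb L A) (TUnit L A)"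
      using lhom_eq[OF h] by simp
    also have "\<dots> = snd K \<cdot> vmap X L A (fst K) (\<chi> \<cdot> TUnit L A)"
      using comp_assoc[OF vmap_in_hom[OF u] vmap_in_hom[OF h'] k] vmap_comp[OF u h'] by simp
    finally show ?thesis .
  qed
  show ?thesis using *[OF f] *[OF g] e by simp
qed

lemma generates_unit: "A \<in> Ob X \<Longrightarrow> generates (free L A) K ((\<lambda>x. TUnit L A \<cdot> x) ` el A)"
  unfolding generates_def by (auto intro: free_lhom_unique comp_in_hom TUnit_in_hom)

section \<open>The hom-object of two algebras and its elements\<close>

lemma em_equalizer_spec:
  assumes E: "alg E" and K: "alg K"
  shows "is_equalizer X (Exp X (fst E) (fst K)) (Exp X (TOb L (fst E)) (fst K))
      (exp_pre X (TOb L (fst E)) (fst E) (fst K) (snd E))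
      (exp_post X (TOb L (fst E)) (TOb L (fst K)) (fst K) (snd K) \<cdot> THom L (fst E) (fst K))
      (em_hom X L E K) (em_incl X L E K)"
proof -
  note A = alg_ob[OF E] and B = alg_ob[OF K]
  let ?P = "\<lambda>(M, i). is_equalizer X (Exp X (fst E) (fst K)) (Exp X (TOb L (fst E)) (fst K))
      (exp_pre X (TOb L (fst E)) (fst E) (fst K) (snd E))
      (exp_post X (TOb L (fst E)) (TOb L (fst K)) (fst K) (snd K) \<cdot> THom L (fst E) (fst K)) M i"
  have "\<exists>M i. ?P (M, i)"
    using equalizer_ex[OF exp_pre_in_hom[OF alg_struct[OF E] B]
        comp_in_hom[OF THom_in_hom[OF A B] exp_post_in_hom[OF alg_struct[OF K] TOb_ob[OF A]]]]
    by simp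
  then have "\<exists>p. ?P p" by blast
  then have "?P (em_equalizer X L E K)" unfolding em_equalizer_def Let_def by (rule someI_ex)
  then show ?thesis unfolding em_hom_def em_incl_def by (simp add: case_prod_unfold)
qed

context
  fixes E K
  assumes E: "alg E" and K: "alg K"
begin

lemma em_incl_in_hom: "em_incl X L E K \<in> Hom X (em_hom X L E K) (Exp X (fst E) (fst K))"
  using em_equalizer_spec[OF E K] unfolding is_equalizer_def by blast

lemma em_hom_ob: "em_hom X L E K \<in> Ob X"
  using em_incl_in_hom dom_ob by blast

text \<open>At a point v of \<open>L A\<close> the two maps of the equalizer pair yield the two
  sides of the homomorphism square for the morphism named by n. Hence the elements of the hom-object
  are the homomorphisms.\<close>

lemma em_condition:
  assumes n: "n \<in> el (Exp X (fst E) (fst K))"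
  shows "exp_pre X (TOb L (fst E)) (fst E) (fst K) (snd E) \<cdot> n =
      (exp_post X (TOb L (fst E)) (TOb L (fst K)) (fst K) (snd K) \<cdot> THom L (fst E) (fst K)) \<cdot> n \<longleftrightarrow>
    named_by X (fst E) (fst K) n \<in> lhom E K" (is "?l = ?r \<longleftrightarrow> ?h \<in> _")
proof -
  note A = alg_ob[OF E] and B = alg_ob[OF K] and e = alg_struct[OF E] and k = alg_struct[OF K]
  note t = THom_in_hom[OF A B] and po = exp_post_in_hom[OF k TOb_ob[OF A]]
    and pr = exp_pre_in_hom[OF e B]
  note h = named_by_in_hom[OF n A B]
  have l: "ap (TOb L (fst E)) (fst K) ?l v = ?h \<cdot> snd E \<cdot> v" if v: "v \<in> el (TOb L (fst E))" for v
    using exp_pre_el[OF e B n v] named_by_el[OF n comp_in_hom[OF v e] B] by simp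
  have r: "ap (TOb L (fst E)) (fst K) ?r v = snd K \<cdot> vmap X L (fst E) (fst K) ?h \<cdot> v"
    if v: "v \<in> el (TOb L (fst E))" for v
    using exp_post_el[OF k TOb_ob[OF A] comp_in_hom[OF n t] v] THom_el[OF n A B v] comp_el[OF n t po]
    by simp
  show ?thesis
  proof
    assume "?l = ?r"
    then show "?h \<in> lhom E K" using l r by (intro lhomI[OF E K h]) simp
  next
    assume h': "?h \<in> lhom E K"
    show "?l = ?r"
      by (rule ap_ext[OF comp_in_hom[OF n pr] comp_in_hom[OF n comp_in_hom[OF t po]] TOb_ob[OF A] B])
        (simp add: l r lhom_el[OF h'])
  qed
qed

text \<open>\<open>hom_at\<close> and \<open>em_ev\<close> are the two partial applications of the
  evaluation pairing (n,x) \<mapsto> n(x) on the hom-object: the first fixes n and is a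
  homomorphism, the second fixes x and is a morphism in n.\<close>

definition hom_at :: "'a \<Rightarrow> 'a" where
  "hom_at n = named_by X (fst E) (fst K) (em_incl X L E K \<cdot> n)"

definition em_ev :: "'a \<Rightarrow> 'a" where
  "em_ev x = evat (fst E) (fst K) x \<cdot> em_incl X L E K"

lemma em_ev_in_hom: "x \<in> el (fst E) \<Longrightarrow> em_ev x \<in> Hom X (em_hom X L E K) (fst K)"
  unfolding em_ev_def using evat_in_hom alg_ob[OF K] em_incl_in_hom comp_in_hom by blast

lemma em_ev_el:
  assumes x: "x \<in> el (fst E)" and n: "n \<in> el (em_hom X L E K)"
  shows "em_ev x \<cdot> n = hom_at n \<cdot> x"
proof -
  note i = em_incl_in_hom
  note B = alg_ob[OF K] and In = comp_in_hom[OF n i]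
  show ?thesis
    unfolding em_ev_def hom_at_def comp_el[OF n i evat_in_hom[OF x B]] evat_el[OF x B In]
      named_by_el[OF In x B] ..
qed

lemma incl_ap:
  assumes x: "x \<in> el (fst E)" and n: "n \<in> el (em_hom X L E K)"
  shows "ap (fst E) (fst K) (em_incl X L E K \<cdot> n) x = em_ev x \<cdot> n"
  unfolding em_ev_el[OF x n] hom_at_def
  by (rule named_by_el[OF comp_in_hom[OF n em_incl_in_hom] x alg_ob[OF K], symmetric])

text \<open>By well-pointedness the equalizing condition on h may be tested at each element d, where
  \<open>em_condition\<close> reads it as homomorphy.\<close>

lemma em_factor:
  assumes h: "h \<in> Hom X D (Exp X (fst E) (fst K))"
    and lh: "\<And>d. d \<in> el D \<Longrightarrow> named_by X (fst E) (fst K) (h \<cdot> d) \<in> lhom E K"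
  shows "\<exists>!u. u \<in> Hom X D (em_hom X L E K) \<and> em_incl X L E K \<cdot> u = h"
proof -
  note A = alg_ob[OF E] and B = alg_ob[OF K]
  note pr = exp_pre_in_hom[OF alg_struct[OF E] B]
    and po = comp_in_hom[OF THom_in_hom[OF A B] exp_post_in_hom[OF alg_struct[OF K] TOb_ob[OF A]]]
  have "exp_pre X (TOb L (fst E)) (fst E) (fst K) (snd E) \<cdot> h =
      (exp_post X (TOb L (fst E)) (TOb L (fst K)) (fst K) (snd K) \<cdot> THom L (fst E) (fst K)) \<cdot> h"
    by (rule ext[OF comp_in_hom[OF h pr] comp_in_hom[OF h po]])
      (simp add: comp_el[OF _ h pr] comp_el[OF _ h po] em_condition[OF comp_in_hom[OF _ h]] lh)
  then show ?thesis using em_equalizer_spec[OF E K] h unfolding is_equalizer_def by blast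
qed

lemma hom_at_lhom:
  assumes n: "n \<in> el (em_hom X L E K)"
  shows "hom_at n \<in> lhom E K"
proof -
  note A = alg_ob[OF E] and B = alg_ob[OF K] and i = em_incl_in_hom
  note pr = exp_pre_in_hom[OF alg_struct[OF E] B]
    and po = comp_in_hom[OF THom_in_hom[OF A B] exp_post_in_hom[OF alg_struct[OF K] TOb_ob[OF A]]]
  have "exp_pre X (TOb L (fst E)) (fst E) (fst K) (snd E) \<cdot> em_incl X L E K =
      (exp_post X (TOb L (fst E)) (TOb L (fst K)) (fst K) (snd K) \<cdot> THom L (fst E) (fst K)) \<cdot>
        em_incl X L E K"
    using em_equalizer_spec[OF E K] unfolding is_equalizer_def by blast
  then have "exp_pre X (TOb L (fst E)) (fst E) (fst K) (snd E) \<cdot> em_incl X L E K \<cdot> n =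
      (exp_post X (TOb L (fst E)) (TOb L (fst K)) (fst K) (snd K) \<cdot> THom L (fst E) (fst K)) \<cdot>
        em_incl X L E K \<cdot> n"
    using comp_el[OF n i pr] comp_el[OF n i po] by simp
  then show ?thesis unfolding hom_at_def em_condition[OF comp_in_hom[OF n i]] .
qed

text \<open>The evaluations at S are jointly monic on the hom-object: they determine the named
  homomorphism because S generates, the homomorphism determines its name in the exponential, and the
  inclusion is monic as an equalizer.\<close>

lemma em_ext:
  assumes u: "u \<in> Hom X D (em_hom X L E K)" and u': "u' \<in> Hom X D (em_hom X L E K)"
    and S: "generates E K S"
    and eq: "\<And>d x. d \<in> el D \<Longrightarrow> x \<in> S \<Longrightarrow> em_ev x \<cdot> u \<cdot> d = em_ev x \<cdot> u' \<cdot> d"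
  shows "u = u'"
proof -
  note A = alg_ob[OF E] and B = alg_ob[OF K] and i = em_incl_in_hom
  have iu: "em_incl X L E K \<cdot> u = em_incl X L E K \<cdot> u'"
  proof (rule ext[OF comp_in_hom[OF u i] comp_in_hom[OF u' i]])
    fix d assume d: "d \<in> el D"
    note du = comp_in_hom[OF d u] and du' = comp_in_hom[OF d u']
    have "hom_at (u \<cdot> d) \<cdot> x = hom_at (u' \<cdot> d) \<cdot> x" if "x \<in> S" for x
      using eq[OF d that] em_ev_el[OF _ du, of x] em_ev_el[OF _ du', of x] S that
      unfolding generates_def by auto
    then have "hom_at (u \<cdot> d) = hom_at (u' \<cdot> d)"
      using S hom_at_lhom[OF du] hom_at_lhom[OF du'] unfolding generates_def by blast
    then have "em_incl X L E K \<cdot> u \<cdot> d = em_incl X L E K \<cdot> u' \<cdot> d"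
      unfolding hom_at_def
      using name_named[OF comp_in_hom[OF du i] A B] name_named[OF comp_in_hom[OF du' i] A B]
      by (metis (no_types))
    then show "(em_incl X L E K \<cdot> u) \<cdot> d = (em_incl X L E K \<cdot> u') \<cdot> d"
      using comp_el[OF d u i] comp_el[OF d u' i] by simp
  qed
  have "\<exists>!v. v \<in> Hom X D (em_hom X L E K) \<and> em_incl X L E K \<cdot> v = em_incl X L E K \<cdot> u"
  proof (rule em_factor[OF comp_in_hom[OF u i]])
    fix d assume d: "d \<in> el D"
    show "named_by X (fst E) (fst K) ((em_incl X L E K \<cdot> u) \<cdot> d) \<in> lhom E K"
      using hom_at_lhom[OF comp_in_hom[OF d u]] comp_el[OF d u i] unfolding hom_at_def by simp
  qed
  then obtain w where w: "\<And>v. v \<in> Hom X D (em_hom X L E K) \<Longrightarrow> em_incl X L E K \<cdot> v = em_incl X L E K \<cdot> u \<Longrightarrow> v = w"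
    by (elim ex1E) blast
  show ?thesis using w[OF u refl] w[OF u' iu[symmetric]] by simp
qed

lemma em_el_ext:
  assumes n: "n \<in> el (em_hom X L E K)" and n': "n' \<in> el (em_hom X L E K)"
    and eq: "hom_at n = hom_at n'"
  shows "n = n'"
proof (rule em_ext[OF n n' generates_el])
  fix d x assume "d \<in> el (One X)" and x: "x \<in> el (fst E)"
  then have "d = Id X (One X)" by (rule_tac el_One)
  then show "em_ev x \<cdot> n \<cdot> d = em_ev x \<cdot> n' \<cdot> d"
    by (simp add: comp_id[OF n] comp_id[OF n'] em_ev_el[OF x n] em_ev_el[OF x n'] eq)
qed

lemma hom_at_surj:
  assumes p: "\<phi> \<in> lhom E K"
  obtains n where "n \<in> el (em_hom X L E K)" "hom_at n = \<phi>"
proof -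
  note p' = lhom_in_hom[OF p]
  note n = name_of_in_hom[OF p']
  have "\<exists>!u. u \<in> el (em_hom X L E K) \<and> em_incl X L E K \<cdot> u = name_of X (fst E) (fst K) \<phi>"
    by (rule em_factor[OF n]) (use el_One comp_id[OF n] named_name[OF p'] p in auto)
  then obtain u where "u \<in> el (em_hom X L E K)" "em_incl X L E K \<cdot> u = name_of X (fst E) (fst K) \<phi>"
    by blast
  then show ?thesis using that[of u] named_name[OF p'] unfolding hom_at_def by simp
qed

end

section \<open>The internal hom of algebras\<close>

text \<open>The strength at (w,x) is \<open>L\<close> applied to the section fixing x, and
  evaluation after this section is \<open>evat\<close>. So every evaluation carries the pointwise
  structure to that of K.\<close>

lemma pointwise_in_hom_el:
  assumes A: "A \<in> Ob X" and K: "alg K"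
  shows pointwise_in_hom:
      "pointwise X L A K \<in> Hom X (TOb L (Exp X A (fst K))) (Exp X A (fst K))"
    and pointwise_el: "\<And>w x. w \<in> el (TOb L (Exp X A (fst K))) \<Longrightarrow> x \<in> el A \<Longrightarrow>
      ap A (fst K) (pointwise X L A K \<cdot> w) x =
        snd K \<cdot> vmap X L (Exp X A (fst K)) (fst K) (evat A (fst K) x) \<cdot> w"
proof -
  let ?M = "Exp X A (fst K)"
  note B = alg_ob[OF K] and k = alg_struct[OF K]
  note M = exp_ob[OF A B] and v = ev_in_hom[OF A B]
  note Lv = vmap_in_hom[OF v] and t = strength1_in_hom[OF M A]
  note Lvt = comp_in_hom[OF t Lv]
  note h = comp_in_hom[OF Lvt k]
  have pw: "pointwise X L A K = curry X (TOb L ?M) A (fst K)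
      (snd K \<cdot> vmap X L (?M \<times>\<^bsub>X\<^esub> A) (fst K) (Ev X A (fst K)) \<cdot> strength1 X L ?M A)"
    unfolding pointwise_def Let_def ..
  show "pointwise X L A K \<in> Hom X (TOb L ?M) ?M"
    unfolding pw by (rule curry_in_hom[OF h TOb_ob[OF M] A])
  fix w x assume w: "w \<in> el (TOb L ?M)" and x: "x \<in> el A"
  note p = point_in_hom[OF w x]
  show "ap A (fst K) (pointwise X L A K \<cdot> w) x = snd K \<cdot> vmap X L ?M (fst K) (evat A (fst K) x) \<cdot> w"
    unfolding pw curry_el[OF h w x] comp_el[OF p Lvt k] comp_el[OF p t Lv] strength1_el[OF M A w x]
      evat_def vmap_comp_el[OF sec1_in_hom[OF x M] v w] ..
qed

context
  fixes E K
  assumes E: "alg E" and K: "alg K"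
begin

text \<open>By commutativity, a pointwise combination of homomorphisms is again a homomorphism, so that
  the pointwise structure restricts to the hom-object.\<close>

lemma pointwise_lhom:
  assumes w: "w \<in> el (TOb L (em_hom X L E K))"
    and \<phi>: "\<phi> \<in> Hom X (fst E) (fst K)"
    and eq: "\<And>x. x \<in> el (fst E) \<Longrightarrow>
      \<phi> \<cdot> x = snd K \<cdot> vmap X L (em_hom X L E K) (fst K) (em_ev E K x) \<cdot> w"
  shows "\<phi> \<in> lhom E K"
proof (rule lhomI[OF E K \<phi>])
  fix v assume v: "v \<in> el (TOb L (fst E))"
  let ?A = "fst E" and ?B = "fst K" and ?M = "em_hom X L E K" and ?i = "em_incl X L E K"
  note A = alg_ob[OF E] and B = alg_ob[OF K] and e = alg_struct[OF E] and k = alg_struct[OF K]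
  note M = em_hom_ob[OF E K] and i = em_incl_in_hom[OF E K]
  \<comment> \<open>\<open>?f\<close> is the evaluation pairing (x,n) \<mapsto> n(x) on the product
    of A with the hom-object. Integrating n against w gives \<phi>, by hypothesis; integrating x
    against v gives evaluation at \<open>snd E \<cdot> v\<close>, because every n is a
    homomorphism.\<close>
  let ?p = "pair X (?A \<times>\<^bsub>X\<^esub> ?M) (Exp X ?A ?B) ?A (?i \<cdot> Snd X ?A ?M) (Fst X ?A ?M)"
  let ?f = "Ev X ?A ?B \<cdot> ?p"
  note F = fst_in_hom[OF A M] and S = snd_in_hom[OF A M]
  note iS = comp_in_hom[OF S i]
  note p = pair_in_hom[OF iS F]
  note f = comp_in_hom[OF p ev_in_hom[OF A B]]
  have f_el: "?f \<cdot> point X ?A ?M x n = em_ev E K x \<cdot> n" if x: "x \<in> el ?A" and n: "n \<in> el ?M" for x n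
  proof -
    note xn = point_in_hom[OF x n]
    show ?thesis
      unfolding comp_el[OF xn p ev_in_hom[OF A B]] pair_el[OF iS F xn] comp_el[OF xn S i]
        fst_point[OF x n] snd_point[OF x n] incl_ap[OF E K x n, symmetric] ap_def ..
  qed
  have f2: "?f \<cdot> sec2 ?A ?M x = em_ev E K x" if x: "x \<in> el ?A" for x
  proof (rule ext[OF comp_in_hom[OF sec2_in_hom[OF x M] f] em_ev_in_hom[OF E K x]])
    fix n assume n: "n \<in> el ?M"
    show "(?f \<cdot> sec2 ?A ?M x) \<cdot> n = em_ev E K x \<cdot> n"
      unfolding comp_el[OF n sec2_in_hom[OF x M] f] sec2_el[OF x n] f_el[OF x n] ..
  qed
  have f1: "?f \<cdot> sec1 ?A ?M n = hom_at E K n" if n: "n \<in> el ?M" for n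
  proof (rule ext[OF comp_in_hom[OF sec1_in_hom[OF n A] f] lhom_in_hom[OF hom_at_lhom[OF E K n]]])
    fix x assume x: "x \<in> el ?A"
    show "(?f \<cdot> sec1 ?A ?M n) \<cdot> x = hom_at E K n \<cdot> x"
      unfolding comp_el[OF x sec1_in_hom[OF n A] f] sec1_el[OF n x] f_el[OF x n]
        em_ev_el[OF E K x n] ..
  qed
  have i2: "inner2 ?A ?M ?B (snd K) ?f w = \<phi>"
    by (rule ext[OF inner2_in_hom[OF A M k f w] \<phi>]) (simp add: inner2_el[OF A M k f w] f2 eq)
  note ev = comp_in_hom[OF v e]
  have i1: "inner1 ?A ?M ?B (snd K) ?f v = em_ev E K (snd E \<cdot> v)"
    by (rule ext[OF inner1_in_hom[OF A M k f v] em_ev_in_hom[OF E K ev]])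
      (simp add: inner1_el[OF A M k f v] f1 lhom_el[OF hom_at_lhom[OF E K] v, symmetric]
        em_ev_el[OF E K ev])
  \<comment> \<open>The two sides of the homomorphism square are the two iterated integrals of
    \<open>?f\<close> against v and w, and commutativity of \<open>L\<close> identifies
    them.\<close>
  show "\<phi> \<cdot> snd E \<cdot> v = snd K \<cdot> vmap X L ?A ?B \<phi> \<cdot> v"
    using integral_otimes[OF A M k f alg_assoc[OF K] v w]
      integral_otimes_tilde[OF A M k f alg_assoc[OF K] v w] commutative[OF A M]
    unfolding i1 i2 eq[OF ev] by simp
qed

lemma ihom_struct_ex:
  "\<exists>!s. s \<in> Hom X (TOb L (em_hom X L E K)) (em_hom X L E K) \<and> em_incl X L E K \<cdot> s =
    pointwise X L (fst E) K \<cdot> vmap X L (em_hom X L E K) (Exp X (fst E) (fst K)) (em_incl X L E K)"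
  (is "\<exists>!s. _ \<and> _ = ?pw \<cdot> ?Li")
  and ihom_pointwise_el: "\<And>w x. w \<in> el (TOb L (em_hom X L E K)) \<Longrightarrow> x \<in> el (fst E) \<Longrightarrow>
    ap (fst E) (fst K) ((pointwise X L (fst E) K \<cdot>
        vmap X L (em_hom X L E K) (Exp X (fst E) (fst K)) (em_incl X L E K)) \<cdot> w) x =
      snd K \<cdot> vmap X L (em_hom X L E K) (fst K) (em_ev E K x) \<cdot> w"
proof -
  note A = alg_ob[OF E] and B = alg_ob[OF K] and i = em_incl_in_hom[OF E K]
  note Li = vmap_in_hom[OF i] and pw = pointwise_in_hom[OF A K]
  have *: "ap (fst E) (fst K) ((?pw \<cdot> ?Li) \<cdot> w) x =
      snd K \<cdot> vmap X L (em_hom X L E K) (fst K) (em_ev E K x) \<cdot> w"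
    if w: "w \<in> el (TOb L (em_hom X L E K))" and x: "x \<in> el (fst E)" for w x
    unfolding comp_el[OF w Li pw] pointwise_el[OF A K comp_in_hom[OF w Li] x] em_ev_def[OF E K]
      vmap_comp_el[OF i evat_in_hom[OF x B] w] ..
  then show "\<And>w x. w \<in> el (TOb L (em_hom X L E K)) \<Longrightarrow> x \<in> el (fst E) \<Longrightarrow>
    ap (fst E) (fst K) ((?pw \<cdot> ?Li) \<cdot> w) x =
      snd K \<cdot> vmap X L (em_hom X L E K) (fst K) (em_ev E K x) \<cdot> w" .
  note pL = comp_in_hom[OF Li pw]
  show "\<exists>!s. s \<in> Hom X (TOb L (em_hom X L E K)) (em_hom X L E K) \<and> em_incl X L E K \<cdot> s = ?pw \<cdot> ?Li"
  proof (rule em_factor[OF E K pL])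
    fix w assume w: "w \<in> el (TOb L (em_hom X L E K))"
    show "named_by X (fst E) (fst K) ((?pw \<cdot> ?Li) \<cdot> w) \<in> lhom E K"
      by (rule pointwise_lhom[OF w named_by_in_hom[OF comp_in_hom[OF w pL] A B]])
        (simp add: named_by_el[OF comp_in_hom[OF w pL] _ B] *[OF w])
  qed
qed

lemma fst_ihom [simp]: "fst (ihom X L E K) = em_hom X L E K"
  unfolding ihom_def Let_def by simp

lemma ihom_struct_in_hom: "snd (ihom X L E K) \<in> Hom X (TOb L (em_hom X L E K)) (em_hom X L E K)"
  and ihom_struct_incl: "em_incl X L E K \<cdot> snd (ihom X L E K) =
    pointwise X L (fst E) K \<cdot> vmap X L (em_hom X L E K) (Exp X (fst E) (fst K)) (em_incl X L E K)"
  using theI'[OF ihom_struct_ex] unfolding ihom_def Let_def by simp_all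

text \<open>Evaluation at x factors through the inclusion into the exponential, along which the
  structure of the internal hom is a restriction of the pointwise one.\<close>

lemma ihom_struct_el:
  assumes w: "w \<in> el (TOb L (em_hom X L E K))" and x: "x \<in> el (fst E)"
  shows "em_ev E K x \<cdot> snd (ihom X L E K) \<cdot> w =
    snd K \<cdot> vmap X L (em_hom X L E K) (fst K) (em_ev E K x) \<cdot> w"
  using ihom_pointwise_el[OF w x] incl_ap[OF E K x comp_in_hom[OF w ihom_struct_in_hom]]
    comp_el[OF w ihom_struct_in_hom em_incl_in_hom[OF E K]]
  unfolding ihom_struct_incl[symmetric] by simp

text \<open>Each law is tested after all evaluations \<open>em_ev E K x\<close>. These are jointly
  monic and compatible with the structures, so the law becomes the corresponding one for K.\<close>

lemma ihom_alg: "alg (ihom X L E K)"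
proof (rule algI)
  let ?M = "em_hom X L E K" and ?s = "snd (ihom X L E K)"
  note A = alg_ob[OF E] and B = alg_ob[OF K] and M = em_hom_ob[OF E K] and s = ihom_struct_in_hom
  note LM = TOb_ob[OF M]
  note u = TUnit_in_hom[OF M] and m = TMult_in_hom[OF M] and Ls = vmap_in_hom[OF s]
  note em_ev = em_ev_in_hom[OF E K]
  show "fst (ihom X L E K) \<in> Ob X" using M by simp
  show "?s \<in> Hom X (TOb L (fst (ihom X L E K))) (fst (ihom X L E K))" using s by simp
  have "?s \<cdot> TUnit L ?M = Id X ?M"
  proof (rule em_ext[OF E K comp_in_hom[OF u s] id_in_hom[OF M] generates_el])
    fix n x assume n: "n \<in> el ?M" and x: "x \<in> el (fst E)"
    show "em_ev E K x \<cdot> (?s \<cdot> TUnit L ?M) \<cdot> n = em_ev E K x \<cdot> Id X ?M \<cdot> n"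
      unfolding comp_el[OF n u s] ihom_struct_el[OF comp_in_hom[OF n u] x] id_comp[OF n]
      by (rule ext_unit[OF K em_ev[OF x] n])
  qed
  then show "?s \<cdot> TUnit L (fst (ihom X L E K)) = Id X (fst (ihom X L E K))" by simp
  have "?s \<cdot> vmap X L (TOb L ?M) ?M ?s = ?s \<cdot> TMult L ?M"
  proof (rule em_ext[OF E K comp_in_hom[OF Ls s] comp_in_hom[OF m s] generates_el])
    fix w x assume w: "w \<in> el (TOb L (TOb L ?M))" and x: "x \<in> el (fst E)"
    let ?h = "em_ev E K x"
    note h = em_ev[OF x]
    note Lh = vmap_in_hom[OF h] and k = alg_struct[OF K]
    have hs: "?h \<cdot> ?s = snd K \<cdot> vmap X L ?M (fst K) ?h"
      by (rule ext[OF comp_in_hom[OF s h] comp_in_hom[OF Lh k]])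
        (simp add: comp_el[OF _ s h] comp_el[OF _ Lh k] ihom_struct_el x)
    have "?h \<cdot> (?s \<cdot> vmap X L (TOb L ?M) ?M ?s) \<cdot> w =
        snd K \<cdot> vmap X L ?M (fst K) ?h \<cdot> vmap X L (TOb L ?M) ?M ?s \<cdot> w"
      unfolding comp_el[OF w Ls s] ihom_struct_el[OF comp_in_hom[OF w Ls] x] ..
    also have "\<dots> = snd K \<cdot> vmap X L (TOb L (fst K)) (fst K) (snd K) \<cdot>
        vmap X L (TOb L ?M) (TOb L (fst K)) (vmap X L ?M (fst K) ?h) \<cdot> w"
      unfolding vmap_comp_el[OF s h w, symmetric] hs vmap_comp_el[OF Lh k w] ..
    also have "\<dots> = snd K \<cdot> TMult L (fst K) \<cdot>
        vmap X L (TOb L ?M) (TOb L (fst K)) (vmap X L ?M (fst K) ?h) \<cdot> w"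
      by (rule alg_assoc_el[OF K comp_in_hom[OF w vmap_in_hom[OF Lh]]])
    also have "\<dots> = snd K \<cdot> vmap X L ?M (fst K) ?h \<cdot> TMult L ?M \<cdot> w"
      using TMult_nat[OF h] comp_el[OF w vmap_in_hom[OF Lh] TMult_in_hom[OF B]] comp_el[OF w m Lh]
      by simp
    also have "\<dots> = ?h \<cdot> (?s \<cdot> TMult L ?M) \<cdot> w"
      unfolding comp_el[OF w m s] ihom_struct_el[OF comp_in_hom[OF w m] x] ..
    finally show "?h \<cdot> (?s \<cdot> vmap X L (TOb L ?M) ?M ?s) \<cdot> w = ?h \<cdot> (?s \<cdot> TMult L ?M) \<cdot> w" .
  qed
  then show "?s \<cdot> vmap X L (TOb L (fst (ihom X L E K))) (fst (ihom X L E K)) ?s =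
      ?s \<cdot> TMult L (fst (ihom X L E K))" by simp
qed

lemma em_ev_lhom: "x \<in> el (fst E) \<Longrightarrow> em_ev E K x \<in> lhom (ihom X L E K) K"
  by (rule lhomI[OF ihom_alg K]) (simp_all add: em_ev_in_hom[OF E K] ihom_struct_el)

text \<open>The evaluations at S are homomorphisms and jointly monic, hence detect homomorphy. With
  S the units of a free algebra \<open>F B\<close>, a family of homomorphisms into K indexed by the
  points of B is enough.\<close>

lemma lhom_into_ihom:
  assumes E': "alg E'" and u: "u \<in> Hom X (fst E') (em_hom X L E K)" and S: "generates E K S"
    and lh: "\<And>x. x \<in> S \<Longrightarrow> em_ev E K x \<cdot> u \<in> lhom E' K"
  shows "u \<in> lhom E' (ihom X L E K)"
proof -
  let ?M = "em_hom X L E K" and ?s = "snd (ihom X L E K)"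
  note e = alg_struct[OF E'] and s = ihom_struct_in_hom and Lu = vmap_in_hom[OF u]
  have eq: "u \<cdot> snd E' = ?s \<cdot> vmap X L (fst E') ?M u"
  proof (rule em_ext[OF E K comp_in_hom[OF e u] comp_in_hom[OF Lu s] S])
    fix v x assume v: "v \<in> el (TOb L (fst E'))" and xS: "x \<in> S"
    have x: "x \<in> el (fst E)" using xS S unfolding generates_def by blast
    note h = em_ev_in_hom[OF E K x]
    have "em_ev E K x \<cdot> u \<cdot> snd E' \<cdot> v = (em_ev E K x \<cdot> u) \<cdot> snd E' \<cdot> v"
      by (rule comp_el[OF comp_in_hom[OF v e] u h, symmetric])
    also have "\<dots> = snd K \<cdot> vmap X L (fst E') (fst K) (em_ev E K x \<cdot> u) \<cdot> v"
      by (rule lhom_el[OF lh[OF xS] v])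
    also have "\<dots> = em_ev E K x \<cdot> ?s \<cdot> vmap X L (fst E') ?M u \<cdot> v"
      unfolding ihom_struct_el[OF comp_in_hom[OF v Lu] x] vmap_comp_el[OF u h v] ..
    finally show "em_ev E K x \<cdot> (u \<cdot> snd E') \<cdot> v = em_ev E K x \<cdot> (?s \<cdot> vmap X L (fst E') ?M u) \<cdot> v"
      unfolding comp_el[OF v e u] comp_el[OF v Lu s] .
  qed
  show ?thesis
    by (rule lhomI[OF E' ihom_alg])
      (use u eq comp_el[OF _ e u] comp_el[OF _ Lu s] in auto)
qed

end

section \<open>Functoriality of the internal hom\<close>

lemma ihom_pre_props:
  assumes h: "h \<in> lhom E E'" and K: "alg K"
  shows ihom_pre_lhom: "ihom_pre X L E E' K h \<in> lhom (ihom X L E' K) (ihom X L E K)"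
    and hom_at_ihom_pre: "\<And>n. n \<in> el (em_hom X L E' K) \<Longrightarrow>
      hom_at E K (ihom_pre X L E E' K h \<cdot> n) = hom_at E' K n \<cdot> h"
proof -
  note E = lhom_dom[OF h] and E' = lhom_cod[OF h] and h' = lhom_in_hom[OF h]
  note A = alg_ob[OF E] and A' = alg_ob[OF E'] and B = alg_ob[OF K]
  let ?c = "exp_pre X (fst E) (fst E') (fst K) h" and ?i = "em_incl X L E K" and ?i' = "em_incl X L E' K"
  note i = em_incl_in_hom[OF E K] and i' = em_incl_in_hom[OF E' K] and c = exp_pre_in_hom[OF h' B]
  note ci = comp_in_hom[OF i' c]
  have at: "named_by X (fst E) (fst K) ((?c \<cdot> ?i') \<cdot> n) = hom_at E' K n \<cdot> h"
    if n: "n \<in> el (em_hom X L E' K)" for n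
  proof (rule ext[OF named_by_in_hom[OF comp_in_hom[OF n ci] A B]
        comp_in_hom[OF h' lhom_in_hom[OF hom_at_lhom[OF E' K n]]]])
    fix x assume x: "x \<in> el (fst E)"
    show "named_by X (fst E) (fst K) ((?c \<cdot> ?i') \<cdot> n) \<cdot> x = (hom_at E' K n \<cdot> h) \<cdot> x"
      unfolding named_by_el[OF comp_in_hom[OF n ci] x B]
      unfolding comp_el[OF n i' c]
        exp_pre_el[OF h' B comp_in_hom[OF n i'] x]
        comp_el[OF x h' lhom_in_hom[OF hom_at_lhom[OF E' K n]]]
        incl_ap[OF E' K comp_in_hom[OF x h'] n] em_ev_el[OF E' K comp_in_hom[OF x h'] n] ..
  qed
  have ex: "\<exists>!u. u \<in> Hom X (em_hom X L E' K) (em_hom X L E K) \<and> ?i \<cdot> u = ?c \<cdot> ?i'"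
    by (rule em_factor[OF E K ci]) (simp add: at lhom_comp[OF h hom_at_lhom[OF E' K]])
  then obtain u where u: "u \<in> Hom X (em_hom X L E' K) (em_hom X L E K)" and iu: "?i \<cdot> u = ?c \<cdot> ?i'"
    by blast
  have au: "hom_at E K (u \<cdot> n) = hom_at E' K n \<cdot> h" if n: "n \<in> el (em_hom X L E' K)" for n
    using at[OF n] comp_el[OF n u i] iu unfolding hom_at_def[OF E K] by simp
  \<comment> \<open>Evaluation at x after u is evaluation at \<open>h \<cdot> x\<close>, which is
    already known to be a homomorphism.\<close>
  have ul: "u \<in> lhom (ihom X L E' K) (ihom X L E K)"
  proof (rule lhom_into_ihom[OF E K ihom_alg[OF E' K] _ generates_el])
    show "u \<in> Hom X (fst (ihom X L E' K)) (em_hom X L E K)" using u E' K by simp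
    fix x assume x: "x \<in> el (fst E)"
    note hx = comp_in_hom[OF x h']
    have "em_ev E K x \<cdot> u = em_ev E' K (h \<cdot> x)"
    proof (rule ext[OF comp_in_hom[OF u em_ev_in_hom[OF E K x]] em_ev_in_hom[OF E' K hx]])
      fix n assume n: "n \<in> el (em_hom X L E' K)"
      show "(em_ev E K x \<cdot> u) \<cdot> n = em_ev E' K (h \<cdot> x) \<cdot> n"
        unfolding comp_el[OF n u em_ev_in_hom[OF E K x]] em_ev_el[OF E K x comp_in_hom[OF n u]]
          em_ev_el[OF E' K hx n] au[OF n] comp_el[OF x h' lhom_in_hom[OF hom_at_lhom[OF E' K n]]] ..
    qed
    then show "em_ev E K x \<cdot> u \<in> lhom (ihom X L E' K) K" using em_ev_lhom[OF E' K hx] by simp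
  qed
  \<comment> \<open>Any candidate for the definite description is also a factorization through the
    inclusion, and \<open>ex\<close> leaves only one of these.\<close>
  have "ihom_pre X L E E' K h = u"
    unfolding ihom_pre_def
  proof (rule the_equality)
    show "u \<in> lhom (ihom X L E' K) (ihom X L E K) \<and> ?i \<cdot> u = ?c \<cdot> ?i'" using ul iu ..
    fix v assume v: "v \<in> lhom (ihom X L E' K) (ihom X L E K) \<and> ?i \<cdot> v = ?c \<cdot> ?i'"
    then have "v \<in> Hom X (em_hom X L E' K) (em_hom X L E K)"
      using lhom_in_hom[of v "ihom X L E' K" "ihom X L E K"] E E' K by auto
    then show "v = u" using ex u iu v by (elim ex1E) auto
  qed
  then show "ihom_pre X L E E' K h \<in> lhom (ihom X L E' K) (ihom X L E K)"
    and "\<And>n. n \<in> el (em_hom X L E' K) \<Longrightarrow>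
      hom_at E K (ihom_pre X L E E' K h \<cdot> n) = hom_at E' K n \<cdot> h"
    using ul au by simp_all
qed

lemma ihom_post_props:
  assumes g: "g \<in> lhom K K'" and E: "alg E"
  shows ihom_post_lhom: "ihom_post X L E K K' g \<in> lhom (ihom X L E K) (ihom X L E K')"
    and hom_at_ihom_post: "\<And>n. n \<in> el (em_hom X L E K) \<Longrightarrow>
      hom_at E K' (ihom_post X L E K K' g \<cdot> n) = g \<cdot> hom_at E K n"
proof -
  note K = lhom_dom[OF g] and K' = lhom_cod[OF g] and g' = lhom_in_hom[OF g]
  note A = alg_ob[OF E] and B = alg_ob[OF K] and B' = alg_ob[OF K']
  let ?c = "exp_post X (fst E) (fst K) (fst K') g" and ?i = "em_incl X L E K" and ?i' = "em_incl X L E K'"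
  note i = em_incl_in_hom[OF E K] and i' = em_incl_in_hom[OF E K'] and c = exp_post_in_hom[OF g' A]
  note ci = comp_in_hom[OF i c]
  have at: "named_by X (fst E) (fst K') ((?c \<cdot> ?i) \<cdot> n) = g \<cdot> hom_at E K n"
    if n: "n \<in> el (em_hom X L E K)" for n
  proof (rule ext[OF named_by_in_hom[OF comp_in_hom[OF n ci] A B']
        comp_in_hom[OF lhom_in_hom[OF hom_at_lhom[OF E K n]] g']])
    fix x assume x: "x \<in> el (fst E)"
    show "named_by X (fst E) (fst K') ((?c \<cdot> ?i) \<cdot> n) \<cdot> x = (g \<cdot> hom_at E K n) \<cdot> x"
      unfolding named_by_el[OF comp_in_hom[OF n ci] x B']
      unfolding comp_el[OF n i c]
        exp_post_el[OF g' A comp_in_hom[OF n i] x]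
        comp_el[OF x lhom_in_hom[OF hom_at_lhom[OF E K n]] g']
        incl_ap[OF E K x n] em_ev_el[OF E K x n] ..
  qed
  have ex: "\<exists>!u. u \<in> Hom X (em_hom X L E K) (em_hom X L E K') \<and> ?i' \<cdot> u = ?c \<cdot> ?i"
    by (rule em_factor[OF E K' ci]) (simp add: at lhom_comp[OF hom_at_lhom[OF E K] g])
  then obtain u where u: "u \<in> Hom X (em_hom X L E K) (em_hom X L E K')" and iu: "?i' \<cdot> u = ?c \<cdot> ?i"
    by blast
  have au: "hom_at E K' (u \<cdot> n) = g \<cdot> hom_at E K n" if n: "n \<in> el (em_hom X L E K)" for n
    using at[OF n] comp_el[OF n u i'] iu unfolding hom_at_def[OF E K'] by simp
  \<comment> \<open>Here evaluation at x after u is g after evaluation at x, a composite of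
    homomorphisms.\<close>
  have ul: "u \<in> lhom (ihom X L E K) (ihom X L E K')"
  proof (rule lhom_into_ihom[OF E K' ihom_alg[OF E K] _ generates_el])
    show "u \<in> Hom X (fst (ihom X L E K)) (em_hom X L E K')" using u E K by simp
    fix x assume x: "x \<in> el (fst E)"
    note hx = em_ev_in_hom[OF E K x]
    have "em_ev E K' x \<cdot> u = g \<cdot> em_ev E K x"
    proof (rule ext[OF comp_in_hom[OF u em_ev_in_hom[OF E K' x]] comp_in_hom[OF hx g']])
      fix n assume n: "n \<in> el (em_hom X L E K)"
      show "(em_ev E K' x \<cdot> u) \<cdot> n = (g \<cdot> em_ev E K x) \<cdot> n"
        unfolding comp_el[OF n u em_ev_in_hom[OF E K' x]] em_ev_el[OF E K' x comp_in_hom[OF n u]]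
          comp_el[OF n hx g'] em_ev_el[OF E K x n] au[OF n]
          comp_el[OF x lhom_in_hom[OF hom_at_lhom[OF E K n]] g'] ..
    qed
    then show "em_ev E K' x \<cdot> u \<in> lhom (ihom X L E K) K'"
      using lhom_comp[OF em_ev_lhom[OF E K x] g] by simp
  qed
  have "ihom_post X L E K K' g = u"
    unfolding ihom_post_def
  proof (rule the_equality)
    show "u \<in> lhom (ihom X L E K) (ihom X L E K') \<and> ?i' \<cdot> u = ?c \<cdot> ?i" using ul iu ..
    fix v assume v: "v \<in> lhom (ihom X L E K) (ihom X L E K') \<and> ?i' \<cdot> v = ?c \<cdot> ?i"
    then have "v \<in> Hom X (em_hom X L E K) (em_hom X L E K')"
      using lhom_in_hom[of v "ihom X L E K" "ihom X L E K'"] E K K' by auto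
    then show "v = u" using ex u iu v by (elim ex1E) auto
  qed
  then show "ihom_post X L E K K' g \<in> lhom (ihom X L E K) (ihom X L E K')"
    and "\<And>n. n \<in> el (em_hom X L E K) \<Longrightarrow>
      hom_at E K' (ihom_post X L E K K' g \<cdot> n) = g \<cdot> hom_at E K n"
    using ul au by simp_all
qed

section \<open>The monad induced by a reflection\<close>

lemma free_hom_props:
  assumes A: "A \<in> Ob X" and B: "B \<in> Ob X"
  shows free_hom_in_hom: "free_hom X L A B \<in> Hom X (Exp X A B) (em_hom X L (free L A) (free L B))"
    and incl_free_hom: "em_incl X L (free L A) (free L B) \<cdot> free_hom X L A B = THom L A B"
proof -
  have "\<exists>!u. u \<in> Hom X (Exp X A B) (em_hom X L (free L A) (free L B)) \<and>
      em_incl X L (free L A) (free L B) \<cdot> u = THom L A B"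
    using THom_in_hom[OF A B] named_THom[OF _ A B] vmap_lhom[OF named_by_in_hom[OF _ A B]]
    by (intro em_factor[OF alg_free[OF A] alg_free[OF B]]) auto
  from theI'[OF this] show "free_hom X L A B \<in> Hom X (Exp X A B) (em_hom X L (free L A) (free L B))"
    and "em_incl X L (free L A) (free L B) \<cdot> free_hom X L A B = THom L A B"
    unfolding free_hom_def by blast+
qed

lemma hom_at_free_hom:
  assumes A: "A \<in> Ob X" and B: "B \<in> Ob X" and n: "n \<in> el (Exp X A B)"
  shows "hom_at (free L A) (free L B) (free_hom X L A B \<cdot> n) = vmap X L A B (named_by X A B n)"
  using comp_el[OF n free_hom_in_hom[OF A B] em_incl_in_hom[OF alg_free[OF A] alg_free[OF B]]]
    named_THom[OF n A B]
  unfolding hom_at_def[OF alg_free[OF A] alg_free[OF B]] incl_free_hom[OF A B] by simp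

end

locale algebra_reflection = commutative_monad X L
  for X :: "('o, 'a) ccc" (structure) and L :: "('o, 'a) vmonad" +
  fixes P :: "'o \<times> 'a \<Rightarrow> bool" and H :: "'o \<times> 'a \<Rightarrow> 'o \<times> 'a" and d :: "'o \<times> 'a \<Rightarrow> 'a"
  assumes reflection: "is_L_reflection X L P H d"
begin

lemma refl_props:
  assumes E: "alg E"
  shows refl_alg: "alg (H E)" and refl_P: "P (H E)" and unit_lhom: "d E \<in> lhom E (H E)"
  using reflection E unfolding is_L_reflection_def by auto

lemma ihom_iso:
  assumes E: "alg E" and K: "alg K" and PK: "P K"
  obtains g where "g \<in> lhom (ihom X L E K) (ihom X L (H E) K)"
    and "g \<cdot> ihom_pre X L E (H E) K (d E) = Id X (em_hom X L (H E) K)"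
    and "ihom_pre X L E (H E) K (d E) \<cdot> g = Id X (em_hom X L E K)"
proof -
  have "is_iso (EM X L) (ihom X L (H E) K) (ihom X L E K) (ihom_pre X L E (H E) K (d E))"
    using reflection E K PK unfolding is_L_reflection_def by auto
  then show ?thesis
    using that fst_ihom[OF E K] fst_ihom[OF refl_alg[OF E] K] unfolding is_iso_def by auto
qed

lemma ihom_pre_unit_in_hom:
  assumes E: "alg E" and K: "alg K"
  shows "ihom_pre X L E (H E) K (d E) \<in> Hom X (em_hom X L (H E) K) (em_hom X L E K)"
  using lhom_in_hom[OF ihom_pre_lhom[OF unit_lhom[OF E] K]] fst_ihom[OF E K]
    fst_ihom[OF refl_alg[OF E] K] by simp

text \<open>Elements of the hom-objects are homomorphisms, and \<open>ihom_pre\<close> acts on them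
  as precomposition with \<open>d E\<close>. The ordinary universal property is therefore the
  bijection on elements underlying the isomorphism of hom-objects.\<close>

lemma lift_ex:
  assumes \<phi>: "\<phi> \<in> lhom E K" and PK: "P K"
  shows "\<exists>!\<psi>. \<psi> \<in> lhom (H E) K \<and> \<psi> \<cdot> d E = \<phi>"
proof -
  note E = lhom_dom[OF \<phi>] and K = lhom_cod[OF \<phi>]
  note HE = refl_alg[OF E] and dE = unit_lhom[OF E]
  let ?p = "ihom_pre X L E (H E) K (d E)"
  note p = ihom_pre_unit_in_hom[OF E K]
  obtain g where gl: "g \<in> lhom (ihom X L E K) (ihom X L (H E) K)"
    and gp: "g \<cdot> ?p = Id X (em_hom X L (H E) K)" and pg: "?p \<cdot> g = Id X (em_hom X L E K)"
    using ihom_iso[OF E K PK] .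
  have g: "g \<in> Hom X (em_hom X L E K) (em_hom X L (H E) K)"
    using lhom_in_hom[OF gl] fst_ihom[OF E K] fst_ihom[OF HE K] by simp
  obtain n where n: "n \<in> el (em_hom X L E K)" and np: "hom_at E K n = \<phi>"
    using hom_at_surj[OF E K \<phi>] .
  note gn = comp_in_hom[OF n g]
  have "hom_at (H E) K (g \<cdot> n) \<cdot> d E = \<phi>"
    using hom_at_ihom_pre[OF dE K gn] comp_el[OF n g p] pg np id_comp[OF n] by simp
  moreover have "\<psi> = \<psi>'" if \<psi>: "\<psi> \<in> lhom (H E) K" and \<psi>': "\<psi>' \<in> lhom (H E) K"
    and eq: "\<psi> \<cdot> d E = \<psi>' \<cdot> d E" for \<psi> \<psi>'
  proof -
    obtain m where m: "m \<in> el (em_hom X L (H E) K)" and mp: "hom_at (H E) K m = \<psi>"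
      using hom_at_surj[OF HE K \<psi>] .
    obtain m' where m': "m' \<in> el (em_hom X L (H E) K)" and mp': "hom_at (H E) K m' = \<psi>'"
      using hom_at_surj[OF HE K \<psi>'] .
    have "?p \<cdot> m = ?p \<cdot> m'"
      by (rule em_el_ext[OF E K comp_in_hom[OF m p] comp_in_hom[OF m' p]])
        (simp add: hom_at_ihom_pre[OF dE K] m m' mp mp' eq)
    then have "m = m'"
      using comp_el[OF m p g] comp_el[OF m' p g] gp id_comp[OF m] id_comp[OF m'] by simp
    then show ?thesis using mp mp' by simp
  qed
  ultimately show ?thesis using hom_at_lhom[OF HE K gn] by (intro ex_ex1I) blast+
qed

lemma lift_unique:
  assumes "\<phi> \<in> lhom (H E) K" "\<psi> \<in> lhom (H E) K" "alg E" "P K" "\<phi> \<cdot> d E = \<psi> \<cdot> d E"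
  shows "\<phi> = \<psi>"
  using lift_ex[OF lhom_comp[OF unit_lhom[OF assms(3)] assms(1)] assms(4)] assms by (elim ex1E) auto

text \<open>The defining equation is solved by composing \<open>ihom_post\<close> with the inverse
  of the invertible \<open>ihom_pre\<close>. On elements the equation is the naturality square of
  \<open>d\<close>, which shows that the enriched action sends a homomorphism to its
  reflection.\<close>

lemma refl_hom_props:
  assumes E: "alg E" and E': "alg E'"
  shows refl_hom_in_hom: "refl_hom X L H d E E' \<in> Hom X (em_hom X L E E') (em_hom X L (H E) (H E'))"
    and hom_at_refl_hom: "\<And>n. n \<in> el (em_hom X L E E') \<Longrightarrow>
      hom_at (H E) (H E') (refl_hom X L H d E E' \<cdot> n) \<cdot> d E = d E' \<cdot> hom_at E E' n"
proof -
  note HE = refl_alg[OF E] and HE' = refl_alg[OF E'] and dE = unit_lhom[OF E] and dE' = unit_lhom[OF E']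
  let ?p = "ihom_pre X L E (H E) (H E') (d E)" and ?q = "ihom_post X L E E' (H E') (d E')"
    and ?r = "refl_hom X L H d E E'"
  obtain g where gl: "g \<in> lhom (ihom X L E (H E')) (ihom X L (H E) (H E'))"
    and gp: "g \<cdot> ?p = Id X (em_hom X L (H E) (H E'))" and pg: "?p \<cdot> g = Id X (em_hom X L E (H E'))"
    using ihom_iso[OF E HE' refl_P[OF E']] .
  have g: "g \<in> Hom X (em_hom X L E (H E')) (em_hom X L (H E) (H E'))"
    using lhom_in_hom[OF gl] fst_ihom[OF E HE'] fst_ihom[OF HE HE'] by simp
  note p = ihom_pre_unit_in_hom[OF E HE']
  note ql = ihom_post_lhom[OF dE' E]
  have q: "?q \<in> Hom X (em_hom X L E E') (em_hom X L E (H E'))"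
    using lhom_in_hom[OF ql] fst_ihom[OF E HE'] fst_ihom[OF E E'] by simp
  have ul: "g \<cdot> ?q \<in> lhom (ihom X L E E') (ihom X L (H E) (H E'))" by (rule lhom_comp[OF ql gl])
  have u: "g \<cdot> ?q \<in> Hom X (em_hom X L E E') (em_hom X L (H E) (H E'))" by (rule comp_in_hom[OF q g])
  have pu: "?p \<cdot> g \<cdot> ?q = ?q" using comp_assoc[OF q g p] pg id_comp[OF q] by simp
  have r: "?r = g \<cdot> ?q"
    unfolding refl_hom_def
  proof (rule the_equality)
    show "g \<cdot> ?q \<in> lhom (ihom X L E E') (ihom X L (H E) (H E')) \<and> ?p \<cdot> g \<cdot> ?q = ?q" using ul pu ..
    fix v assume v: "v \<in> lhom (ihom X L E E') (ihom X L (H E) (H E')) \<and> ?p \<cdot> v = ?q"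
    then have v': "v \<in> Hom X (em_hom X L E E') (em_hom X L (H E) (H E'))"
      using lhom_in_hom[of v "ihom X L E E'" "ihom X L (H E) (H E')"] fst_ihom[OF E E'] fst_ihom[OF HE HE']
      by auto
    show "v = g \<cdot> ?q" using comp_assoc[OF v' p g] gp id_comp[OF v'] v by simp
  qed
  show "?r \<in> Hom X (em_hom X L E E') (em_hom X L (H E) (H E'))" unfolding r by (rule u)
  fix n assume n: "n \<in> el (em_hom X L E E')"
  show "hom_at (H E) (H E') (?r \<cdot> n) \<cdot> d E = d E' \<cdot> hom_at E E' n"
    unfolding r hom_at_ihom_post[OF dE' E n, symmetric]
    using hom_at_ihom_pre[OF dE HE' comp_in_hom[OF n u]] comp_el[OF n u p] pu by simp
qed

section \<open>The accessible distribution monad through its universal property\<close>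

abbreviation D :: "('o, 'a) vmonad" where
  "D \<equiv> accessible_distribution_monad X L H d"

lemma D_simps:
  "TOb D A = fst (H (free L A))" "TUnit D A = d (free L A) \<cdot> TUnit L A"
  "THom D A B = em_incl X L (H (free L A)) (H (free L B)) \<cdot>
     refl_hom X L H d (free L A) (free L B) \<cdot> free_hom X L A B"
  unfolding accessible_distribution_monad_def by simp_all

context
  fixes A assumes A: "A \<in> Ob X"
begin

lemma D_alg: "alg (H (free L A))" and D_P: "P (H (free L A))"
  by (rule refl_alg refl_P; rule alg_free[OF A])+

lemma D_unit_in_hom: "TUnit D A \<in> Hom X A (TOb D A)"
  unfolding D_simps
  using comp_in_hom[OF TUnit_in_hom[OF A]] lhom_in_hom[OF unit_lhom[OF alg_free[OF A]]] by simp

lemma D_unit_el: "x \<in> el A \<Longrightarrow> TUnit D A \<cdot> x = d (free L A) \<cdot> TUnit L A \<cdot> x"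
  unfolding D_simps
  using comp_el[OF _ TUnit_in_hom[OF A]] lhom_in_hom[OF unit_lhom[OF alg_free[OF A]]] by simp

text \<open>\<open>H (free L A)\<close> is the free reflective algebra on A: a homomorphism out of
  it is determined along \<open>d\<close> by reflectivity, and then along the unit of
  \<open>L\<close> by freeness.\<close>

lemma D_lhom_unique:
  assumes f: "\<phi> \<in> lhom (H (free L A)) K" and g: "\<psi> \<in> lhom (H (free L A)) K" and K: "P K"
    and eq: "\<And>x. x \<in> el A \<Longrightarrow> \<phi> \<cdot> TUnit D A \<cdot> x = \<psi> \<cdot> TUnit D A \<cdot> x"
  shows "\<phi> = \<psi>"
proof (rule lift_unique[OF f g alg_free[OF A] K])
  note dl = unit_lhom[OF alg_free[OF A]]
  note d = lhom_in_hom[OF dl, simplified] and f' = lhom_in_hom[OF f] and g' = lhom_in_hom[OF g]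
  show "\<phi> \<cdot> d (free L A) = \<psi> \<cdot> d (free L A)"
  proof (rule free_lhom_unique[OF lhom_comp[OF dl f] lhom_comp[OF dl g] A])
    fix x assume x: "x \<in> el A"
    note u = comp_in_hom[OF x TUnit_in_hom[OF A]]
    show "(\<phi> \<cdot> d (free L A)) \<cdot> TUnit L A \<cdot> x = (\<psi> \<cdot> d (free L A)) \<cdot> TUnit L A \<cdot> x"
      unfolding comp_el[OF u d f'] comp_el[OF u d g'] using eq[OF x] D_unit_el[OF x] by simp
  qed
qed

text \<open>Both factors in the definition of the multiplication are lifts along \<open>d\<close>;
  cancelling them shows that the multiplication is the homomorphic extension along \<open>d\<close>
  of the algebra structure of \<open>H (free L A)\<close>. Calculations with it go through this
  description.\<close>

lemma D_mult_lhom: "TMult D A \<in> lhom (H (free L (TOb D A))) (H (free L A))"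
  and D_mult_unit: "TMult D A \<cdot> d (free L (TOb D A)) = snd (H (free L A))"
proof -
  let ?E = "H (free L A)"
  let ?m = "refl_map X L H d (free L (fst ?E)) ?E (snd ?E)" and ?k = "refl_mult X L H d (free L A)"
  note E = D_alg and s = struct_lhom[OF D_alg] and dE = unit_lhom[OF D_alg]
  have "?m \<in> lhom (H (free L (fst ?E))) (H ?E) \<and> ?m \<cdot> d (free L (fst ?E)) = d ?E \<cdot> snd ?E"
    unfolding refl_map_def by (rule theI'[OF lift_ex[OF lhom_comp[OF s dE] refl_P[OF E]]])
  then have m: "?m \<in> lhom (H (free L (fst ?E))) (H ?E)"
    and md: "?m \<cdot> d (free L (fst ?E)) = d ?E \<cdot> snd ?E" by blast+
  have "?k \<in> lhom (H ?E) ?E \<and> ?k \<cdot> d ?E = Id X (fst ?E)"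
    unfolding refl_mult_def by (rule theI'[OF lift_ex[OF lhom_id[OF E] D_P]])
  then have k: "?k \<in> lhom (H ?E) ?E" and kd: "?k \<cdot> d ?E = Id X (fst ?E)" by blast+
  have e: "TMult D A = ?k \<cdot> ?m" unfolding accessible_distribution_monad_def by simp
  show "TMult D A \<in> lhom (H (free L (TOb D A))) ?E"
    unfolding e D_simps by (rule lhom_comp[OF m k])
  have "(?k \<cdot> ?m) \<cdot> d (free L (fst ?E)) = ?k \<cdot> ?m \<cdot> d (free L (fst ?E))"
    using unit_lhom[OF alg_free[OF alg_ob[OF E]]] m k by (intro comp_assoc) (auto intro: lhom_in_hom)
  also have "\<dots> = (?k \<cdot> d ?E) \<cdot> snd ?E"
    unfolding md using s dE k lhom_in_hom by (intro comp_assoc[symmetric]) (auto intro: lhom_in_hom)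
  also have "\<dots> = snd ?E" unfolding kd by (rule id_comp[OF alg_struct[OF E]])
  finally show "TMult D A \<cdot> d (free L (TOb D A)) = snd ?E" unfolding e D_simps .
qed

end

lemma D_THom_in_hom:
  assumes A: "A \<in> Ob X" and B: "B \<in> Ob X"
  shows "THom D A B \<in> Hom X (Exp X A B) (Exp X (TOb D A) (TOb D B))"
  unfolding D_simps
  by (rule comp_in_hom[OF comp_in_hom[OF free_hom_in_hom[OF A B]
        refl_hom_in_hom[OF alg_free[OF A] alg_free[OF B]]] em_incl_in_hom[OF D_alg[OF A] D_alg[OF B]]])

text \<open>The hom-action composes the actions of the free functor, the reflection and the
  inclusion, so its value at the name of f is the reflection of the free homomorphism
  \<open>vmap X L A B f\<close>.\<close>

lemma D_vmap_props:
  assumes f: "f \<in> Hom X A B"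
  shows D_vmap_lhom: "vmap X D A B f \<in> lhom (H (free L A)) (H (free L B))"
    and D_vmap_unit: "vmap X D A B f \<cdot> d (free L A) = d (free L B) \<cdot> vmap X L A B f"
proof -
  have A: "A \<in> Ob X" and B: "B \<in> Ob X" using f dom_ob cod_ob by blast+
  note n = name_of_in_hom[OF f] and F = free_hom_in_hom[OF A B]
    and r = refl_hom_in_hom[OF alg_free[OF A] alg_free[OF B]]
    and i = em_incl_in_hom[OF D_alg[OF A] D_alg[OF B]]
  note Fn = comp_in_hom[OF n F]
  have e: "vmap X D A B f = hom_at (H (free L A)) (H (free L B))
      (refl_hom X L H d (free L A) (free L B) \<cdot> free_hom X L A B \<cdot> name_of X A B f)"
    unfolding vmap_def hom_at_def[OF D_alg[OF A] D_alg[OF B]] D_simps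
      comp_el[OF n comp_in_hom[OF F r] i] comp_el[OF n F r] ..
  show "vmap X D A B f \<in> lhom (H (free L A)) (H (free L B))"
    unfolding e by (rule hom_at_lhom[OF D_alg[OF A] D_alg[OF B] comp_in_hom[OF Fn r]])
  show "vmap X D A B f \<cdot> d (free L A) = d (free L B) \<cdot> vmap X L A B f"
    unfolding e hom_at_refl_hom[OF alg_free[OF A] alg_free[OF B] Fn] hom_at_free_hom[OF A B n]
      named_name[OF f] ..
qed

text \<open>In each law both sides are homomorphisms from a reflection into a reflective algebra, so
  \<open>lift_unique\<close> permits comparison after \<open>d\<close>. There functoriality becomes
  functoriality of \<open>L\<close>, and naturality of the multiplication becomes homomorphy of
  \<open>vmap X D A B f\<close>.\<close>

sublocale D: strong_functor_mult X "accessible_distribution_monad X L H d"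
proof
  show "TOb D A \<in> Ob X" if "A \<in> Ob X" for A
    unfolding D_simps using D_alg[OF that] alg_ob by blast
  show "THom D A B \<in> Hom X (Exp X A B) (Exp X (TOb D A) (TOb D B))" if "A \<in> Ob X" "B \<in> Ob X" for A B
    using that by (rule D_THom_in_hom)
  show "TMult D A \<in> Hom X (TOb D (TOb D A)) (TOb D A)" if "A \<in> Ob X" for A
    using lhom_in_hom[OF D_mult_lhom[OF that]] by (simp add: D_simps)
  show "vmap X D A C (g \<cdot> f) = vmap X D B C g \<cdot> vmap X D A B f"
    if f: "f \<in> Hom X A B" and g: "g \<in> Hom X B C" for f g A B C
  proof (rule lift_unique[OF D_vmap_lhom lhom_comp[OF D_vmap_lhom D_vmap_lhom] alg_free D_P])
    have A: "A \<in> Ob X" and B: "B \<in> Ob X" and C: "C \<in> Ob X" using f g dom_ob cod_ob by blast+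
    show "g \<cdot> f \<in> Hom X A C" by (rule comp_in_hom[OF f g])
    show "f \<in> Hom X A B" "g \<in> Hom X B C" "A \<in> Ob X" "C \<in> Ob X" by fact+
    note df = lhom_in_hom[OF unit_lhom[OF alg_free]]
    note Df = lhom_in_hom[OF D_vmap_lhom[OF f]] and Dg = lhom_in_hom[OF D_vmap_lhom[OF g]]
    have "(vmap X D B C g \<cdot> vmap X D A B f) \<cdot> d (free L A) =
        vmap X D B C g \<cdot> d (free L B) \<cdot> vmap X L A B f"
      using comp_assoc[OF df[OF A] Df Dg] D_vmap_unit[OF f] by simp
    also have "\<dots> = d (free L C) \<cdot> vmap X L B C g \<cdot> vmap X L A B f"
      using comp_assoc[OF _ df[OF B] Dg, of "vmap X L A B f" "TOb L A"]
        comp_assoc[OF vmap_in_hom[OF f] vmap_in_hom[OF g], of "d (free L C)"]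
        df[OF C] vmap_in_hom[OF f] D_vmap_unit[OF g] by simp
    finally show "vmap X D A C (g \<cdot> f) \<cdot> d (free L A) =
        (vmap X D B C g \<cdot> vmap X D A B f) \<cdot> d (free L A)"
      using D_vmap_unit[OF comp_in_hom[OF f g]] vmap_comp[OF f g] by simp
  qed
  show "TMult D B \<cdot> vmap X D (TOb D A) (TOb D B) (vmap X D A B f) = vmap X D A B f \<cdot> TMult D A"
    if f: "f \<in> Hom X A B" for f A B
  proof -
    have A: "A \<in> Ob X" and B: "B \<in> Ob X" using f dom_ob cod_ob by blast+
    let ?f = "vmap X D A B f"
    note fl = D_vmap_lhom[OF f]
    have f': "?f \<in> Hom X (TOb D A) (TOb D B)" using lhom_in_hom[OF fl] by (simp add: D_simps)
    have DA: "TOb D A \<in> Ob X" and DB: "TOb D B \<in> Ob X" using f' dom_ob cod_ob by blast+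
    note ffl = D_vmap_lhom[OF f'] and mA = D_mult_lhom[OF A] and mB = D_mult_lhom[OF B]
    note dA = lhom_in_hom[OF unit_lhom[OF alg_free[OF DA]]]
      and dB = lhom_in_hom[OF unit_lhom[OF alg_free[OF DB]]]
    show ?thesis
    proof (rule lift_unique[OF lhom_comp[OF ffl mB] lhom_comp[OF mA fl] alg_free[OF DA] D_P[OF B]])
      have "(TMult D B \<cdot> vmap X D (TOb D A) (TOb D B) ?f) \<cdot> d (free L (TOb D A)) =
          TMult D B \<cdot> d (free L (TOb D B)) \<cdot> vmap X L (TOb D A) (TOb D B) ?f"
        using comp_assoc[OF dA lhom_in_hom[OF ffl] lhom_in_hom[OF mB]] D_vmap_unit[OF f'] by simp
      also have "\<dots> = snd (H (free L B)) \<cdot> vmap X L (TOb D A) (TOb D B) ?f"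
        using comp_assoc[OF _ dB lhom_in_hom[OF mB]] vmap_in_hom[OF f'] D_mult_unit[OF B]
        by (metis free_simps(1))
      also have "\<dots> = ?f \<cdot> snd (H (free L A))"
        using lhom_eq[OF fl] by (simp add: D_simps)
      also have "\<dots> = (?f \<cdot> TMult D A) \<cdot> d (free L (TOb D A))"
        using comp_assoc[OF dA lhom_in_hom[OF mA] lhom_in_hom[OF fl]] D_mult_unit[OF A] by simp
      finally show "(TMult D B \<cdot> vmap X D (TOb D A) (TOb D B) ?f) \<cdot> d (free L (TOb D A)) =
          (?f \<cdot> TMult D A) \<cdot> d (free L (TOb D A))" .
    qed
  qed
qed

section \<open>Commutativity of the accessible distribution monad\<close>

lemma D_ext_lhom:
  assumes A: "A \<in> Ob X" and C: "C \<in> Ob X" and g: "g \<in> Hom X A (TOb D C)"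
  shows "TMult D C \<cdot> vmap X D A (TOb D C) g \<in> lhom (H (free L A)) (H (free L C))"
  by (rule lhom_comp[OF D_vmap_lhom[OF g] D_mult_lhom[OF C]])

text \<open>Integration against a point mass is evaluation. Naturality of \<open>d\<close> and
  \<open>D_mult_unit\<close> reduce this to the same fact for the \<open>L\<close>-algebra
  \<open>H (free L C)\<close>.\<close>

lemma D_ext_unit:
  assumes A: "A \<in> Ob X" and C: "C \<in> Ob X" and g: "g \<in> Hom X A (TOb D C)" and x: "x \<in> el A"
  shows "TMult D C \<cdot> vmap X D A (TOb D C) g \<cdot> TUnit D A \<cdot> x = g \<cdot> x"
proof -
  let ?K = "H (free L C)"
  have DC: "TOb D C \<in> Ob X" using g cod_ob by blast
  have g': "g \<in> Hom X A (fst ?K)" using g by (simp add: D_simps)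
  note u = comp_in_hom[OF x TUnit_in_hom[OF A]]
  note dA = lhom_in_hom[OF unit_lhom[OF alg_free[OF A]], simplified]
    and dC = lhom_in_hom[OF unit_lhom[OF alg_free[OF DC]], simplified]
  note Dg = lhom_in_hom[OF D_vmap_lhom[OF g]] and m = lhom_in_hom[OF D_mult_lhom[OF C]]
  note Lgu = comp_in_hom[OF u vmap_in_hom[OF g]]
  have "vmap X D A (TOb D C) g \<cdot> TUnit D A \<cdot> x =
      (vmap X D A (TOb D C) g \<cdot> d (free L A)) \<cdot> TUnit L A \<cdot> x"
    unfolding D_unit_el[OF A x] by (rule comp_el[OF u dA Dg, symmetric])
  also have "\<dots> = d (free L (TOb D C)) \<cdot> vmap X L A (TOb D C) g \<cdot> TUnit L A \<cdot> x"
    unfolding D_vmap_unit[OF g] by (rule comp_el[OF u vmap_in_hom[OF g] dC])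
  finally have "TMult D C \<cdot> vmap X D A (TOb D C) g \<cdot> TUnit D A \<cdot> x =
      (TMult D C \<cdot> d (free L (TOb D C))) \<cdot> vmap X L A (TOb D C) g \<cdot> TUnit L A \<cdot> x"
    using comp_el[OF Lgu dC m] by simp
  then show ?thesis
    unfolding D_mult_unit[OF C] using ext_unit[OF D_alg[OF C] g' x] by (simp add: D_simps)
qed

text \<open>The iterated integral \<open>\<integral>\<^sub>y\<integral>\<^sub>x f(x,y) d\<mu> d\<nu>\<close> is the \<open>\<nu>\<close>-component of the homomorphism
  \<open>HFA \<rightarrow> ihom(FB,HFC) \<cong> ihom(HFB,HFC)\<close> obtained from \<open>f\<close>.\<close>

lemma iterated_lhom:
  assumes A: "A \<in> Ob X" and B: "B \<in> Ob X" and C: "C \<in> Ob X"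
    and f: "f \<in> Hom X (A \<times>\<^bsub>X\<^esub> B) (TOb D C)" and \<nu>: "\<nu> \<in> el (TOb D B)"
  obtains w where "w \<in> lhom (H (free L A)) (H (free L C))"
    and "\<And>\<mu>. \<mu> \<in> el (TOb D A) \<Longrightarrow> w \<cdot> \<mu> = TMult D C \<cdot>
      vmap X D B (TOb D C) (D.inner1 A B (TOb D C) (TMult D C) f \<mu>) \<cdot> \<nu>"
proof -
  let ?DA = "TOb D A" and ?DC = "TOb D C" and ?m = "TMult D C" and ?K = "H (free L C)"
  let ?AB = "A \<times>\<^bsub>X\<^esub> B"
  let ?q = "D.inner1 A B ?DC ?m f"
  note DA = D.TOb_ob[OF A] and DB = D.TOb_ob[OF B] and DC = D.TOb_ob[OF C]
  note LB = TOb_ob[OF B]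
  note K = D_alg[OF C] and PK = D_P[OF C] and FB = alg_free[OF B] and HFB = D_alg[OF B]
    and HFA = D_alg[OF A]
  have Kob: "fst ?K = ?DC" and HA: "fst (H (free L A)) = ?DA" and HB: "fst (H (free L B)) = TOb D B"
    by (simp_all add: D_simps)
  note k = alg_struct[OF K, unfolded Kob] and m = D.TMult_in_hom[OF C]
  note q = D.inner1_in_hom[OF A B m f] and q_el = D.inner1_el[OF A B m f]
  note t = D.strength1_in_hom[OF A B] and Df = D.vmap_in_hom[OF f]
  note Dft = comp_in_hom[OF t Df]
  note mDft = comp_in_hom[OF Dft m]
  \<comment> \<open>\<open>r\<close> sends \<mu> to the name of the inner integral
    \<open>?q \<mu>\<close>, making the inner integral a morphism in \<mu>.\<close>
  define r where "r = curry X ?DA B ?DC (?m \<cdot> vmap X D ?AB ?DC f \<cdot> strength1 X D A B)"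
  have r: "r \<in> Hom X ?DA (Exp X B ?DC)" unfolding r_def by (rule curry_in_hom[OF mDft DA B])
  have rq: "named_by X B ?DC (r \<cdot> \<mu>) = ?q \<mu>" if \<mu>: "\<mu> \<in> el ?DA" for \<mu>
  proof (rule ext[OF named_by_in_hom[OF comp_in_hom[OF \<mu> r] B DC] q[OF \<mu>]])
    fix y assume y: "y \<in> el B"
    note p = point_in_hom[OF \<mu> y]
    show "named_by X B ?DC (r \<cdot> \<mu>) \<cdot> y = ?q \<mu> \<cdot> y"
      unfolding named_by_el[OF comp_in_hom[OF \<mu> r] y DC] q_el[OF \<mu> y]
        D.vmap_comp_el[OF sec1_in_hom[OF y A] f \<mu>]
      unfolding r_def curry_el[OF mDft \<mu> y] comp_el[OF p Dft m] comp_el[OF p t Df]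
        D.strength1_el[OF A B \<mu> y] ..
  qed
  \<comment> \<open>\<open>h\<close> extends each inner integral from B to the free algebra on B,
    uniformly in \<mu>; its values are homomorphisms, so it factors through the hom-object.\<close>
  define h where "h = exp_post X (TOb L B) (TOb L ?DC) ?DC (snd ?K) \<cdot> THom L B ?DC \<cdot> r"
  note tr = comp_in_hom[OF r THom_in_hom[OF B DC]]
  note po = exp_post_in_hom[OF k LB]
  have h: "h \<in> Hom X ?DA (Exp X (TOb L B) ?DC)" unfolding h_def by (rule comp_in_hom[OF tr po])
  have Lq: "snd ?K \<cdot> vmap X L B ?DC (?q \<mu>) \<in> lhom (free L B) ?K" if \<mu>: "\<mu> \<in> el ?DA" for \<mu>
    using ext_lhom[OF K, unfolded Kob, OF q[OF \<mu>]] .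
  have hq: "named_by X (TOb L B) ?DC (h \<cdot> \<mu>) = snd ?K \<cdot> vmap X L B ?DC (?q \<mu>)"
    if \<mu>: "\<mu> \<in> el ?DA" for \<mu>
  proof (rule ext[OF named_by_in_hom[OF comp_in_hom[OF \<mu> h] LB DC]
        comp_in_hom[OF vmap_in_hom[OF q[OF \<mu>]] k]])
    fix v assume v: "v \<in> el (TOb L B)"
    note rm = comp_in_hom[OF \<mu> r]
    show "named_by X (TOb L B) ?DC (h \<cdot> \<mu>) \<cdot> v = (snd ?K \<cdot> vmap X L B ?DC (?q \<mu>)) \<cdot> v"
      unfolding named_by_el[OF comp_in_hom[OF \<mu> h] v DC] comp_el[OF v vmap_in_hom[OF q[OF \<mu>]] k]
      unfolding h_def comp_el[OF \<mu> tr po] comp_el[OF \<mu> r THom_in_hom[OF B DC]]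
        exp_post_el[OF k LB comp_in_hom[OF rm THom_in_hom[OF B DC]] v] THom_el[OF rm B DC v]
        rq[OF \<mu>] ..
  qed
  have "\<exists>!u. u \<in> Hom X ?DA (em_hom X L (free L B) ?K) \<and> em_incl X L (free L B) ?K \<cdot> u = h"
    by (rule em_factor[OF FB K]) (use h hq Lq Kob in auto)
  then obtain u where u: "u \<in> Hom X ?DA (em_hom X L (free L B) ?K)"
    and iu: "em_incl X L (free L B) ?K \<cdot> u = h" by blast
  have uq: "hom_at (free L B) ?K (u \<cdot> \<mu>) = snd ?K \<cdot> vmap X L B ?DC (?q \<mu>)" if \<mu>: "\<mu> \<in> el ?DA" for \<mu>
    using hq[OF \<mu>] comp_el[OF \<mu> u em_incl_in_hom[OF FB K]] iu Kob
    unfolding hom_at_def[OF FB K] by simp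
  have uq_unit: "hom_at (free L B) ?K (u \<cdot> \<mu>) \<cdot> TUnit L B \<cdot> y = ?q \<mu> \<cdot> y"
    if \<mu>: "\<mu> \<in> el ?DA" and y: "y \<in> el B" for \<mu> y
    unfolding uq[OF \<mu>] comp_el[OF comp_in_hom[OF y TUnit_in_hom[OF B]] vmap_in_hom[OF q[OF \<mu>]] k]
    using ext_unit[OF K _ y, unfolded Kob, OF q[OF \<mu>]] .
  \<comment> \<open>Only evaluations at units of y in B have to be tested. Such an evaluation sends
    \<mu> to the integral of f(-,y) against \<mu>, the homomorphic extension of f(-,y).\<close>
  have ul: "u \<in> lhom (H (free L A)) (ihom X L (free L B) ?K)"
  proof (rule lhom_into_ihom[OF FB K HFA _ generates_unit[OF B]])
    show "u \<in> Hom X (fst (H (free L A))) (em_hom X L (free L B) ?K)" using u HA by simp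
    fix z assume "z \<in> (\<lambda>x. TUnit L B \<cdot> x) ` el B"
    then obtain y where y: "y \<in> el B" and z: "z = TUnit L B \<cdot> y" by blast
    have z': "z \<in> el (fst (free L B))" using comp_in_hom[OF y TUnit_in_hom[OF B]] z by simp
    note fy = comp_in_hom[OF sec1_in_hom[OF y A] f]
    note e = em_ev_in_hom[OF FB K z', unfolded Kob]
    have "em_ev (free L B) ?K z \<cdot> u = ?m \<cdot> vmap X D A ?DC (f \<cdot> sec1 A B y)"
    proof (rule ext[OF comp_in_hom[OF u e] comp_in_hom[OF D.vmap_in_hom[OF fy] m]])
      fix \<mu> assume \<mu>: "\<mu> \<in> el ?DA"
      show "(em_ev (free L B) ?K z \<cdot> u) \<cdot> \<mu> = (?m \<cdot> vmap X D A ?DC (f \<cdot> sec1 A B y)) \<cdot> \<mu>"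
        unfolding comp_el[OF \<mu> u e] em_ev_el[OF FB K z' comp_in_hom[OF \<mu> u]]
        unfolding z uq_unit[OF \<mu> y]
          q_el[OF \<mu> y] comp_el[OF \<mu> D.vmap_in_hom[OF fy] m] ..
    qed
    then show "em_ev (free L B) ?K z \<cdot> u \<in> lhom (H (free L A)) ?K"
      using D_ext_lhom[OF A C fy] by simp
  qed
  \<comment> \<open>The inverse of precomposition with \<open>d\<close> is a homomorphism of
    internal homs, so extending the inner integrals from \<open>F B\<close> to \<open>H F B\<close>
    preserves homomorphy in \<mu>.\<close>
  let ?p = "ihom_pre X L (free L B) (H (free L B)) ?K (d (free L B))"
  note p = ihom_pre_unit_in_hom[OF FB K] and dB = unit_lhom[OF FB]
  obtain g where gl: "g \<in> lhom (ihom X L (free L B) ?K) (ihom X L (H (free L B)) ?K)"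
    and pg: "?p \<cdot> g = Id X (em_hom X L (free L B) ?K)"
    using ihom_iso[OF FB K PK] .
  have g: "g \<in> Hom X (em_hom X L (free L B) ?K) (em_hom X L (H (free L B)) ?K)"
    using lhom_in_hom[OF gl] fst_ihom[OF FB K] fst_ihom[OF HFB K] by simp
  note gu = comp_in_hom[OF u g]
  have \<nu>': "\<nu> \<in> el (fst (H (free L B)))" using \<nu> HB by simp
  \<comment> \<open>The extension is identified as integration of \<open>?q \<mu>\<close>: both are
    homomorphisms on \<open>H F B\<close> that restrict to \<open>?q \<mu>\<close> along the unit of
    B.\<close>
  have at: "hom_at (H (free L B)) ?K (g \<cdot> u \<cdot> \<mu>) = ?m \<cdot> vmap X D B ?DC (?q \<mu>)" if \<mu>: "\<mu> \<in> el ?DA" for \<mu>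
  proof -
    note um = comp_in_hom[OF \<mu> u]
    note gum = comp_in_hom[OF um g]
    note l = hom_at_lhom[OF HFB K gum]
    have pgu: "hom_at (H (free L B)) ?K (g \<cdot> u \<cdot> \<mu>) \<cdot> d (free L B) = hom_at (free L B) ?K (u \<cdot> \<mu>)"
      using hom_at_ihom_pre[OF dB K gum] comp_el[OF um g p] pg id_comp[OF um] by simp
    show ?thesis
    proof (rule D_lhom_unique[OF B l D_ext_lhom[OF B C q[OF \<mu>]] PK])
      fix y assume y: "y \<in> el B"
      note b = comp_in_hom[OF y D_unit_in_hom[OF B]] and u' = comp_in_hom[OF y TUnit_in_hom[OF B]]
      have "hom_at (H (free L B)) ?K (g \<cdot> u \<cdot> \<mu>) \<cdot> TUnit D B \<cdot> y =
          (hom_at (H (free L B)) ?K (g \<cdot> u \<cdot> \<mu>) \<cdot> d (free L B)) \<cdot> TUnit L B \<cdot> y"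
        unfolding D_unit_el[OF B y]
        using comp_el[OF u' _ lhom_in_hom[OF l]] lhom_in_hom[OF dB] by simp
      also have "\<dots> = (?m \<cdot> vmap X D B ?DC (?q \<mu>)) \<cdot> TUnit D B \<cdot> y"
        unfolding pgu uq_unit[OF \<mu> y] comp_el[OF b D.vmap_in_hom[OF q[OF \<mu>]] m]
        by (rule D_ext_unit[OF B C q[OF \<mu>] y, symmetric])
      finally show "hom_at (H (free L B)) ?K (g \<cdot> u \<cdot> \<mu>) \<cdot> TUnit D B \<cdot> y =
          (?m \<cdot> vmap X D B ?DC (?q \<mu>)) \<cdot> TUnit D B \<cdot> y" .
    qed
  qed
  note e = em_ev_in_hom[OF HFB K \<nu>']
  show thesis
  proof
    show "em_ev (H (free L B)) ?K \<nu> \<cdot> g \<cdot> u \<in> lhom (H (free L A)) ?K"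
      by (rule lhom_comp[OF lhom_comp[OF ul gl] em_ev_lhom[OF HFB K \<nu>']])
    fix \<mu> assume \<mu>: "\<mu> \<in> el ?DA"
    note gum = comp_in_hom[OF comp_in_hom[OF \<mu> u] g]
    show "(em_ev (H (free L B)) ?K \<nu> \<cdot> g \<cdot> u) \<cdot> \<mu> = ?m \<cdot> vmap X D B ?DC (?q \<mu>) \<cdot> \<nu>"
      unfolding comp_el[OF \<mu> gu e] comp_el[OF \<mu> u g] em_ev_el[OF HFB K \<nu>' gum] at[OF \<mu>]
      by (rule comp_el[OF \<nu> D.vmap_in_hom[OF q[OF \<mu>]] m])
  qed
qed

text \<open>Both sides agree after \<open>d\<close> because the multiplication is a homomorphism of
  \<open>L\<close>-algebras. This supplies the associativity hypothesis of
  \<open>integral_otimes\<close> when the values lie in \<open>TOb D C\<close>.\<close>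

lemma D_mult_assoc:
  assumes C: "C \<in> Ob X"
  shows "TMult D C \<cdot> vmap X D (TOb D (TOb D C)) (TOb D C) (TMult D C) =
    TMult D C \<cdot> TMult D (TOb D C)"
proof -
  let ?DC = "TOb D C" and ?m = "TMult D C"
  note DC = D.TOb_ob[OF C] and m = D.TMult_in_hom[OF C]
  note DDC = D.TOb_ob[OF DC]
  note ml = D_mult_lhom[OF C] and mm = D_mult_lhom[OF DC] and Dm = D_vmap_lhom[OF m]
  note d1 = lhom_in_hom[OF unit_lhom[OF alg_free[OF DDC]]]
    and d2 = lhom_in_hom[OF unit_lhom[OF alg_free[OF DC]], simplified]
  show ?thesis
  proof (rule lift_unique[OF lhom_comp[OF Dm ml] lhom_comp[OF mm ml] alg_free[OF DDC] D_P[OF C]])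
    have "(?m \<cdot> vmap X D (TOb D ?DC) ?DC ?m) \<cdot> d (free L (TOb D ?DC)) =
        ?m \<cdot> d (free L ?DC) \<cdot> vmap X L (TOb D ?DC) ?DC ?m"
      using comp_assoc[OF d1 lhom_in_hom[OF Dm] lhom_in_hom[OF ml]] D_vmap_unit[OF m] by simp
    also have "\<dots> = snd (H (free L C)) \<cdot> vmap X L (TOb D ?DC) ?DC ?m"
      using comp_assoc[OF vmap_in_hom[OF m] d2 lhom_in_hom[OF ml]] D_mult_unit[OF C] by simp
    also have "\<dots> = ?m \<cdot> snd (H (free L ?DC))"
      using lhom_eq[OF ml] by (simp add: D_simps)
    also have "\<dots> = (?m \<cdot> TMult D ?DC) \<cdot> d (free L (TOb D ?DC))"
      using comp_assoc[OF d1 lhom_in_hom[OF mm] lhom_in_hom[OF ml]] D_mult_unit[OF DC] by simp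
    finally show "(?m \<cdot> vmap X D (TOb D ?DC) ?DC ?m) \<cdot> d (free L (TOb D ?DC)) =
        (?m \<cdot> TMult D ?DC) \<cdot> d (free L (TOb D ?DC))" .
  qed
qed

text \<open>Commutativity is Fubini for the unit of \<open>A \<times> B\<close> as integrand, with
  values in \<open>TOb D (A \<times> B)\<close>.\<close>

lemma D_commutative_el:
  assumes A: "A \<in> Ob X" and B: "B \<in> Ob X" and \<mu>: "\<mu> \<in> el (TOb D A)" and \<nu>: "\<nu> \<in> el (TOb D B)"
  shows "otimes X D A B \<cdot> point X (TOb D A) (TOb D B) \<mu> \<nu> =
    otimes_tilde X D A B \<cdot> point X (TOb D A) (TOb D B) \<mu> \<nu>"
proof -
  let ?C = "A \<times>\<^bsub>X\<^esub> B"
  let ?DC = "TOb D ?C" and ?m = "TMult D ?C" and ?f = "TUnit D ?C"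
  note C = prod_ob[OF A B]
  note DC = D.TOb_ob[OF C] and f = D_unit_in_hom[OF C] and m = D.TMult_in_hom[OF C]
  note q = D.inner1_in_hom[OF A B m f] and p = D.inner2_in_hom[OF A B m f \<nu>]
  have DD: "fst (H (free L ?C)) = ?DC" by (simp add: D_simps)
  have idl: "Id X ?DC \<in> lhom (H (free L ?C)) (H (free L ?C))"
    using lhom_id[OF D_alg[OF C]] DD by simp
  \<comment> \<open>Integrating the unit against a distribution returns that distribution, so
    equality of the two integrals of \<open>?f\<close> gives equality of the two tensors.\<close>
  have mf: "?m \<cdot> vmap X D ?C ?DC ?f = Id X ?DC"
  proof (rule D_lhom_unique[OF C D_ext_lhom[OF C C f] idl D_P[OF C]])
    fix x assume x: "x \<in> el ?C"
    note fx = comp_in_hom[OF x f]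
    show "(?m \<cdot> vmap X D ?C ?DC ?f) \<cdot> ?f \<cdot> x = Id X ?DC \<cdot> ?f \<cdot> x"
      unfolding comp_el[OF fx D.vmap_in_hom[OF f] m] D_ext_unit[OF C C f x] id_comp[OF fx] ..
  qed
  note assoc = D_mult_assoc[OF C]
  let ?q = "D.inner1 A B ?DC ?m ?f" and ?p = "D.inner2 A B ?DC ?m ?f \<nu>"
  obtain w where w: "w \<in> lhom (H (free L A)) (H (free L ?C))"
    and wq: "\<And>\<mu>. \<mu> \<in> el (TOb D A) \<Longrightarrow> w \<cdot> \<mu> = ?m \<cdot> vmap X D B ?DC (?q \<mu>) \<cdot> \<nu>"
    by (rule iterated_lhom[OF A B C f \<nu>]) blast
  have "w = ?m \<cdot> vmap X D A ?DC ?p"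
  proof (rule D_lhom_unique[OF A w D_ext_lhom[OF A C p] D_P[OF C]])
    fix x assume x: "x \<in> el A"
    note ux = comp_in_hom[OF x D_unit_in_hom[OF A]]
    note fx = comp_in_hom[OF sec2_in_hom[OF x B] f]
    \<comment> \<open>For \<mu> the unit at x the inner integral is f(x,-), so \<open>w\<close>
      sends this unit to the integral of f(x,-) against \<nu>, which is also the value of
      \<open>?p\<close> at x.\<close>
    have "?q (TUnit D A \<cdot> x) = ?f \<cdot> sec2 A B x"
    proof (rule ext[OF q[OF ux] fx])
      fix y assume y: "y \<in> el B"
      note fy = comp_in_hom[OF sec1_in_hom[OF y A] f]
      show "?q (TUnit D A \<cdot> x) \<cdot> y = (?f \<cdot> sec2 A B x) \<cdot> y"
        unfolding D.inner1_el[OF A B m f ux y] D_ext_unit[OF A C fy x]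
          comp_el[OF x sec1_in_hom[OF y A] f] comp_el[OF y sec2_in_hom[OF x B] f]
          sec1_el[OF y x] sec2_el[OF x y] ..
    qed
    then show "w \<cdot> TUnit D A \<cdot> x = (?m \<cdot> vmap X D A ?DC ?p) \<cdot> TUnit D A \<cdot> x"
      unfolding wq[OF ux] comp_el[OF ux D.vmap_in_hom[OF p] m] D_ext_unit[OF A C p x]
        D.inner2_el[OF A B m f \<nu> x] by simp
  qed
  then have "?m \<cdot> vmap X D B ?DC (?q \<mu>) \<cdot> \<nu> = ?m \<cdot> vmap X D A ?DC ?p \<cdot> \<mu>"
    using wq[OF \<mu>] comp_el[OF \<mu> D.vmap_in_hom[OF p] m] by simp
  then have eq: "?m \<cdot> vmap X D ?C ?DC ?f \<cdot> otimes X D A B \<cdot> point X (TOb D A) (TOb D B) \<mu> \<nu> =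
      ?m \<cdot> vmap X D ?C ?DC ?f \<cdot> otimes_tilde X D A B \<cdot> point X (TOb D A) (TOb D B) \<mu> \<nu>"
    unfolding D.integral_otimes[OF A B m f assoc \<mu> \<nu>] D.integral_otimes_tilde[OF A B m f assoc \<mu> \<nu>] .
  have "?m \<cdot> vmap X D ?C ?DC ?f \<cdot> z = z" if z: "z \<in> el ?DC" for z
    using comp_el[OF z D.vmap_in_hom[OF f] m] mf id_comp[OF z] by simp
  then show ?thesis
    using eq comp_in_hom[OF point_in_hom[OF \<mu> \<nu>] D.otimes_in_hom[OF A B]]
      comp_in_hom[OF point_in_hom[OF \<mu> \<nu>] D.otimes_tilde_in_hom[OF A B]] by simp
qed

end

theorem theorem8p7p5:
  fixes X :: "('o, 'a) ccc"
    and L D :: "('o, 'a) vmonad"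
    and H :: "'o \<times> 'a \<Rightarrow> 'o \<times> 'a" and d :: "'o \<times> 'a \<Rightarrow> 'a"
    and A B Z :: 'o and a f \<mu> \<nu> :: 'a
  assumes "cartesian_closed X"
    and "well_pointed X"
    and "finitely_well_complete X"
    and "is_commutative_vmonad X L"
    and "has_tensor_products X L"
    and "is_L_reflection X L (functionally_complete X L) H d"
    and "D = accessible_distribution_monad X L H d"
    and "(Z, a) \<in> Ob (EM X D)"
    and "A \<in> Ob X" and "B \<in> Ob X"
    and "f \<in> Hom X (A \<times>\<^bsub>X\<^esub> B) Z"
    and "\<mu> \<in> elements X (TOb D A)"
    and "\<nu> \<in> elements X (TOb D B)"
  shows "integral_fun X D (Z, a) B
           (\<lambda>y. integral_fun X D (Z, a) A (\<lambda>x. f \<cdot>\<^bsub>X\<^esub> point X A B x y) \<mu>) \<nu> =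
         integral X D (Z, a) (A \<times>\<^bsub>X\<^esub> B) f (product_distribution X D A B \<mu> \<nu>)
       \<and> integral X D (Z, a) (A \<times>\<^bsub>X\<^esub> B) f (product_distribution X D A B \<mu> \<nu>) =
         integral_fun X D (Z, a) A
           (\<lambda>x. integral_fun X D (Z, a) B (\<lambda>y. f \<cdot>\<^bsub>X\<^esub> point X A B x y) \<nu>) \<mu>"
proof -
  interpret well_pointed_ccc X
    by (intro well_pointed_ccc.intro well_pointed_ccc_axioms.intro) fact+
  interpret commutative_monad X L
    using assms(3,4) by (intro commutative_monadI) (auto simp: finitely_well_complete_def)
  interpret R: algebra_reflection X L "functionally_complete X L" H d
    by unfold_locales fact
  note D = assms(7) and A = assms(9) and B = assms(10) and f = assms(11)
  have a: "a \<in> Hom X (TOb D Z) Z" and assoc: "a \<cdot>\<^bsub>X\<^esub> vmap X D (TOb D Z) Z a = a \<cdot>\<^bsub>X\<^esub> TMult D Z"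
    using assms(8) by (auto simp: EM_def algebras_def)
  have \<mu>: "\<mu> \<in> el (TOb D A)" and \<nu>: "\<nu> \<in> el (TOb D B)" using assms(12,13) by (auto simp: elements_def)
  \<comment> \<open>The algebra and the integrand are now the given ones. Each tensor yields one
    order of integration, and the two tensors are the same element of
    \<open>TOb D (A \<times> B)\<close>.\<close>
  note facts = R.D.iterated_integral1[folded D, OF A B a f \<mu>, of \<nu>]
    R.D.iterated_integral2[folded D, OF A B a f \<nu>, of \<mu>]
    R.D.integral_otimes[folded D, OF A B a f assoc \<mu> \<nu>]
    R.D.integral_otimes_tilde[folded D, OF A B a f assoc \<mu> \<nu>]
    R.D_commutative_el[folded D, OF A B \<mu> \<nu>]
  show ?thesis
    unfolding facts(1,2) product_distribution_def integral_def using facts(3-5) by simp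
qed

end
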